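(* Assume $\alpha=2$, so that $\rho=1/2$ and $L=\sqrt2\,B$ with $B$ a Brownian motion. For every $x<0$, under $\mathbb{P}_{(x,0)}$ one has the identity in law $$L_{T_0}\;\overset{d}{=}\;|9x|^{1/3}\left(\frac{\mathbf{\Gamma}_{5/6}}{\mathbf{B}_{1/6,1/6}}\right)^{1/3},$$ where $\mathbf{\Gamma}_{5/6}$ and $\mathbf{B}_{1/6,1/6}$ are independent.
   Context: $B$ is a standard real Brownian motion and $L=\sqrt2\,B$, so that $\mathbb{E}[e^{i\lambda L_1}]=e^{-\lambda^2}$ when $L$ starts from $0$. For $(x,y)\in\mathbb{R}^2$, $\mathbb{P}_{(x,y)}$ denotes the law of the Markov process $(X,L)$ started at $(x,y)$, i.e. $L$ starts at $y$ and $X_t=x+\int_0^tL_s\,ds$. $T_0=\inf\{t>0:\,X_t=0\}$, and $L_{T_0}$ is the value of $L$ at time $T_0$. $\mathbf{\Gamma}_c$ is the standard Gamma random variable, with density $\frac{1}{\Gamma(c)}u^{c-1}e^{-u}$ on $(0,\infty)$, and $\mathbf{B}_{a,b}$ is the standard Beta random variable, with density $\frac{\Gamma(a+b)}{\Gamma(a)\Gamma(b)}u^{a-1}(1-u)^{b-1}$ on $(0,1)$. *)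

theory Defs
  imports "HOL-Probability.Probability"
begin

text \<open>
  Paths are continuous everywhere on the sample space, not just almost surely: the space need not
  be complete, and path functionals such as hitting times must be measurable on it.
  The second parameter of \<^const>\<open>normal_density\<close> is the standard deviation.
\<close>

definition standard_brownian_motion :: "'a measure \<Rightarrow> (real \<Rightarrow> 'a \<Rightarrow> real) \<Rightarrow> bool" where
  "standard_brownian_motion M B \<longleftrightarrow>
     prob_space M \<and>
     (\<forall>t\<ge>0. B t \<in> borel_measurable M) \<and>
     (AE \<omega> in M. B 0 \<omega> = 0) \<and>
     (\<forall>(n::nat) (t::nat \<Rightarrow> real). 0 \<le> t 0 \<and> (\<forall>i<n. t i < t (Suc i)) \<longrightarrow>
        prob_space.indep_vars M (\<lambda>_. borel) (\<lambda>i \<omega>. B (t (Suc i)) \<omega> - B (t i) \<omega>) {..<n}) \<and>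
     (\<forall>s t. 0 \<le> s \<and> s < t \<longrightarrow>
        distributed M lborel (\<lambda>\<omega>. B t \<omega> - B s \<omega>) (normal_density 0 (sqrt (t - s)))) \<and>
     (\<forall>\<omega>\<in>space M. continuous_on {0..} (\<lambda>t. B t \<omega>))"

text \<open>
  The process $(X, L)$ started at $(x, y)$, realised from a standard Brownian motion $B$.
\<close>

definition L_proc :: "(real \<Rightarrow> 'a \<Rightarrow> real) \<Rightarrow> real \<Rightarrow> real \<Rightarrow> 'a \<Rightarrow> real" where
  "L_proc B y t \<omega> = y + sqrt 2 * B t \<omega>"

definition X_proc :: "(real \<Rightarrow> 'a \<Rightarrow> real) \<Rightarrow> real \<Rightarrow> real \<Rightarrow> real \<Rightarrow> 'a \<Rightarrow> real" where
  "X_proc B x y t \<omega> = x + integral {0..t} (\<lambda>s. L_proc B y s \<omega>)"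

definition T_zero :: "(real \<Rightarrow> 'a \<Rightarrow> real) \<Rightarrow> real \<Rightarrow> real \<Rightarrow> 'a \<Rightarrow> ereal" where
  "T_zero B x y \<omega> = Inf {ereal t | t. 0 < t \<and> X_proc B x y t \<omega> = 0}"

text \<open>
  If $X$ never returns to $0$, then \<^const>\<open>T_zero\<close> is \<open>\<infinity>\<close> and, since \<open>real_of_ereal \<infinity> = 0\<close>,
  the value below is the one at time $0$.
\<close>

definition L_at_T_zero :: "(real \<Rightarrow> 'a \<Rightarrow> real) \<Rightarrow> real \<Rightarrow> real \<Rightarrow> 'a \<Rightarrow> real" where
  "L_at_T_zero B x y \<omega> = L_proc B y (real_of_ereal (T_zero B x y \<omega>)) \<omega>"

definition gamma_density :: "real \<Rightarrow> real \<Rightarrow> real" where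
  "gamma_density c u = (if 0 < u then u powr (c - 1) * exp (- u) / Gamma c else 0)"

definition beta_density :: "real \<Rightarrow> real \<Rightarrow> real \<Rightarrow> real" where
  "beta_density a b u =
     (if 0 < u \<and> u < 1
      then Gamma (a + b) / (Gamma a * Gamma b) * u powr (a - 1) * (1 - u) powr (b - 1) else 0)"

end

theory Submission
  imports Defs "HOL-Complex_Analysis.Complex_Analysis" "HOL-Real_Asymp.Real_Asymp"
begin

text \<open>
  Let \<open>p\<^sub>r\<close> be the transition density of \<open>(X, L)\<close> and \<open>T\<close> the hitting time. The strong Markov property at \<open>T\<close>,
  applied to the occupation density of the point \<open>(0, -w)\<close> with \<open>w > 0\<close>, gives
  \<open>\<integral> p\<^sub>r((x, 0); (0, -w)) dr = E[1\<^bsub>T < \<infinity>\<^esub> \<integral> p\<^sub>r((0, L\<^sub>T); (0, -w)) dr]\<close>, and the inner integral on the right is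
  \<open>(\<surd>3 / 2\<pi>) / (L\<^sub>T\<^sup>2 - L\<^sub>T w + w\<^sup>2)\<close>. Taking Mellin transforms in \<open>w\<close> turns the right-hand side into a product of
  \<open>E[1\<^bsub>T < \<infinity>\<^esub> L\<^sub>T\<^bsup>s-2\<^esup>]\<close> and a factor given by Gamma functions; the left-hand side becomes a Beta integral after
  a cubic substitution. The reflection formula identifies \<open>E[1\<^bsub>T < \<infinity>\<^esub> L\<^sub>T\<^bsup>s-2\<^esup>]\<close> for \<open>0 < s < 2\<close> with the moments
  of the Gamma--Beta quotient. These determine the law by analytic continuation to the imaginary axis and Levy's
  uniqueness theorem; that \<open>T\<close> is almost surely finite is a by-product.
\<close>

section \<open>Integrals over the half line\<close>

text \<open>The velocity \<open>-w\<close> is negative because a path that arrives at position 0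
  with negative velocity comes from the positive side; started at \<open>x < 0\<close> it has
  crossed 0 earlier, so the whole occupation density at (0, -w) is accumulated after T. Conversely
  L_T is nonnegative, since 0 is first reached from below, and this gap between the velocities makes
  the return density integrable near time 0, uniformly in L_T. A point density is no bounded test
  function, so the identity is proved for continuous bumps living in the quarter-plane X > 0, L <
  -w, which are then shrunk to the point. Brownian motion is given through increments over finite
  grids and continuous paths, so the Markov property is assembled from the area and the increment of
  B over one time interval. The cube roots come from the factorisation (u + w) (u^2 - u w + w^2) =
  u^3 + w^3, and the parameters 1/6 from sin (pi a) + sin (pi (a + 1/3)) = sqrt 3 sin (pi (a +
  1/6)).\<close>

lemma nn_integral_halfline_SUP:
  fixes f :: "real \<Rightarrow> ennreal" and a b :: "nat \<Rightarrow> real"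
  assumes f [measurable]: "f \<in> borel_measurable borel"
    and mono: "decseq a" "incseq b" and pos: "\<And>n. 0 < a n"
    and lim: "a \<longlonglongrightarrow> 0" "filterlim b at_top sequentially"
  shows "(\<integral>\<^sup>+x\<in>{0<..}. f x \<partial>lborel) = (SUP n. \<integral>\<^sup>+x\<in>{a n..b n}. f x \<partial>lborel)"
proof -
  have "(\<Union>n. {a n..b n}) = {0<..}"
  proof safe
    fix x :: real assume "x > 0"
    with lim(1) have "eventually (\<lambda>n. a n < x) sequentially" by (auto dest: order_tendstoD)
    moreover from lim(2) have "eventually (\<lambda>n. b n > x) sequentially" by (simp add: filterlim_at_top_dense)
    ultimately have "eventually (\<lambda>n. x \<in> {a n..b n}) sequentially" by eventually_elim auto
    then show "x \<in> (\<Union>n. {a n..b n})" by (auto dest: eventually_happens)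
  qed (use pos in \<open>auto intro: order.strict_trans2\<close>)
  moreover have "incseq (\<lambda>n. {a n..b n})"
    using mono by (intro incseq_SucI) (auto intro: order_trans decseq_SucD incseq_SucD)
  ultimately show ?thesis
    using SUP_emeasure_incseq[of "\<lambda>n. {a n..b n}" "density lborel f"]
    by (simp add: emeasure_density image_subset_iff)
qed

text \<open>Substitution on compact intervals, exhausted from inside: the monotone \<open>g\<close>
  carries one exhaustion of the half line to another, which is why both limits of \<open>g\<close>
  are assumed.\<close>

lemma nn_integral_halfline_substitution:
  fixes f g g' :: "real \<Rightarrow> real"
  assumes f [measurable]: "f \<in> borel_measurable borel"
    and deriv: "\<And>x. 0 < x \<Longrightarrow> (g has_real_derivative g' x) (at x)"
    and cont: "continuous_on {0<..} g'"
    and nonneg: "\<And>x. 0 < x \<Longrightarrow> 0 \<le> g' x"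
    and pos: "\<And>x. 0 < x \<Longrightarrow> 0 < g x"
    and lim0: "(g \<longlongrightarrow> 0) (at_right 0)"
    and liminf: "filterlim g at_top at_top"
  shows "(\<integral>\<^sup>+x\<in>{0<..}. ennreal (f x) \<partial>lborel) = (\<integral>\<^sup>+x\<in>{0<..}. ennreal (f (g x) * g' x) \<partial>lborel)"
proof -
  define a b where "a n = 1 / (real n + 1)" and "b n = real n + 1" for n
  have ab: "0 < a n" "a n \<le> b n" for n by (auto simp: a_def b_def field_simps)
  have mono: "g x \<le> g y" if "0 < x" "x \<le> y" for x y
  proof (rule DERIV_nonneg_imp_nondecreasing[of x y g])
    fix z assume "x \<le> z" "z \<le> y"
    with that have "0 < z" by simp
    with deriv nonneg show "\<exists>d. (g has_real_derivative d) (at z) \<and> 0 \<le> d" by blast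
  qed fact
  have a_lim: "filterlim a (at_right 0) sequentially" unfolding a_def by real_asymp
  have a_lim': "a \<longlonglongrightarrow> 0" unfolding a_def by real_asymp
  have b_lim: "filterlim b at_top sequentially" unfolding b_def by real_asymp
  have dec: "decseq a" "incseq b" by (auto intro!: decseq_SucI incseq_SucI simp: a_def b_def field_simps)
  have dec': "decseq (\<lambda>n. g (a n))" "incseq (\<lambda>n. g (b n))"
    using dec ab by (auto intro!: decseq_SucI incseq_SucI mono intro: decseq_SucD incseq_SucD order.strict_trans2)
  have gcont: "continuous_on {0<..} g"
    using deriv by (auto intro!: continuous_at_imp_continuous_on DERIV_isCont)
  \<comment> \<open>Nothing is known of \<open>g\<close> and \<open>g'\<close> outside the half
    line, so both are cut off there before measurability can be claimed.\<close>
  have m1: "(\<lambda>x. f (g x) * g' x * indicator {0<..} x) \<in> borel_measurable borel"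
  proof -
    have [measurable]: "(\<lambda>x. indicator {0<..} x *\<^sub>R g x) \<in> borel_measurable borel" "(\<lambda>x. indicator {0<..} x *\<^sub>R g' x) \<in> borel_measurable borel"
      using borel_measurable_continuous_on_indicator[OF _ gcont] borel_measurable_continuous_on_indicator[OF _ cont] by auto
    have "(\<lambda>x. f (indicator {0<..} x *\<^sub>R g x) * (indicator {0<..} x *\<^sub>R g' x)) \<in> borel_measurable borel" by measurable
    also have "(\<lambda>x. f (indicator {0<..} x *\<^sub>R g x) * (indicator {0<..} x *\<^sub>R g' x)) = (\<lambda>x. f (g x) * g' x * indicator {0<..} x)"
      by (auto simp: fun_eq_iff indicator_def)
    finally show ?thesis .
  qed
  let ?h = "\<lambda>x. ennreal (f (g x) * g' x * indicator {0<..} x)"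
  have "(\<integral>\<^sup>+x\<in>{0<..}. ennreal (f x) \<partial>lborel) = (SUP n. \<integral>\<^sup>+x\<in>{g (a n)..g (b n)}. ennreal (f x) \<partial>lborel)"
    using ab by (intro nn_integral_halfline_SUP dec' pos filterlim_compose[OF lim0 a_lim] filterlim_compose[OF liminf b_lim]) auto
  also have "\<dots> = (SUP n. \<integral>\<^sup>+x\<in>{a n..b n}. ?h x \<partial>lborel)"
  proof (rule SUP_cong[OF refl])
    fix n
    have "(\<integral>\<^sup>+x\<in>{g (a n)..g (b n)}. ennreal (f x) \<partial>lborel) = (\<integral>\<^sup>+x. f x * indicator {g (a n)..g (b n)} x \<partial>lborel)"
      by (intro nn_integral_cong) (auto simp: indicator_def)
    also have "\<dots> = (\<integral>\<^sup>+x. f (g x) * g' x * indicator {a n..b n} x \<partial>lborel)"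
      using ab[of n] by (intro nn_integral_substitution deriv nonneg continuous_on_subset[OF cont])
        (auto simp: set_borel_measurable_def intro: order.strict_trans2)
    also have "\<dots> = (\<integral>\<^sup>+x\<in>{a n..b n}. ?h x \<partial>lborel)"
      using ab[of n] by (intro nn_integral_cong) (auto simp: indicator_def)
    finally show "(\<integral>\<^sup>+x\<in>{g (a n)..g (b n)}. ennreal (f x) \<partial>lborel) = (\<integral>\<^sup>+x\<in>{a n..b n}. ?h x \<partial>lborel)" .
  qed
  also have "\<dots> = (\<integral>\<^sup>+x\<in>{0<..}. ?h x \<partial>lborel)"
    using m1 by (intro nn_integral_halfline_SUP[symmetric] dec ab a_lim' b_lim) simp
  also have "\<dots> = (\<integral>\<^sup>+x\<in>{0<..}. ennreal (f (g x) * g' x) \<partial>lborel)"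
    by (intro nn_integral_cong) (auto simp: indicator_def)
  finally show ?thesis .
qed

text \<open>Inversion reverses orientation, while the substitution rule is for increasing maps; it
  is split into the reflection \<open>x\<close> to \<open>-x\<close> and the increasing map
  \<open>x\<close> to \<open>-1/x\<close>.\<close>

lemma nn_integral_halfline_inverse:
  fixes f :: "real \<Rightarrow> real"
  assumes f [measurable]: "f \<in> borel_measurable borel"
  shows "(\<integral>\<^sup>+x\<in>{0<..}. ennreal (f x) \<partial>lborel) = (\<integral>\<^sup>+x\<in>{0<..}. ennreal (f (1 / x) / x\<^sup>2) \<partial>lborel)"
proof -
  define a b where "a n = 1 / (real n + 1)" and "b n = real n + 1" for n
  have ab: "0 < a n" "a n \<le> b n" for n by (auto simp: a_def b_def field_simps)
  have lims: "a \<longlonglongrightarrow> 0" "filterlim b at_top sequentially" unfolding a_def b_def by real_asymp+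
  have dec: "decseq a" "incseq b" by (auto intro!: decseq_SucI incseq_SucI simp: a_def b_def field_simps)
  have "(\<integral>\<^sup>+x\<in>{a n..b n}. ennreal (f x) \<partial>lborel) = (\<integral>\<^sup>+x\<in>{a n..b n}. ennreal (f (1 / x) / x\<^sup>2) \<partial>lborel)" for n
  proof -
    have "(\<integral>\<^sup>+x\<in>{a n..b n}. ennreal (f x) \<partial>lborel) = (\<integral>\<^sup>+x. ennreal (f (-x) * indicator {- 1 / a n..- 1 / b n} x) \<partial>lborel)"
      by (subst nn_integral_real_affine[where c = "-1" and t = 0])
         (auto simp: indicator_def a_def b_def intro!: nn_integral_cong)
    also have "\<dots> = (\<integral>\<^sup>+x. f (- (- 1 / x)) * (1 / x\<^sup>2) * indicator {a n..b n} x \<partial>lborel)"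
      using ab[of n]
      by (intro nn_integral_substitution)
         (auto simp: set_borel_measurable_def power2_eq_square intro!: derivative_eq_intros continuous_intros)
    also have "\<dots> = (\<integral>\<^sup>+x\<in>{a n..b n}. ennreal (f (1 / x) / x\<^sup>2) \<partial>lborel)"
      by (intro nn_integral_cong) (auto simp: indicator_def)
    finally show ?thesis .
  qed
  then show ?thesis
    by (simp add: nn_integral_halfline_SUP[of _ a b] dec ab lims)
qed

lemma nn_integral_halfline_powr_substitution:
  fixes f :: "real \<Rightarrow> real"
  assumes [measurable]: "f \<in> borel_measurable borel" and "0 < p"
  shows "(\<integral>\<^sup>+x\<in>{0<..}. ennreal (f x) \<partial>lborel) = (\<integral>\<^sup>+x\<in>{0<..}. ennreal (f (x powr p) * (p * x powr (p - 1))) \<partial>lborel)"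
proof (rule nn_integral_halfline_substitution)
  show "((\<lambda>x::real. x powr p) \<longlongrightarrow> 0) (at_right 0)" using \<open>0 < p\<close> by real_asymp
  show "filterlim (\<lambda>x::real. x powr p) at_top at_top" using \<open>0 < p\<close> by real_asymp
qed (use \<open>0 < p\<close> in \<open>auto intro!: derivative_eq_intros continuous_intros\<close>)

lemma nn_integral_halfline_scale:
  fixes f :: "real \<Rightarrow> real"
  assumes [measurable]: "f \<in> borel_measurable borel" and "0 < c"
  shows "(\<integral>\<^sup>+x\<in>{0<..}. ennreal (f x) \<partial>lborel) = (\<integral>\<^sup>+x\<in>{0<..}. ennreal (f (c * x) * c) \<partial>lborel)"
proof (rule nn_integral_halfline_substitution)
  show "((\<lambda>x::real. c * x) \<longlongrightarrow> 0) (at_right 0)" using \<open>0 < c\<close> by real_asymp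
  show "filterlim (\<lambda>x::real. c * x) at_top at_top" using \<open>0 < c\<close> by real_asymp
qed (use \<open>0 < c\<close> in \<open>auto intro!: derivative_eq_intros continuous_intros\<close>)

section \<open>Gamma and Beta integrals and the two kernels reduced to them\<close>

lemma nn_integral_Gamma_scaled:
  fixes a A :: real
  assumes "0 < a" "0 < A"
  shows "(\<integral>\<^sup>+t\<in>{0<..}. ennreal (t powr (a - 1) * exp (- A * t)) \<partial>lborel) = ennreal (Gamma a / A powr a)"
proof -
  have "ennreal (Gamma a) = (\<integral>\<^sup>+t\<in>{0<..}. ennreal (t powr (a - 1) * exp (- t)) \<partial>lborel)"
    unfolding Gamma_conv_nn_integral_real[OF \<open>0 < a\<close>]
    by (intro nn_integral_cong) (auto simp: indicator_def exp_minus field_simps)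
  also have "\<dots> = (\<integral>\<^sup>+t\<in>{0<..}. ennreal ((A * t) powr (a - 1) * exp (- (A * t)) * A) \<partial>lborel)"
    by (rule nn_integral_halfline_scale) (use assms in auto)
  also have "\<dots> = (\<integral>\<^sup>+t. ennreal (A powr a) * (ennreal (t powr (a - 1) * exp (- A * t)) * indicator {0<..} t) \<partial>lborel)"
    using assms by (intro nn_integral_cong)
      (auto simp: indicator_def ennreal_mult'[symmetric] powr_mult powr_diff)
  also have "\<dots> = ennreal (A powr a) * (\<integral>\<^sup>+t\<in>{0<..}. ennreal (t powr (a - 1) * exp (- A * t)) \<partial>lborel)"
    by (rule nn_integral_cmult) auto
  finally have *: "ennreal (Gamma a) = ennreal (A powr a) * (\<integral>\<^sup>+t\<in>{0<..}. ennreal (t powr (a - 1) * exp (- A * t)) \<partial>lborel)" .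
  have "ennreal (Gamma a / A powr a) = ennreal (1 / A powr a) * ennreal (Gamma a)"
    using assms by (simp add: ennreal_mult'[symmetric])
  also have "\<dots> = (ennreal (1 / A powr a) * ennreal (A powr a)) * (\<integral>\<^sup>+t\<in>{0<..}. ennreal (t powr (a - 1) * exp (- A * t)) \<partial>lborel)"
    by (subst *) (simp add: mult.assoc)
  also have "ennreal (1 / A powr a) * ennreal (A powr a) = 1"
    using assms by (simp add: ennreal_mult'[symmetric])
  finally show ?thesis by simp
qed

text \<open>Multiplied by \<open>Gamma (a + b)\<close>, the factor (1 + m)^(-a-b) becomes the
  Laplace integral of u^(a+b-1) exp (-(1 + m) u). After exchanging the integrals the one over
  \<open>m\<close> gives \<open>Gamma a\<close> / u^a and the remaining one is
  \<open>Gamma b\<close>.\<close>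

lemma nn_integral_Beta_prime:
  fixes a b :: real
  assumes a: "0 < a" and b: "0 < b"
  shows "(\<integral>\<^sup>+m\<in>{0<..}. ennreal (m powr (a - 1) * (1 + m) powr (- (a + b))) \<partial>lborel)
    = ennreal (Gamma a * Gamma b / Gamma (a + b))"
proof -
  let ?B = "\<integral>\<^sup>+m\<in>{0<..}. ennreal (m powr (a - 1) * (1 + m) powr (- (a + b))) \<partial>lborel"
  let ?f = "\<lambda>m u. ennreal (m powr (a - 1) * u powr (a + b - 1) * exp (- u) * exp (- (u * m))) * indicator {0<..} m * indicator {0<..} u"
  have G: "0 < Gamma a" "0 < Gamma b" "0 < Gamma (a + b)" using a b by (auto intro!: Gamma_real_pos)
  have "?B * ennreal (Gamma (a + b)) = (\<integral>\<^sup>+m. (ennreal (m powr (a - 1) * (1 + m) powr (- (a + b))) * indicator {0<..} m) * ennreal (Gamma (a + b)) \<partial>lborel)"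
    by (rule nn_integral_multc[symmetric]) auto
  also have "\<dots> = (\<integral>\<^sup>+m. \<integral>\<^sup>+u. ?f m u \<partial>lborel \<partial>lborel)"
  proof (rule nn_integral_cong)
    fix m :: real
    show "(ennreal (m powr (a - 1) * (1 + m) powr (- (a + b))) * indicator {0<..} m) * ennreal (Gamma (a + b))
      = (\<integral>\<^sup>+u. ?f m u \<partial>lborel)"
    proof (cases "0 < m")
      case True
      have "ennreal (m powr (a - 1) * (1 + m) powr (- (a + b))) * ennreal (Gamma (a + b))
        = ennreal (m powr (a - 1)) * ennreal (Gamma (a + b) / (1 + m) powr (a + b))"
        using G True by (simp add: ennreal_mult'[symmetric] powr_minus_divide[of "1 + m" "a + b", simplified])
      also have "\<dots> = ennreal (m powr (a - 1)) * (\<integral>\<^sup>+u\<in>{0<..}. ennreal (u powr (a + b - 1) * exp (- (1 + m) * u)) \<partial>lborel)"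
        by (subst nn_integral_Gamma_scaled) (use a b True in auto)
      also have "\<dots> = (\<integral>\<^sup>+u. ennreal (m powr (a - 1)) * (ennreal (u powr (a + b - 1) * exp (- (1 + m) * u)) * indicator {0<..} u) \<partial>lborel)"
        by (rule nn_integral_cmult[symmetric]) auto
      also have "\<dots> = (\<integral>\<^sup>+u. ?f m u \<partial>lborel)"
        using True by (intro nn_integral_cong)
          (auto simp: indicator_def ennreal_mult'[symmetric] mult_exp_exp algebra_simps)
      finally show ?thesis using True by simp
    qed simp
  qed
  also have "\<dots> = (\<integral>\<^sup>+u. \<integral>\<^sup>+m. ?f m u \<partial>lborel \<partial>lborel)"
    by (rule lborel_pair.Fubini') measurable
  also have "\<dots> = (\<integral>\<^sup>+u. ennreal (Gamma a) * (ennreal (u powr (b - 1) * exp (- 1 * u)) * indicator {0<..} u) \<partial>lborel)"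
  proof (rule nn_integral_cong)
    fix u :: real
    show "(\<integral>\<^sup>+m. ?f m u \<partial>lborel) = ennreal (Gamma a) * (ennreal (u powr (b - 1) * exp (- 1 * u)) * indicator {0<..} u)"
    proof (cases "0 < u")
      case True
      have "(\<integral>\<^sup>+m. ?f m u \<partial>lborel) = (\<integral>\<^sup>+m. ennreal (u powr (a + b - 1) * exp (- u)) * (ennreal (m powr (a - 1) * exp (- u * m)) * indicator {0<..} m) \<partial>lborel)"
        using True by (intro nn_integral_cong) (auto simp: indicator_def ennreal_mult'[symmetric] mult_ac)
      also have "\<dots> = ennreal (u powr (a + b - 1) * exp (- u)) * (\<integral>\<^sup>+m\<in>{0<..}. ennreal (m powr (a - 1) * exp (- u * m)) \<partial>lborel)"
        by (rule nn_integral_cmult) auto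
      also have "\<dots> = ennreal (u powr (a + b - 1) * exp (- u) * (Gamma a / u powr a))"
        using True a by (subst nn_integral_Gamma_scaled) (auto simp: ennreal_mult'[symmetric])
      also have "u powr (a + b - 1) * exp (- u) * (Gamma a / u powr a) = Gamma a * (u powr (b - 1) * exp (- 1 * u))"
      proof -
        have "u powr (a + b - 1) = u powr a * u powr (b - 1)" by (simp add: powr_add[symmetric] add_diff_eq)
        then show ?thesis using True by simp
      qed
      finally show ?thesis using True G by (simp add: ennreal_mult')
    qed simp
  qed
  also have "\<dots> = ennreal (Gamma a) * (\<integral>\<^sup>+u\<in>{0<..}. ennreal (u powr (b - 1) * exp (- 1 * u)) \<partial>lborel)"
    by (rule nn_integral_cmult) auto
  also have "\<dots> = ennreal (Gamma a * Gamma b)"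
    using b G by (subst nn_integral_Gamma_scaled) (auto simp: ennreal_mult')
  finally have *: "?B * ennreal (Gamma (a + b)) = ennreal (Gamma a * Gamma b)" .
  have "ennreal (Gamma a * Gamma b / Gamma (a + b)) = ennreal (Gamma a * Gamma b) * ennreal (1 / Gamma (a + b))"
    using G by (simp add: ennreal_mult'[symmetric])
  also have "\<dots> = ?B * (ennreal (Gamma (a + b)) * ennreal (1 / Gamma (a + b)))"
    by (subst *[symmetric]) (simp only: mult.assoc)
  also have "ennreal (Gamma (a + b)) * ennreal (1 / Gamma (a + b)) = 1"
    using G by (simp add: ennreal_mult'[symmetric] del: ennreal_mult')
  finally show ?thesis by simp
qed

text \<open>The variable t = r^(-3) turns r^(-s-2) dr into t^((s+1)/3 - 1) dt / 3, leaving a Gamma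
  integral. This is the time integral for the start at (x, 0), where the exponent of the density is
  a multiple of r^(-3) after scaling.\<close>

lemma nn_integral_inverse_power_exp:
  fixes s A :: real
  assumes "0 < s" "0 < A"
  shows "(\<integral>\<^sup>+r\<in>{0<..}. ennreal (r powr (- s - 2) * exp (- A / r ^ 3)) \<partial>lborel)
    = ennreal (Gamma ((s + 1) / 3) / (3 * A powr ((s + 1) / 3)))"
proof -
  have "(\<integral>\<^sup>+r\<in>{0<..}. ennreal (r powr (- s - 2) * exp (- A / r ^ 3)) \<partial>lborel)
     = (\<integral>\<^sup>+r\<in>{0<..}. ennreal ((1 / r) powr (- s - 2) * exp (- A / (1 / r) ^ 3) / r\<^sup>2) \<partial>lborel)"
    by (rule nn_integral_halfline_inverse) measurable
  also have "\<dots> = (\<integral>\<^sup>+r\<in>{0<..}. ennreal (1/3 * ((r powr 3) powr ((s + 1) / 3 - 1) * exp (- A * r powr 3)) * (3 * r powr (3 - 1))) \<partial>lborel)"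
  proof (intro set_nn_integral_cong refl)
    fix r :: real assume "r \<in> space lborel \<inter> {0<..}"
    then have r: "0 < r" by simp
    have "(1 / r) powr (- s - 2) / r\<^sup>2 = (r powr 3) powr ((s + 1) / 3 - 1) * r powr 2"
      using r by (simp add: powr_def mult_exp_exp ln_div exp_diff[symmetric] powr_realpow[symmetric] field_simps)
    moreover have "exp (- A / (1 / r) ^ 3) = exp (- A * r powr 3)"
      using r by (simp add: power_divide)
    ultimately have "((1 / r) powr (- s - 2) / r\<^sup>2) * exp (- A / (1 / r) ^ 3) = ((r powr 3) powr ((s + 1) / 3 - 1) * r powr 2) * exp (- A * r powr 3)"
      by (simp only:)
    then have "(1 / r) powr (- s - 2) * exp (- A / (1 / r) ^ 3) / r\<^sup>2 = 1/3 * ((r powr 3) powr ((s + 1) / 3 - 1) * exp (- A * r powr 3)) * (3 * r powr (3 - 1))"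
      by simp
    then show "ennreal ((1 / r) powr (- s - 2) * exp (- A / (1 / r) ^ 3) / r\<^sup>2) = ennreal (1/3 * ((r powr 3) powr ((s + 1) / 3 - 1) * exp (- A * r powr 3)) * (3 * r powr (3 - 1)))"
      by (simp only:)
  qed
  also have "\<dots> = (\<integral>\<^sup>+t\<in>{0<..}. ennreal (1/3 * (t powr ((s + 1) / 3 - 1) * exp (- A * t))) \<partial>lborel)"
    by (rule nn_integral_halfline_powr_substitution[symmetric]) auto
  also have "\<dots> = (\<integral>\<^sup>+t. ennreal (1/3) * (ennreal (t powr ((s + 1) / 3 - 1) * exp (- A * t)) * indicator {0<..} t) \<partial>lborel)"
    by (intro nn_integral_cong) (auto simp: indicator_def ennreal_mult'[symmetric])
  also have "\<dots> = ennreal (1/3) * (\<integral>\<^sup>+t\<in>{0<..}. ennreal (t powr ((s + 1) / 3 - 1) * exp (- A * t)) \<partial>lborel)"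
    by (rule nn_integral_cmult) auto
  also have "\<dots> = ennreal (Gamma ((s + 1) / 3) / (3 * A powr ((s + 1) / 3)))"
    using assms by (subst nn_integral_Gamma_scaled) (auto simp: ennreal_mult'[symmetric])
  finally show ?thesis .
qed

text \<open>With \<open>m = w\<^sup>3 / (9 q)\<close> and \<open>q = w\<^sup>2 + 3 w + 3\<close> one has \<open>1 + m = (w + 3)\<^sup>3 / (9 q)\<close>, which turns
  the integrand into a Beta density of the second kind.\<close>

lemma nn_integral_cubic_Beta:
  fixes s :: real
  assumes s: "0 < s" "s < 2"
  shows "(\<integral>\<^sup>+w\<in>{0<..}. ennreal (w powr (s - 1) * (w\<^sup>2 + 3 * w + 3) powr (- (s + 1) / 3)) \<partial>lborel)
    = ennreal (9 powr ((s - 2) / 3) * (Gamma (s / 3) * Gamma ((2 - s) / 3) / Gamma (2 / 3)))"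
proof -
  define q :: "real \<Rightarrow> real" where "q w = w\<^sup>2 + 3 * w + 3" for w
  have q: "0 < q w" if "0 < w" for w using that by (auto simp: q_def intro!: add_pos_pos)
  define m where "m w = w ^ 3 / (9 * q w)" for w
  define m' where "m' w = w\<^sup>2 * (w + 3)\<^sup>2 / (9 * (q w)\<^sup>2)" for w
  have m1: "1 + m w = (w + 3) ^ 3 / (9 * q w)" if "0 < w" for w
    using q[OF that] by (simp add: m_def q_def field_simps) algebra
  have "ennreal (Gamma (s / 3) * Gamma ((2 - s) / 3) / Gamma (2 / 3))
     = (\<integral>\<^sup>+m\<in>{0<..}. ennreal (m powr (s / 3 - 1) * (1 + m) powr (- (s / 3 + (2 - s) / 3))) \<partial>lborel)"
    using s by (subst nn_integral_Beta_prime) (auto simp: add_divide_distrib[symmetric])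
  also have "\<dots> = (\<integral>\<^sup>+w\<in>{0<..}. ennreal (m w powr (s / 3 - 1) * (1 + m w) powr (- (s / 3 + (2 - s) / 3)) * m' w) \<partial>lborel)"
  proof (rule nn_integral_halfline_substitution)
    fix w :: real assume w: "0 < w"
    show "(m has_real_derivative m' w) (at w)"
    proof -
      have "(q has_real_derivative 2 * w + 3) (at w)"
        unfolding q_def by (auto intro!: derivative_eq_intros)
      then have "(m has_real_derivative (3 * w\<^sup>2 * (9 * q w) - w ^ 3 * (9 * (2 * w + 3))) / (9 * q w)\<^sup>2) (at w)"
        using q[OF w] unfolding m_def by (auto intro!: derivative_eq_intros simp: power2_eq_square)
      moreover have "3 * w\<^sup>2 * (9 * q w) - w ^ 3 * (9 * (2 * w + 3)) = 9 * (w\<^sup>2 * (w + 3)\<^sup>2)"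
        unfolding q_def by algebra
      ultimately show ?thesis by (simp add: m'_def power_mult_distrib)
    qed
    show "0 < m w" using q[OF w] w by (simp add: m_def)
    show "0 \<le> m' w" by (simp add: m'_def)
  next
    show "continuous_on {0<..} m'" unfolding m'_def using q
      by (auto intro!: continuous_intros simp: q_def less_imp_neq[symmetric])
    show "(m \<longlongrightarrow> 0) (at_right 0)" unfolding m_def q_def by real_asymp
    show "filterlim m at_top at_top" unfolding m_def q_def by real_asymp
  qed auto
  also have "\<dots> = (\<integral>\<^sup>+w. ennreal (9 powr ((2 - s) / 3)) * (ennreal (w powr (s - 1) * (q w) powr (- (s + 1) / 3)) * indicator {0<..} w) \<partial>lborel)"
  proof (intro nn_integral_cong)
    fix w :: real
    have "m w powr (s / 3 - 1) * (1 + m w) powr (- (s / 3 + (2 - s) / 3)) * m' w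
       = 9 powr ((2 - s) / 3) * (w powr (s - 1) * (q w) powr (- (s + 1) / 3))" if w: "0 < w"
    proof -
      \<comment> \<open>The integrand is a monomial in w, w + 3, q w and 9, so exponents are
        compared through logarithms. The powers of w + 3 cancel because 3 * (-2/3) + 2 = 0; this is
        what fixes the sum 2/3 of the two Beta parameters.\<close>
      have "ln (m w) = 3 * ln w - (ln 9 + ln (q w))"
        using w q[OF w] by (simp add: m_def ln_div ln_mult ln_realpow)
      moreover have "ln (1 + m w) = 3 * ln (w + 3) - (ln 9 + ln (q w))"
        using w q[OF w] by (simp add: m1 ln_div ln_mult ln_realpow)
      moreover have "m' w = exp (2 * ln w + 2 * ln (w + 3) - (ln 9 + 2 * ln (q w)))"
        using w q[OF w] by (simp add: m'_def exp_add exp_diff exp_double power2_eq_square[symmetric])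
      moreover have "m w > 0" using w q[OF w] by (simp add: m_def)
      ultimately show ?thesis using w q[OF w]
        by (simp add: powr_def mult_exp_exp) (simp add: field_simps)
    qed
    then show "ennreal (m w powr (s / 3 - 1) * (1 + m w) powr (- (s / 3 + (2 - s) / 3)) * m' w) * indicator {0<..} w
       = ennreal (9 powr ((2 - s) / 3)) * (ennreal (w powr (s - 1) * (q w) powr (- (s + 1) / 3)) * indicator {0<..} w)"
      by (auto simp: indicator_def ennreal_mult'[symmetric])
  qed
  also have "\<dots> = ennreal (9 powr ((2 - s) / 3)) * (\<integral>\<^sup>+w\<in>{0<..}. ennreal (w powr (s - 1) * (q w) powr (- (s + 1) / 3)) \<partial>lborel)"
    by (rule nn_integral_cmult) (auto simp: q_def)
  finally have *: "ennreal (Gamma (s / 3) * Gamma ((2 - s) / 3) / Gamma (2 / 3)) =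
    ennreal (9 powr ((2 - s) / 3)) * (\<integral>\<^sup>+w\<in>{0<..}. ennreal (w powr (s - 1) * (q w) powr (- (s + 1) / 3)) \<partial>lborel)" .
  have "ennreal (9 powr ((s - 2) / 3) * (Gamma (s / 3) * Gamma ((2 - s) / 3) / Gamma (2 / 3)))
     = ennreal (9 powr ((s - 2) / 3)) * ennreal (Gamma (s / 3) * Gamma ((2 - s) / 3) / Gamma (2 / 3))"
    using s by (intro ennreal_mult) (auto intro!: divide_nonneg_nonneg mult_nonneg_nonneg less_imp_le Gamma_real_pos)
  also have "\<dots> = ennreal (9 powr ((s - 2) / 3)) * ennreal (9 powr ((2 - s) / 3)) * (\<integral>\<^sup>+w\<in>{0<..}. ennreal (w powr (s - 1) * (q w) powr (- (s + 1) / 3)) \<partial>lborel)"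
    by (simp only: * mult.assoc)
  also have "ennreal (9 powr ((s - 2) / 3)) * ennreal (9 powr ((2 - s) / 3)) = 1"
    by (simp add: ennreal_mult'[symmetric] powr_add[symmetric] add_divide_distrib[symmetric])
  finally show ?thesis by (simp add: q_def)
qed

lemma return_form_pos:
  fixes u w :: real
  assumes "0 < w"
  shows "0 < u\<^sup>2 - u * w + w\<^sup>2"
proof -
  have "u\<^sup>2 - u * w + w\<^sup>2 = (u - w / 2)\<^sup>2 + 3 / 4 * w\<^sup>2" by (simp add: power2_eq_square field_simps)
  moreover have "0 \<le> (u - w / 2)\<^sup>2" "0 < 3 / 4 * w\<^sup>2" using assms by auto
  ultimately show ?thesis by linarith
qed

text \<open>Since (u + w) (u^2 - u w + w^2) = u^3 + w^3, the kernel equals (u + w) / (u^3 + w^3).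
  With m = (w/u)^3 the summands u and w give Beta integrals of the second kind with parameters s/3
  and (s+1)/3, each complemented to 1; the range of \<open>s\<close> makes both converge.\<close>

lemma nn_integral_rational_kernel:
  fixes s u :: real
  assumes s: "0 < s" "s < 2" and u: "0 < u"
  shows "(\<integral>\<^sup>+w\<in>{0<..}. ennreal (w powr (s - 1) / (u\<^sup>2 - u * w + w\<^sup>2)) \<partial>lborel)
    = ennreal (u powr (s - 2) / 3 * (Gamma (s / 3) * Gamma (1 - s / 3) + Gamma ((s + 1) / 3) * Gamma (1 - (s + 1) / 3)))"
proof -
  let ?f = "\<lambda>a m. m powr (a - 1) * (1 + m) powr (- (a + (1 - a)))"
  have G: "0 < Gamma (s / 3)" "0 < Gamma (1 - s / 3)" "0 < Gamma ((s + 1) / 3)" "0 < Gamma (1 - (s + 1) / 3)"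
    using s by (auto intro!: Gamma_real_pos)
  have "ennreal (u powr (s - 2) / 3 * (Gamma (s / 3) * Gamma (1 - s / 3) + Gamma ((s + 1) / 3) * Gamma (1 - (s + 1) / 3)))
    = ennreal (u powr (s - 2) / 3) * ((\<integral>\<^sup>+m\<in>{0<..}. ennreal (?f (s / 3) m) \<partial>lborel) + (\<integral>\<^sup>+m\<in>{0<..}. ennreal (?f ((s + 1) / 3) m) \<partial>lborel))"
    using s G by (subst (1 2) nn_integral_Beta_prime) (auto simp: ennreal_mult'[symmetric] ennreal_plus[symmetric] simp del: ennreal_plus)
  also have "\<dots> = (\<integral>\<^sup>+m. ennreal (u powr (s - 2) / 3) * (ennreal (?f (s / 3) m) * indicator {0<..} m + ennreal (?f ((s + 1) / 3) m) * indicator {0<..} m) \<partial>lborel)"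
    by (subst nn_integral_cmult, measurable, subst nn_integral_add) auto
  also have "\<dots> = (\<integral>\<^sup>+m\<in>{0<..}. ennreal (u powr (s - 2) / 3 * (?f (s / 3) m + ?f ((s + 1) / 3) m)) \<partial>lborel)"
    by (intro nn_integral_cong) (auto simp: indicator_def ennreal_mult'[symmetric] ennreal_plus[symmetric] simp del: ennreal_plus)
  also have "\<dots> = (\<integral>\<^sup>+w\<in>{0<..}. ennreal (u powr (s - 2) / 3 * (?f (s / 3) ((w / u) ^ 3) + ?f ((s + 1) / 3) ((w / u) ^ 3)) * (3 * w\<^sup>2 / u ^ 3)) \<partial>lborel)"
  proof (rule nn_integral_halfline_substitution)
    show "((\<lambda>w. (w / u) ^ 3) \<longlongrightarrow> 0) (at_right 0)" using u by real_asymp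
    show "filterlim (\<lambda>w. (w / u) ^ 3) at_top at_top" using u by real_asymp
  qed (use u in \<open>auto intro!: derivative_eq_intros continuous_intros simp: power_divide field_simps power2_eq_square power3_eq_cube\<close>)
  also have "\<dots> = (\<integral>\<^sup>+w\<in>{0<..}. ennreal (w powr (s - 1) / (u\<^sup>2 - u * w + w\<^sup>2)) \<partial>lborel)"
  proof (intro set_nn_integral_cong refl)
    fix w :: real assume "w \<in> space lborel \<inter> {0<..}"
    then have w: "0 < w" by simp
    have 1: "((w / u) ^ 3) powr (s / 3 - 1) = w powr (s - 1) * u powr 1 / u powr (s - 2) / w powr 2"
      using u w by (subst ln_inj_iff[symmetric]) (simp_all add: ln_mult ln_div ln_powr ln_realpow, simp_all add: field_simps)
    have 2: "((w / u) ^ 3) powr ((s + 1) / 3 - 1) = w powr (s - 1) / w powr 1 / u powr (s - 2)"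
      using u w by (subst ln_inj_iff[symmetric]) (simp_all add: ln_mult ln_div ln_powr ln_realpow, simp_all add: field_simps)
    have 3: "(1 + (w / u) ^ 3) powr (-1) = u ^ 3 / (u ^ 3 + w ^ 3)"
      using u w by (simp add: powr_minus_divide power_divide field_simps)
    have "0 < u\<^sup>2 - u * w + w\<^sup>2" using w by (rule return_form_pos)
    moreover have "u ^ 3 + w ^ 3 = (u + w) * (u\<^sup>2 - u * w + w\<^sup>2)" by algebra
    ultimately have "u powr (s - 2) / 3 * (?f (s / 3) ((w / u) ^ 3) + ?f ((s + 1) / 3) ((w / u) ^ 3)) * (3 * w\<^sup>2 / u ^ 3)
      = w powr (s - 1) / (u\<^sup>2 - u * w + w\<^sup>2)"
      using u w by (simp add: 1 2 3) (simp add: divide_simps power2_eq_square power3_eq_cube, simp add: algebra_simps)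
    then show "ennreal (u powr (s - 2) / 3 * (?f (s / 3) ((w / u) ^ 3) + ?f ((s + 1) / 3) ((w / u) ^ 3)) * (3 * w\<^sup>2 / u ^ 3)) = ennreal (w powr (s - 1) / (u\<^sup>2 - u * w + w\<^sup>2))"
      by simp
  qed
  finally show ?thesis by simp
qed

section \<open>The Kolmogorov density\<close>

text \<open>Transition density of (X, L) from (x, y) to (x', y') in time \<open>r\<close>,
  disintegrated over the final velocity: L has variance 2r, and given both end velocities X is an
  integrated bridge with mean displacement r (y + y') / 2 and variance r^3 / 6.\<close>

definition kolmogorov_density :: "real \<Rightarrow> real \<Rightarrow> real \<Rightarrow> real \<Rightarrow> real \<Rightarrow> real" where
  "kolmogorov_density r x y x' y' =
     normal_density y (sqrt (2 * r)) y' * normal_density (x + r * (y + y') / 2) (sqrt (r ^ 3 / 6)) x'"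

lemma kolmogorov_density_eq:
  assumes "0 < r"
  shows "kolmogorov_density r x y x' y' =
    sqrt 3 / (2 * pi) / r\<^sup>2 * exp (- ((y' - y)\<^sup>2 / (4 * r) + 3 * (x' - x - r * (y + y') / 2)\<^sup>2 / r ^ 3))"
proof -
  have "sqrt (2 * pi * (sqrt (2 * r))\<^sup>2) * sqrt (2 * pi * (sqrt (r ^ 3 / 6))\<^sup>2) = sqrt ((2 * pi * r\<^sup>2)\<^sup>2 / 3)"
    using assms by (simp add: real_sqrt_mult[symmetric] power2_eq_square power3_eq_cube field_simps)
  also have "\<dots> = 2 * pi * r\<^sup>2 / sqrt 3"
    by (simp add: real_sqrt_divide)
  finally have 1: "sqrt (2 * pi * (sqrt (2 * r))\<^sup>2) * sqrt (2 * pi * (sqrt (r ^ 3 / 6))\<^sup>2) = 2 * pi * r\<^sup>2 / sqrt 3" .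
  have 2: "- (y' - y)\<^sup>2 / (2 * (sqrt (2 * r))\<^sup>2) + - (x' - (x + r * (y + y') / 2))\<^sup>2 / (2 * (sqrt (r ^ 3 / 6))\<^sup>2)
     = - ((y' - y)\<^sup>2 / (4 * r) + 3 * (x' - x - r * (y + y') / 2)\<^sup>2 / r ^ 3)"
    using assms by (simp add: diff_diff_eq)
  have "kolmogorov_density r x y x' y' = 1 / (sqrt (2 * pi * (sqrt (2 * r))\<^sup>2) * sqrt (2 * pi * (sqrt (r ^ 3 / 6))\<^sup>2))
     * exp (- (y' - y)\<^sup>2 / (2 * (sqrt (2 * r))\<^sup>2) + - (x' - (x + r * (y + y') / 2))\<^sup>2 / (2 * (sqrt (r ^ 3 / 6))\<^sup>2))"
    by (simp only: kolmogorov_density_def normal_density_def exp_add) simp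
  then show ?thesis unfolding 1 2 by simp
qed

lemma borel_measurable_kolmogorov_density [measurable]:
  assumes [measurable]: "f \<in> borel_measurable M" "g \<in> borel_measurable M" "h \<in> borel_measurable M" "k \<in> borel_measurable M" "l \<in> borel_measurable M"
  shows "(\<lambda>z. kolmogorov_density (f z) (g z) (h z) (k z) (l z)) \<in> borel_measurable M"
  unfolding kolmogorov_density_def normal_density_def by measurable

lemma kolmogorov_density_nonneg [simp]: "0 \<le> kolmogorov_density r x y x' y'"
  by (simp add: kolmogorov_density_def)

lemma nn_integral_inverse_square_exp:
  fixes A :: real
  assumes "0 < A"
  shows "(\<integral>\<^sup>+r\<in>{0<..}. ennreal (1 / r\<^sup>2 * exp (- A / r)) \<partial>lborel) = ennreal (1 / A)"
proof -
  have "(\<integral>\<^sup>+r\<in>{0<..}. ennreal (1 / r\<^sup>2 * exp (- A / r)) \<partial>lborel)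
      = (\<integral>\<^sup>+r\<in>{0<..}. ennreal (r powr (1 - 1) * exp (- A * r)) \<partial>lborel)"
    by (subst nn_integral_halfline_inverse) (auto intro!: set_nn_integral_cong simp: power_divide)
  also have "\<dots> = ennreal (1 / A)" by (subst nn_integral_Gamma_scaled) (use assms in auto)
  finally show ?thesis .
qed

text \<open>Between two points of position 0 the exponent is a pure multiple of 1/r, because (u +
  w)^2 / 4 + 3 (u - w)^2 / 4 = u^2 - u w + w^2. The time integral is therefore explicit.\<close>

lemma nn_integral_kolmogorov_return:
  assumes "0 \<le> u" "0 < w"
  shows "(\<integral>\<^sup>+r\<in>{0<..}. ennreal (kolmogorov_density r 0 u 0 (- w)) \<partial>lborel)
    = ennreal (sqrt 3 / (2 * pi) * (1 / (u\<^sup>2 - u * w + w\<^sup>2)))"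
proof -
  have "(\<integral>\<^sup>+r\<in>{0<..}. ennreal (kolmogorov_density r 0 u 0 (- w)) \<partial>lborel)
    = (\<integral>\<^sup>+r. ennreal (sqrt 3 / (2 * pi)) * (ennreal (1 / r\<^sup>2 * exp (- (u\<^sup>2 - u * w + w\<^sup>2) / r)) * indicator {0<..} r) \<partial>lborel)"
  proof (intro nn_integral_cong)
    fix r :: real
    have "kolmogorov_density r 0 u 0 (- w) = sqrt 3 / (2 * pi) * (1 / r\<^sup>2 * exp (- (u\<^sup>2 - u * w + w\<^sup>2) / r))" if "0 < r"
    proof -
      have e: "(- w - u)\<^sup>2 / (4 * r) + 3 * (0 - 0 - r * (u + - w) / 2)\<^sup>2 / r ^ 3 = (u\<^sup>2 - u * w + w\<^sup>2) / r"
        using that by (simp add: field_simps power2_eq_square power3_eq_cube)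
      show ?thesis unfolding kolmogorov_density_eq[OF that] e by (simp only: minus_divide_left) simp
    qed
    then show "ennreal (kolmogorov_density r 0 u 0 (- w)) * indicator {0<..} r
       = ennreal (sqrt 3 / (2 * pi)) * (ennreal (1 / r\<^sup>2 * exp (- (u\<^sup>2 - u * w + w\<^sup>2) / r)) * indicator {0<..} r)"
      by (auto simp: indicator_def ennreal_mult'[symmetric])
  qed
  also have "\<dots> = ennreal (sqrt 3 / (2 * pi)) * (\<integral>\<^sup>+r\<in>{0<..}. ennreal (1 / r\<^sup>2 * exp (- (u\<^sup>2 - u * w + w\<^sup>2) / r)) \<partial>lborel)"
    by (rule nn_integral_cmult) auto
  also have "\<dots> = ennreal (sqrt 3 / (2 * pi) * (1 / (u\<^sup>2 - u * w + w\<^sup>2)))"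
    using return_form_pos[OF assms(2)] by (subst nn_integral_inverse_square_exp) (auto simp: ennreal_mult'[symmetric])
  finally show ?thesis .
qed

text \<open>Replacing w by |x| w / r makes the exponent x^2 (w^2 + 3 w + 3) / r^3, which separates
  the variables: w^2 / 4 + 3 (1 + w/2)^2 = w^2 + 3 w + 3. The scaling depends on r, so the order of
  integration is exchanged before it and restored afterwards; then r contributes a Gamma factor and
  w the cubic Beta integral.\<close>

lemma Mellin_kolmogorov_start:
  fixes s x :: real
  assumes s: "0 < s" "s < 2" and x: "x < 0"
  shows "(\<integral>\<^sup>+w\<in>{0<..}. ennreal (w powr (s - 1)) * (\<integral>\<^sup>+r\<in>{0<..}. ennreal (kolmogorov_density r x 0 0 (- w)) \<partial>lborel) \<partial>lborel)
    = ennreal (sqrt 3 / (2 * pi) * (Gamma ((s + 1) / 3) / 3 * (9 * \<bar>x\<bar>) powr ((s - 2) / 3) * (Gamma (s / 3) * Gamma ((2 - s) / 3) / Gamma (2 / 3))))"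
proof -
  define X where "X = - x"
  have X: "0 < X" "\<bar>x\<bar> = X" using x by (auto simp: X_def)
  define q :: "real \<Rightarrow> real" where "q w = w\<^sup>2 + 3 * w + 3" for w
  have [measurable]: "q \<in> borel_measurable borel" unfolding q_def by measurable
  have q: "0 < q w" if "0 < w" for w using that by (auto simp: q_def intro!: add_pos_pos)
  define c where "c = sqrt 3 / (2 * pi)"
  have c: "0 < c" by (simp add: c_def)
  let ?g = "\<lambda>w r. ennreal (w powr (s - 1) * kolmogorov_density r x 0 0 (- w)) * indicator {0<..} w * indicator {0<..} r"
  let ?h = "\<lambda>w r. ennreal (c * X powr s * w powr (s - 1) * (r powr (- s - 2) * exp (- (X\<^sup>2 * q w) / r ^ 3))) * indicator {0<..} w * indicator {0<..} r"
  have "(\<integral>\<^sup>+w\<in>{0<..}. ennreal (w powr (s - 1)) * (\<integral>\<^sup>+r\<in>{0<..}. ennreal (kolmogorov_density r x 0 0 (- w)) \<partial>lborel) \<partial>lborel)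
     = (\<integral>\<^sup>+w. \<integral>\<^sup>+r. ?g w r \<partial>lborel \<partial>lborel)"
    by (auto intro!: nn_integral_cong simp: nn_integral_cmult[symmetric] indicator_def ennreal_mult'[symmetric] ac_simps)
  also have "\<dots> = (\<integral>\<^sup>+r. \<integral>\<^sup>+w. ?g w r \<partial>lborel \<partial>lborel)"
    by (rule lborel_pair.Fubini') measurable
  also have "\<dots> = (\<integral>\<^sup>+r. \<integral>\<^sup>+w. ?h w r \<partial>lborel \<partial>lborel)"
  proof (rule nn_integral_cong)
    fix r :: real
    show "(\<integral>\<^sup>+w. ?g w r \<partial>lborel) = (\<integral>\<^sup>+w. ?h w r \<partial>lborel)"
    proof (cases "0 < r")
      case r: True
      have "(\<integral>\<^sup>+w. ?g w r \<partial>lborel) = (\<integral>\<^sup>+w\<in>{0<..}. ennreal (w powr (s - 1) * kolmogorov_density r x 0 0 (- w)) \<partial>lborel)"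
        using r by simp
      also have "\<dots> = (\<integral>\<^sup>+w\<in>{0<..}. ennreal ((X / r * w) powr (s - 1) * kolmogorov_density r x 0 0 (- (X / r * w)) * (X / r)) \<partial>lborel)"
        by (rule nn_integral_halfline_scale) (use X r in auto)
      also have "\<dots> = (\<integral>\<^sup>+w\<in>{0<..}. ennreal (c * X powr s * w powr (s - 1) * (r powr (- s - 2) * exp (- (X\<^sup>2 * q w) / r ^ 3))) \<partial>lborel)"
      proof (intro set_nn_integral_cong refl)
        fix w :: real assume "w \<in> space lborel \<inter> {0<..}"
        then have w: "0 < w" by simp
        have e: "(- (X / r * w) - 0)\<^sup>2 / (4 * r) + 3 * (0 - x - r * (0 + - (X / r * w)) / 2)\<^sup>2 / r ^ 3 = X\<^sup>2 * q w / r ^ 3"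
          using r by (simp add: q_def X_def field_simps power2_eq_square power3_eq_cube)
        have "(X / r * w) powr (s - 1) * (1 / r\<^sup>2) * (X / r) = X powr s * w powr (s - 1) * r powr (- s - 2)"
          using X w r by (subst ln_inj_iff[symmetric]) (simp_all add: ln_mult ln_div ln_powr ln_realpow, simp_all add: field_simps)
        then have "c * ((X / r * w) powr (s - 1) * (1 / r\<^sup>2) * (X / r)) * exp (- (X\<^sup>2 * q w / r ^ 3))
            = c * (X powr s * w powr (s - 1) * r powr (- s - 2)) * exp (- (X\<^sup>2 * q w / r ^ 3))" by (simp only:)
        then show "ennreal ((X / r * w) powr (s - 1) * kolmogorov_density r x 0 0 (- (X / r * w)) * (X / r))
           = ennreal (c * X powr s * w powr (s - 1) * (r powr (- s - 2) * exp (- (X\<^sup>2 * q w) / r ^ 3)))"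
          using r by (simp only: kolmogorov_density_eq e c_def[symmetric]) (simp add: mult_ac)
      qed
      also have "\<dots> = (\<integral>\<^sup>+w. ?h w r \<partial>lborel)" using r by simp
      finally show ?thesis .
    qed simp
  qed
  also have "\<dots> = (\<integral>\<^sup>+w. \<integral>\<^sup>+r. ?h w r \<partial>lborel \<partial>lborel)"
    by (rule lborel_pair.Fubini') measurable
  also have "\<dots> = (\<integral>\<^sup>+w. ennreal (c * (Gamma ((s + 1) / 3) / 3 * X powr ((s - 2) / 3))) * (ennreal (w powr (s - 1) * q w powr (- (s + 1) / 3)) * indicator {0<..} w) \<partial>lborel)"
  proof (rule nn_integral_cong)
    fix w :: real
    show "(\<integral>\<^sup>+r. ?h w r \<partial>lborel) = ennreal (c * (Gamma ((s + 1) / 3) / 3 * X powr ((s - 2) / 3))) * (ennreal (w powr (s - 1) * q w powr (- (s + 1) / 3)) * indicator {0<..} w)"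
    proof (cases "0 < w")
      case w: True
      have A: "0 < X\<^sup>2 * q w" using X q[OF w] by simp
      have "(\<integral>\<^sup>+r. ?h w r \<partial>lborel) = (\<integral>\<^sup>+r. ennreal (c * X powr s * w powr (s - 1)) * (ennreal (r powr (- s - 2) * exp (- (X\<^sup>2 * q w) / r ^ 3)) * indicator {0<..} r) \<partial>lborel)"
        using w c by (intro nn_integral_cong) (auto simp: indicator_def ennreal_mult'[symmetric])
      also have "\<dots> = ennreal (c * X powr s * w powr (s - 1)) * ennreal (Gamma ((s + 1) / 3) / (3 * (X\<^sup>2 * q w) powr ((s + 1) / 3)))"
        by (subst nn_integral_cmult, measurable, subst nn_integral_inverse_power_exp) (use A s in auto)
      also have "\<dots> = ennreal (c * X powr s * w powr (s - 1) * (Gamma ((s + 1) / 3) / (3 * (X\<^sup>2 * q w) powr ((s + 1) / 3))))"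
        using c by (intro ennreal_mult'[symmetric]) auto
      also have "c * X powr s * w powr (s - 1) * (Gamma ((s + 1) / 3) / (3 * (X\<^sup>2 * q w) powr ((s + 1) / 3)))
          = c * (Gamma ((s + 1) / 3) / 3 * X powr ((s - 2) / 3)) * (w powr (s - 1) * q w powr (- (s + 1) / 3))"
      proof -
        have "X powr s * (1 / (X\<^sup>2 * q w) powr ((s + 1) / 3)) = X powr ((s - 2) / 3) * q w powr (- (s + 1) / 3)"
          using X q[OF w] by (subst ln_inj_iff[symmetric]) (simp_all add: ln_mult ln_div ln_powr ln_realpow, simp_all add: field_simps)
        then have "X powr s / (X\<^sup>2 * q w) powr ((s + 1) / 3) = X powr ((s - 2) / 3) * q w powr (- (s + 1) / 3)" by simp
        moreover have "c * X powr s * w powr (s - 1) * (Gamma ((s + 1) / 3) / (3 * (X\<^sup>2 * q w) powr ((s + 1) / 3)))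
          = c * (Gamma ((s + 1) / 3) / 3) * w powr (s - 1) * (X powr s / (X\<^sup>2 * q w) powr ((s + 1) / 3))" by simp
        ultimately show ?thesis by simp
      qed
      also have "ennreal \<dots> = ennreal (c * (Gamma ((s + 1) / 3) / 3 * X powr ((s - 2) / 3))) * ennreal (w powr (s - 1) * q w powr (- (s + 1) / 3))"
        using c s by (intro ennreal_mult) (auto intro!: less_imp_le Gamma_real_pos)
      finally show ?thesis using w by simp
    qed simp
  qed
  also have "\<dots> = ennreal (c * (Gamma ((s + 1) / 3) / 3 * X powr ((s - 2) / 3))) * ennreal (9 powr ((s - 2) / 3) * (Gamma (s / 3) * Gamma ((2 - s) / 3) / Gamma (2 / 3)))"
    by (subst nn_integral_cmult, measurable, subst nn_integral_cubic_Beta[OF s, folded q_def]) auto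
  also have "\<dots> = ennreal (c * (Gamma ((s + 1) / 3) / 3 * X powr ((s - 2) / 3)) * (9 powr ((s - 2) / 3) * (Gamma (s / 3) * Gamma ((2 - s) / 3) / Gamma (2 / 3))))"
    using c s by (intro ennreal_mult[symmetric]) (auto intro!: less_imp_le Gamma_real_pos divide_nonneg_nonneg mult_nonneg_nonneg)
  also have "\<dots> = ennreal (c * (Gamma ((s + 1) / 3) / 3 * (9 * X) powr ((s - 2) / 3) * (Gamma (s / 3) * Gamma ((2 - s) / 3) / Gamma (2 / 3))))"
    using X by (simp add: powr_mult mult_ac)
  finally show ?thesis by (simp add: c_def X)
qed

section \<open>Uniqueness of Mellin transforms\<close>

lemma norm_exp_diff_1_le:
  fixes w :: complex
  shows "norm (exp w - 1) \<le> norm w * exp (norm w)"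
proof -
  have "norm (exp w - exp 0) \<le> exp (norm w) * norm (w - 0)"
  proof (rule field_differentiable_bound[of "cball 0 (norm w)" exp exp])
    fix z :: complex assume "z \<in> cball 0 (norm w)"
    then show "norm (exp z) \<le> exp (norm w)"
      using complex_Re_le_cmod[of z] by simp
  qed (auto intro!: derivative_eq_intros)
  then show ?thesis by (simp add: mult.commute)
qed

text \<open>\<open>t * ln x\<close> is monotone in \<open>t\<close>, so one of the end exponents
  dominates. This supplies the integrable majorant on the way to the imaginary axis.\<close>

lemma powr_le_add_powr:
  fixes x a b t :: real
  assumes "a \<le> t" "t \<le> b"
  shows "x powr t \<le> x powr a + x powr b"
proof (cases "x = 0")
  case False
  have "x powr t \<le> max (x powr a) (x powr b)"
  proof (cases "ln x \<le> 0")
    case True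
    then have "t * ln x \<le> a * ln x" using assms by (simp add: mult_right_mono_neg)
    then show ?thesis using False by (simp add: powr_def le_max_iff_disj)
  next
    case False2: False
    then have "t * ln x \<le> b * ln x" using assms by (simp add: mult_right_mono)
    then show ?thesis using False by (simp add: powr_def le_max_iff_disj)
  qed
  then show ?thesis by (smt (verit) powr_ge_zero)
qed simp

text \<open>Differentiation under the integral. The difference quotient of exp (z ln x) is at most
  x^(Re z) times exp (2 d |ln x|) / d, and the exponential is absorbed by the powers with exponents
  Re z - 2d and Re z + 2d, integrable inside the strip.\<close>

lemma holomorphic_Mellin:
  fixes \<mu> :: "real measure" and a b :: real
  assumes sets [measurable_cong]: "sets \<mu> = sets borel"
    and pos: "AE x in \<mu>. 0 < x"
    and int: "\<And>t. a < t \<Longrightarrow> t < b \<Longrightarrow> integrable \<mu> (\<lambda>x. x powr t)"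
  shows "(\<lambda>z. \<integral>x. exp (z * of_real (ln x)) \<partial>\<mu>) holomorphic_on {z. a < Re z \<and> Re z < b}" (is "?F holomorphic_on ?S")
proof -
  have norm_e: "norm (exp (z * of_real (ln x))) = x powr Re z" if "0 < x" for z x
    using that by (simp add: powr_def)
  have int': "integrable \<mu> (\<lambda>x. exp (z * of_real (ln x)))" if "a < Re z" "Re z < b" for z
  proof (rule Bochner_Integration.integrable_bound[OF int[OF that]])
    show "AE x in \<mu>. norm (exp (z * complex_of_real (ln x))) \<le> norm (x powr Re z)"
      using pos by eventually_elim (simp add: powr_def)
  qed measurable
  have "?F field_differentiable at z" if z: "a < Re z" "Re z < b" for z
  proof -
    \<comment> \<open>A third of the distance to the boundary: one \<open>d\<close> pays for the
      factor |ln x|, a second for exp (h ln x), and the exponents still stay strictly inside the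
      strip.\<close>
    define d where "d = min (Re z - a) (b - Re z) / 3"
    have d: "0 < d" "a < Re z - 2 * d" "Re z + 2 * d < b"
    proof -
      have "3 * d \<le> Re z - a" "3 * d \<le> b - Re z" "0 < 3 * d" using z by (auto simp: d_def)
      then show "0 < d" "a < Re z - 2 * d" "Re z + 2 * d < b" by linarith+
    qed
    let ?D = "\<integral>x. of_real (ln x) * exp (z * of_real (ln x)) \<partial>\<mu>"
    have "(\<lambda>h. (?F (z + h) - ?F z) / h) \<midarrow>0\<rightarrow> ?D"
    \<comment> \<open>Limits are taken within the ball of radius \<open>d\<close>, so that every
      member of a sequence of increments obeys the bound that dominated convergence asks
      for.\<close>
    proof (subst at_within_open[of 0 "ball 0 d", symmetric])
      show "((\<lambda>h. (?F (z + h) - ?F z) / h) \<longlongrightarrow> ?D) (at 0 within ball 0 d)"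
        unfolding tendsto_at_iff_sequentially
      proof (intro allI impI)
        fix h :: "nat \<Rightarrow> complex" assume h: "\<forall>i. h i \<in> ball 0 d - {0}" and h0: "h \<longlonglongrightarrow> 0"
        have hd: "norm (h i) < d" "h i \<noteq> 0" for i using h by auto
        let ?q = "\<lambda>i x. (exp ((z + h i) * of_real (ln x)) - exp (z * of_real (ln x))) / h i"
        have "(\<lambda>i. \<integral>x. ?q i x \<partial>\<mu>) \<longlonglongrightarrow> ?D"
        proof (rule integral_dominated_convergence[where w = "\<lambda>x. 1 / d * (x powr (Re z - 2 * d) + x powr (Re z + 2 * d))"])
          show "integrable \<mu> (\<lambda>x. 1 / d * (x powr (Re z - 2 * d) + x powr (Re z + 2 * d)))"
            using d by (intro integrable_mult_right Bochner_Integration.integrable_add int) auto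
          show "AE x in \<mu>. (\<lambda>i. ?q i x) \<longlonglongrightarrow> of_real (ln x) * exp (z * of_real (ln x))"
          proof (rule AE_I2)
            fix x :: real
            have "((\<lambda>z. exp (z * of_real (ln x))) has_field_derivative (of_real (ln x) * exp (z * of_real (ln x)))) (at z)"
              by (auto intro!: derivative_eq_intros)
            then have "((\<lambda>h. (exp ((z + h) * of_real (ln x)) - exp (z * of_real (ln x))) / h) \<longlongrightarrow> of_real (ln x) * exp (z * of_real (ln x))) (at 0)"
              by (simp add: DERIV_def)
            then show "(\<lambda>i. ?q i x) \<longlonglongrightarrow> of_real (ln x) * exp (z * of_real (ln x))"
              using hd h0 by (auto simp: tendsto_at_iff_sequentially o_def)
          qed
          fix i
          show "AE x in \<mu>. norm (?q i x) \<le> 1 / d * (x powr (Re z - 2 * d) + x powr (Re z + 2 * d))"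
            using pos
          proof eventually_elim
            fix x :: real assume x: "0 < x"
            let ?L = "\<bar>ln x\<bar>"
            have "norm (?q i x) = x powr Re z * (norm (exp (h i * of_real (ln x)) - 1) / norm (h i))"
            proof -
              have "exp ((z + h i) * of_real (ln x)) - exp (z * of_real (ln x)) = exp (z * of_real (ln x)) * (exp (h i * of_real (ln x)) - 1)"
                by (simp add: exp_add algebra_simps)
              then show ?thesis by (simp only: norm_divide norm_mult norm_e[OF x] times_divide_eq_right)
            qed
            also have "\<dots> \<le> x powr Re z * (norm (h i * of_real (ln x)) * exp (norm (h i * of_real (ln x))) / norm (h i))"
              by (intro mult_left_mono divide_right_mono norm_exp_diff_1_le) auto
            also have "\<dots> = x powr Re z * (?L * exp (norm (h i) * ?L))"
              using hd(2)[of i] by (simp add: norm_mult)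
            also have "\<dots> \<le> x powr Re z * (exp (d * ?L) / d * exp (d * ?L))"
            proof (intro mult_left_mono mult_mono)
              have "d * ?L \<le> exp (d * ?L)" using exp_ge_add_one_self[of "d * ?L"] by linarith
              then show "?L \<le> exp (d * ?L) / d" using d by (simp add: field_simps)
              show "exp (norm (h i) * ?L) \<le> exp (d * ?L)"
                using hd(1)[of i] by (subst exp_le_cancel_iff, intro mult_right_mono) auto
            qed (use d in auto)
            also have "\<dots> = 1 / d * (x powr Re z * exp (2 * d * ?L))"
              by (simp add: mult_exp_exp)
            also have "x powr Re z * exp (2 * d * ?L) \<le> x powr (Re z - 2 * d) + x powr (Re z + 2 * d)"
            proof (cases "0 \<le> ln x")
              case True
              then have "x powr Re z * exp (2 * d * ?L) = x powr (Re z + 2 * d)"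
                using x by (simp add: powr_def mult_exp_exp algebra_simps)
              then show ?thesis by simp
            next
              case False
              then have "x powr Re z * exp (2 * d * ?L) = x powr (Re z - 2 * d)"
                using x by (simp add: powr_def mult_exp_exp algebra_simps)
              then show ?thesis by simp
            qed
            finally show "norm (?q i x) \<le> 1 / d * (x powr (Re z - 2 * d) + x powr (Re z + 2 * d))"
              using d by (simp add: divide_right_mono)
          qed
        qed measurable
        moreover have "(?F (z + h i) - ?F z) / h i = (\<integral>x. ?q i x \<partial>\<mu>)" for i
        proof -
          have "\<bar>Re (h i)\<bar> < d" using abs_Re_le_cmod[of "h i"] hd(1)[of i] by linarith
          then have "integrable \<mu> (\<lambda>x. exp ((z + h i) * of_real (ln x)))"
            using d by (intro int') auto
          then show ?thesis using int'[OF z] by simp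
        qed
        ultimately show "((\<lambda>h. (?F (z + h) - ?F z) / h) \<circ> h) \<longlonglongrightarrow> ?D" unfolding o_def by (simp only:)
      qed
    qed (use d in auto)
    then have "(?F has_field_derivative ?D) (at z)" by (simp add: DERIV_def)
    then show ?thesis by (auto simp: field_differentiable_def)
  qed
  then show ?thesis
    by (auto simp: holomorphic_on_def intro: field_differentiable_at_within)
qed

text \<open>Equal moments on a real segment force equal Mellin transforms on the open strip, by the
  identity theorem. The boundary values on Re z = 0 are the characteristic functions of
  \<open>ln\<close> under the two measures. The segment lies on one side of 0 only, and \<mu> is not
  assumed to have mass 1.\<close>

lemma Mellin_uniqueness:
  fixes \<mu> \<nu> :: "real measure" and a :: real
  assumes fin: "finite_measure \<mu>" and prob: "prob_space \<nu>"
    and sets [measurable_cong]: "sets \<mu> = sets borel" "sets \<nu> = sets borel"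
    and pos: "AE x in \<mu>. 0 < x" "AE x in \<nu>. 0 < x"
    and a: "a < 0"
    and int: "\<And>t. a < t \<Longrightarrow> t < 0 \<Longrightarrow> (\<integral>\<^sup>+x. ennreal (x powr t) \<partial>\<nu>) < \<infinity>"
    and eq: "\<And>t. a < t \<Longrightarrow> t < 0 \<Longrightarrow> (\<integral>\<^sup>+x. ennreal (x powr t) \<partial>\<mu>) = (\<integral>\<^sup>+x. ennreal (x powr t) \<partial>\<nu>)"
  shows "\<mu> = \<nu>"
proof -
  interpret \<mu>: finite_measure \<mu> by fact
  interpret \<nu>: prob_space \<nu> by fact
  have int1: "integrable \<nu> (\<lambda>x. x powr t)" and int2: "integrable \<mu> (\<lambda>x. x powr t)" if "a < t" "t < 0" for t
    using int[OF that] eq[OF that] by (auto intro!: integrableI_nonneg)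
  let ?F = "\<lambda>\<mu> z. \<integral>x. exp (z * of_real (ln x)) \<partial>(\<mu> :: real measure)"
  let ?S = "{z. a < Re z \<and> Re z < 0}"
  have real_arg: "?F M (of_real t) = complex_of_real (\<integral>x. x powr t \<partial>M)" if "AE x in M. 0 < x" and [measurable_cong]: "sets M = sets borel" for M t
  proof -
    have "?F M (of_real t) = (\<integral>x. complex_of_real (x powr t) \<partial>M)"
      using that(1) by (intro integral_cong_AE) (auto elim!: eventually_mono simp: powr_def exp_of_real[symmetric])
    then show ?thesis by simp
  qed
  have strip: "?F \<mu> z - ?F \<nu> z = 0" if z: "z \<in> ?S" for z
  proof (rule analytic_continuation[where f = "\<lambda>z. ?F \<mu> z - ?F \<nu> z" and S = ?S and U = "of_real ` {a<..<0}" and \<xi> = "of_real (a / 2)"])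
    show "(\<lambda>z. ?F \<mu> z - ?F \<nu> z) holomorphic_on ?S"
      by (intro holomorphic_on_diff holomorphic_Mellin int1 int2 pos sets)
    show "open ?S" by (intro open_Collect_conj open_Collect_less continuous_intros)
    have "?S = {z. a < Re z} \<inter> {z. Re z < 0}" by auto
    then have "convex ?S" by (simp add: convex_Int convex_halfspace_Re_gt convex_halfspace_Re_lt)
    then show "connected ?S" by (rule convex_connected)
    show "complex_of_real (a / 2) islimpt of_real ` {a<..<0}"
    proof (rule islimpt_isCont_image[OF _ continuous_of_real[OF continuous_ident]])
      show "a / 2 islimpt {a<..<0}" using a by (intro interior_limit_point) (simp add: interior_open)
      show "\<forall>\<^sub>F y in at (a / 2). complex_of_real y \<noteq> complex_of_real (a / 2)"
        unfolding of_real_eq_iff by (simp add: eventually_at_filter)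
    qed
    fix w assume "w \<in> complex_of_real ` {a<..<0}"
    then obtain t where t: "w = of_real t" "a < t" "t < 0" by auto
    have "(\<integral>x. x powr t \<partial>\<mu>) = (\<integral>x. x powr t \<partial>\<nu>)"
      using eq[OF t(2,3)] by (simp add: integral_eq_nn_integral)
    then show "?F \<mu> w - ?F \<nu> w = 0"
      by (simp add: t real_arg pos sets)
  qed (use a z in auto)
  \<comment> \<open>The imaginary axis bounds the strip without belonging to it. The abscissas a /
    (n + 2) start at a / 2, inside the strip, and tend to 0; x^(a/2) + 1 dominates all of
    them.\<close>
  have lim: "(\<lambda>n. ?F M (Complex (a / (real n + 2)) \<theta>)) \<longlonglongrightarrow> (\<integral>x. exp (\<i> * of_real (\<theta> * ln x)) \<partial>M)"
    if "finite_measure M" "AE x in M. 0 < x" and [measurable_cong]: "sets M = sets borel"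
      and int: "integrable M (\<lambda>x. x powr (a / 2))" for M \<theta>
  proof (rule integral_dominated_convergence[where w = "\<lambda>x. x powr (a / 2) + 1"])
    interpret finite_measure M by fact
    show "integrable M (\<lambda>x. x powr (a / 2) + 1)" using int by simp
    show "AE x in M. (\<lambda>n. exp (Complex (a / (real n + 2)) \<theta> * of_real (ln x))) \<longlonglongrightarrow> exp (\<i> * of_real (\<theta> * ln x))"
    proof (rule AE_I2)
      fix x
      have "(\<lambda>n. a / (real n + 2)) \<longlonglongrightarrow> 0" by real_asymp
      then have "(\<lambda>n. exp ((of_real (a / (real n + 2)) + \<i> * of_real \<theta>) * of_real (ln x))) \<longlonglongrightarrow> exp ((of_real 0 + \<i> * of_real \<theta>) * of_real (ln x))"
        by (intro tendsto_intros)
      then show "(\<lambda>n. exp (Complex (a / (real n + 2)) \<theta> * of_real (ln x))) \<longlonglongrightarrow> exp (\<i> * of_real (\<theta> * ln x))"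
        by (simp add: Complex_eq mult.assoc)
    qed
    fix n
    show "AE x in M. norm (exp (Complex (a / (real n + 2)) \<theta> * of_real (ln x))) \<le> x powr (a / 2) + 1"
      using that(2)
    proof eventually_elim
      fix x :: real assume x: "0 < x"
      have "norm (exp (Complex (a / (real n + 2)) \<theta> * of_real (ln x))) = x powr (a / (real n + 2))"
        using x by (simp add: powr_def)
      also have "\<dots> \<le> x powr (a / 2) + x powr 0"
        using a by (intro powr_le_add_powr) (auto simp: field_simps mult_nonpos_nonneg)
      finally show "norm (exp (Complex (a / (real n + 2)) \<theta> * of_real (ln x))) \<le> x powr (a / 2) + 1" using x by simp
    qed
  qed measurable
  have char_eq: "(\<integral>x. exp (\<i> * of_real (\<theta> * ln x)) \<partial>\<mu>) = (\<integral>x. exp (\<i> * of_real (\<theta> * ln x)) \<partial>\<nu>)" for \<theta>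
  proof (rule LIMSEQ_unique)
    show "(\<lambda>n. ?F \<mu> (Complex (a / (real n + 2)) \<theta>)) \<longlonglongrightarrow> (\<integral>x. exp (\<i> * of_real (\<theta> * ln x)) \<partial>\<mu>)"
      using a by (intro lim int2 pos sets fin) auto
    have "Complex (a / (real n + 2)) \<theta> \<in> ?S" for n using a by (auto simp: field_simps intro!: add_neg_nonpos mult_nonpos_nonneg)
    then have "?F \<mu> (Complex (a / (real n + 2)) \<theta>) = ?F \<nu> (Complex (a / (real n + 2)) \<theta>)" for n
      using strip by simp
    moreover have "(\<lambda>n. ?F \<nu> (Complex (a / (real n + 2)) \<theta>)) \<longlonglongrightarrow> (\<integral>x. exp (\<i> * of_real (\<theta> * ln x)) \<partial>\<nu>)"
      using a by (intro lim int1 pos sets \<nu>.finite_measure_axioms) auto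
    ultimately show "(\<lambda>n. ?F \<mu> (Complex (a / (real n + 2)) \<theta>)) \<longlonglongrightarrow> (\<integral>x. exp (\<i> * of_real (\<theta> * ln x)) \<partial>\<nu>)"
      by simp
  qed
  \<comment> \<open>At frequency 0 the boundary values are the total masses, so the merely finite
    \<mu> turns out to be a probability measure.\<close>
  have "complex_of_real (measure \<mu> (space \<mu>)) = of_real 1"
    using char_eq[of 0] \<nu>.prob_space by (simp add: scaleR_conv_of_real)
  then have "measure \<mu> (space \<mu>) = 1" by (simp only: of_real_eq_iff)
  then interpret \<mu>: prob_space \<mu> by (intro prob_spaceI) (simp add: \<mu>.emeasure_eq_measure)
  have rd: "real_distribution (distr M borel ln)" if "prob_space M" and [measurable_cong]: "sets M = sets borel" for M :: "real measure"
    using that by (auto simp: real_distribution_def real_distribution_axioms_def intro!: prob_space.prob_space_distr)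
  have "distr \<mu> borel ln = distr \<nu> borel ln"
  proof (rule Levy_uniqueness)
    show "char (distr \<mu> borel ln) = char (distr \<nu> borel ln)"
      using char_eq by (simp add: fun_eq_iff char_def integral_distr)
  qed (intro rd \<mu>.prob_space_axioms \<nu>.prob_space_axioms sets)+
  then have "distr (distr \<mu> borel ln) borel exp = distr (distr \<nu> borel ln) borel exp" by simp
  then have eq: "distr \<mu> borel (\<lambda>x. exp (ln x)) = distr \<nu> borel (\<lambda>x. exp (ln x))"
    by (simp add: distr_distr o_def)
  \<comment> \<open>\<open>exp\<close> inverts \<open>ln\<close> on the positive numbers, and these
    carry all the mass; so the laws of the logarithms determine the measures.\<close>
  have id: "distr M borel (\<lambda>x. exp (ln x)) = M" if "AE x in M. 0 < x" and [measurable_cong, simp]: "sets M = sets borel" for M :: "real measure"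
  proof -
    have "distr M borel (\<lambda>x. exp (ln x)) = distr M borel (\<lambda>x. x)"
      using that(1) by (intro distr_cong_AE) auto
    also have "\<dots> = distr M M (\<lambda>x. x)" by (intro distr_cong) auto
    finally show ?thesis by (simp add: distr_id2)
  qed
  show ?thesis using eq id[OF pos(1) sets(1)] id[OF pos(2) sets(2)] by simp
qed

section \<open>Independence and characteristic functions\<close>

context prob_space
begin

text \<open>As g is at least 1, its mean is positive and g divided by its mean is a probability
  density. The hypothesis says that X has the same characteristic function under the tilted and the
  original measure, hence the same law, which is the claimed decorrelation of g from the events of
  X.\<close>

lemma prob_eq_of_weighted_char_eq:
  fixes X g :: "'a \<Rightarrow> real"
  assumes [measurable]: "X \<in> borel_measurable M" "g \<in> borel_measurable M"
    and g: "\<And>\<omega>. 1 \<le> g \<omega>" "\<And>\<omega>. g \<omega> \<le> 3"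
    and char: "\<And>a. expectation (\<lambda>\<omega>. of_real (g \<omega>) * iexp (a * X \<omega>)) = of_real (expectation g) * expectation (\<lambda>\<omega>. iexp (a * X \<omega>))"
    and A [measurable]: "A \<in> sets borel"
  shows "expectation (\<lambda>\<omega>. g \<omega> * indicator A (X \<omega>)) = expectation g * expectation (\<lambda>\<omega>. indicator A (X \<omega>))"
proof -
  have "norm (g \<omega>) \<le> 3" for \<omega> using g(1)[of \<omega>] g(2)[of \<omega>] by simp
  then have ig: "integrable M g" by (intro integrable_const_bound[where B = 3]) auto
  define m where "m = expectation g"
  have "expectation (\<lambda>_. 1) \<le> expectation g" using g by (intro integral_mono ig) auto
  then have m: "0 < m" by (simp add: m_def prob_space)
  have gpos: "0 \<le> g \<omega> / m" for \<omega> using g(1)[of \<omega>] m by simp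
  let ?N = "density M (\<lambda>\<omega>. ennreal (g \<omega> / m))"
  have "emeasure ?N (space ?N) = ennreal (expectation (\<lambda>\<omega>. g \<omega> / m))"
    using ig gpos by (subst nn_integral_eq_integral[symmetric]) (auto simp: emeasure_density intro!: nn_integral_cong)
  then have "prob_space ?N" using m by (intro prob_spaceI) (simp add: m_def)
  then interpret N: prob_space ?N .
  have "distr ?N borel X = distr M borel X"
  proof (rule Levy_uniqueness)
    show "real_distribution (distr ?N borel X)" "real_distribution (distr M borel X)"
      by (auto simp: real_distribution_def real_distribution_axioms_def intro!: prob_space_distr N.prob_space_distr)
    show "char (distr ?N borel X) = char (distr M borel X)"
    proof
      fix a
      have "char (distr ?N borel X) a = expectation (\<lambda>\<omega>. (g \<omega> / m) *\<^sub>R iexp (a * X \<omega>))"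
        using gpos by (simp add: char_def integral_distr integral_density)
      also have "\<dots> = expectation (\<lambda>\<omega>. of_real (g \<omega>) * iexp (a * X \<omega>)) / of_real m"
        by (simp add: scaleR_conv_of_real flip: integral_divide_zero)
      also have "\<dots> = char (distr M borel X) a"
        using m by (subst char) (simp add: char_def integral_distr m_def)
      finally show "char (distr ?N borel X) a = char (distr M borel X) a" .
    qed
  qed
  then have "integral\<^sup>L (distr ?N borel X) (indicat_real A) = integral\<^sup>L (distr M borel X) (indicat_real A)" by simp
  moreover have "integral\<^sup>L (distr ?N borel X) (indicat_real A) = (\<integral>\<omega>. indicat_real A (X \<omega>) \<partial>?N)"
    by (rule integral_distr) measurable
  moreover have "(\<integral>\<omega>. indicat_real A (X \<omega>) \<partial>?N) = expectation (\<lambda>\<omega>. (g \<omega> / m) *\<^sub>R indicat_real A (X \<omega>))"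
    by (rule integral_density) (use gpos in auto)
  moreover have "integral\<^sup>L (distr M borel X) (indicat_real A) = expectation (\<lambda>\<omega>. indicat_real A (X \<omega>))"
    by (rule integral_distr) measurable
  ultimately have "expectation (\<lambda>\<omega>. g \<omega> / m * indicator A (X \<omega>)) = expectation (\<lambda>\<omega>. indicator A (X \<omega>))"
    by (simp only: real_scaleR_def)
  moreover have "expectation (\<lambda>\<omega>. g \<omega> / m * indicator A (X \<omega>)) = expectation (\<lambda>\<omega>. g \<omega> * indicator A (X \<omega>)) / m"
    by (simp flip: integral_divide_zero)
  ultimately show ?thesis using m by (simp add: m_def field_simps)
qed

lemma integrable_iexp_real [simp]:
  "X \<in> borel_measurable M \<Longrightarrow> integrable M (\<lambda>\<omega>. iexp (X \<omega> :: real))"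
  by (intro integrable_const_bound[where B = 1]) auto

text \<open>Tilting the measure by the bounded weights \<open>2 + Re (\<kappa> e\<^bsup>i b Y\<^esup>)\<close> and then \<open>1 + 1\<^sub>A(X)\<close> reduces this
  two-dimensional uniqueness statement to Levy's theorem on the line.\<close>

lemma indep_var_if_joint_char:
  fixes X Y :: "'a \<Rightarrow> real"
  assumes [measurable]: "X \<in> borel_measurable M" "Y \<in> borel_measurable M"
    and char: "\<And>a b. expectation (\<lambda>\<omega>. iexp (a * X \<omega> + b * Y \<omega>)) = expectation (\<lambda>\<omega>. iexp (a * X \<omega>)) * expectation (\<lambda>\<omega>. iexp (b * Y \<omega>))"
  shows "indep_var borel X borel Y"
proof -
  \<comment> \<open>The unit \<open>\<kappa>\<close> is kept general so that \<kappa> = 1 yields the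
    real part of the exponential and \<kappa> = -i the imaginary part. Adding 2 keeps the weight
    between 1 and 3.\<close>
  have Re_iexp: "expectation (\<lambda>\<omega>. Re (\<kappa> * iexp (b * Y \<omega>)) * indicator A (X \<omega>)) = expectation (\<lambda>\<omega>. Re (\<kappa> * iexp (b * Y \<omega>))) * expectation (\<lambda>\<omega>. indicator A (X \<omega>))"
    if \<kappa>: "norm \<kappa> = 1" and [measurable]: "A \<in> sets borel" for \<kappa> b A
  proof -
    let ?R = "\<lambda>\<omega>. Re (\<kappa> * iexp (b * Y \<omega>))"
    have R: "\<bar>?R \<omega>\<bar> \<le> 1" for \<omega>
      using abs_Re_le_cmod[of "\<kappa> * iexp (b * Y \<omega>)"] \<kappa> by (simp add: norm_mult)
    have intR: "integrable M ?R" by (rule integrable_const_bound[where B = 1]) (use R in auto)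
    have R_eq: "complex_of_real (?R \<omega>) = (\<kappa> * iexp (b * Y \<omega>) + cnj \<kappa> * iexp (- b * Y \<omega>)) / 2" for \<omega>
    proof -
      have "cnj (iexp (b * Y \<omega>)) = iexp (- b * Y \<omega>)" by (simp add: exp_cnj)
      then have "cnj \<kappa> * iexp (- b * Y \<omega>) = cnj (\<kappa> * iexp (b * Y \<omega>))" by simp
      then show ?thesis by (simp only: complex_add_cnj) simp
    qed
    have ER: "complex_of_real (expectation ?R) = (\<kappa> * expectation (\<lambda>\<omega>. iexp (b * Y \<omega>)) + cnj \<kappa> * expectation (\<lambda>\<omega>. iexp (- b * Y \<omega>))) / 2"
      unfolding integral_complex_of_real[symmetric] R_eq
      by (simp only: integral_divide_zero Bochner_Integration.integral_add integrable_iexp_real integrable_mult_right integral_mult_right_zero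
              borel_measurable_add borel_measurable_times borel_measurable_const assms)
    have "expectation (\<lambda>\<omega>. (2 + ?R \<omega>) * indicator A (X \<omega>)) = expectation (\<lambda>\<omega>. 2 + ?R \<omega>) * expectation (\<lambda>\<omega>. indicator A (X \<omega>))"
    proof (rule prob_eq_of_weighted_char_eq)
      fix \<omega> show "1 \<le> 2 + ?R \<omega>" "2 + ?R \<omega> \<le> 3" using R[of \<omega>] by linarith+
    next
      fix a
      let ?E = "\<lambda>c. expectation (\<lambda>\<omega>. iexp (a * X \<omega> + c * Y \<omega>))"
      have "complex_of_real (2 + ?R \<omega>) * iexp (a * X \<omega>) = 2 * iexp (a * X \<omega>) + \<kappa> / 2 * iexp (a * X \<omega> + b * Y \<omega>) + cnj \<kappa> / 2 * iexp (a * X \<omega> + (- b) * Y \<omega>)" for \<omega>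
        unfolding of_real_add R_eq by (simp add: algebra_simps mult_exp_exp)
      then have "expectation (\<lambda>\<omega>. of_real (2 + ?R \<omega>) * iexp (a * X \<omega>)) =
        expectation (\<lambda>\<omega>. 2 * iexp (a * X \<omega>) + \<kappa> / 2 * iexp (a * X \<omega> + b * Y \<omega>) + cnj \<kappa> / 2 * iexp (a * X \<omega> + (- b) * Y \<omega>))"
        by (simp only:)
      also have "\<dots> = 2 * expectation (\<lambda>\<omega>. iexp (a * X \<omega>)) + \<kappa> / 2 * ?E b + cnj \<kappa> / 2 * ?E (- b)"
        by (simp only: Bochner_Integration.integral_add integrable_iexp_real Bochner_Integration.integrable_add integrable_mult_right integral_mult_right_zero
              borel_measurable_add borel_measurable_times borel_measurable_const assms)
      also have "\<dots> = (2 + (\<kappa> * expectation (\<lambda>\<omega>. iexp (b * Y \<omega>)) + cnj \<kappa> * expectation (\<lambda>\<omega>. iexp (- b * Y \<omega>))) / 2) * expectation (\<lambda>\<omega>. iexp (a * X \<omega>))"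
        unfolding char by (simp add: field_simps)
      also have "2 + (\<kappa> * expectation (\<lambda>\<omega>. iexp (b * Y \<omega>)) + cnj \<kappa> * expectation (\<lambda>\<omega>. iexp (- b * Y \<omega>))) / 2 = complex_of_real (2 + expectation ?R)"
        unfolding ER[symmetric] by simp
      also have "2 + expectation ?R = expectation (\<lambda>\<omega>. 2 + ?R \<omega>)"
        using intR by (simp add: prob_space)
      finally show "expectation (\<lambda>\<omega>. of_real (2 + ?R \<omega>) * iexp (a * X \<omega>)) = of_real (expectation (\<lambda>\<omega>. 2 + ?R \<omega>)) * expectation (\<lambda>\<omega>. iexp (a * X \<omega>))" .
    qed measurable
    moreover have "expectation (\<lambda>\<omega>. (2 + ?R \<omega>) * indicator A (X \<omega>)) = 2 * expectation (\<lambda>\<omega>. indicator A (X \<omega>)) + expectation (\<lambda>\<omega>. ?R \<omega> * indicator A (X \<omega>))"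
    proof -
      have "integrable M (\<lambda>\<omega>. indicat_real A (X \<omega>))" by (rule integrable_const_bound[where B = 1]) auto
      moreover have "integrable M (\<lambda>\<omega>. ?R \<omega> * indicat_real A (X \<omega>))"
        by (rule integrable_const_bound[where B = 1]) (use R in \<open>auto simp: indicator_def\<close>)
      ultimately show ?thesis unfolding distrib_right by (subst Bochner_Integration.integral_add) auto
    qed
    moreover have "expectation (\<lambda>\<omega>. 2 + ?R \<omega>) = 2 + expectation ?R" using intR by (simp add: prob_space)
    ultimately show ?thesis by (simp add: algebra_simps)
  qed
  have iexp_A: "expectation (\<lambda>\<omega>. of_real (indicator A (X \<omega>)) * iexp (b * Y \<omega>)) = of_real (expectation (\<lambda>\<omega>. indicator A (X \<omega>))) * expectation (\<lambda>\<omega>. iexp (b * Y \<omega>))"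
    if [measurable]: "A \<in> sets borel" for A b
  proof (rule complex_eqI)
    let ?I = "\<lambda>\<omega>. of_real (indicator A (X \<omega>)) * iexp (b * Y \<omega>)"
    have int: "integrable M ?I" "integrable M (\<lambda>\<omega>. iexp (b * Y \<omega>))"
      by (rule integrable_const_bound[where B = 1], auto simp: norm_mult indicator_def)+
    show "Re (expectation ?I) = Re (of_real (expectation (\<lambda>\<omega>. indicator A (X \<omega>))) * expectation (\<lambda>\<omega>. iexp (b * Y \<omega>)))"
      using Re_iexp[of 1 A b] int by (simp add: mult.commute flip: integral_Re)
    show "Im (expectation ?I) = Im (of_real (expectation (\<lambda>\<omega>. indicator A (X \<omega>))) * expectation (\<lambda>\<omega>. iexp (b * Y \<omega>)))"
      using Re_iexp[of "-\<i>" A b] int by (simp add: mult.commute flip: integral_Im)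
  qed
  have prod: "prob (X -` A \<inter> space M \<inter> (Y -` C \<inter> space M)) = prob (X -` A \<inter> space M) * prob (Y -` C \<inter> space M)"
    if [measurable]: "A \<in> sets borel" "C \<in> sets borel" for A C
  proof -
    let ?I = "\<lambda>\<omega>. indicat_real A (X \<omega>)" and ?J = "\<lambda>\<omega>. indicat_real C (Y \<omega>)"
    have int: "integrable M ?I" "integrable M ?J" "integrable M (\<lambda>\<omega>. ?I \<omega> * ?J \<omega>)"
      by (rule integrable_const_bound[where B = 1], auto simp: indicator_def)+
    have "expectation (\<lambda>\<omega>. (1 + ?I \<omega>) * ?J \<omega>) = expectation (\<lambda>\<omega>. 1 + ?I \<omega>) * expectation ?J"
    proof (rule prob_eq_of_weighted_char_eq)
      fix b
      have intc: "integrable M (\<lambda>\<omega>. of_real (?I \<omega>) * iexp (b * Y \<omega>))"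
        by (rule integrable_const_bound[where B = 1], auto simp: norm_mult indicator_def)
      have "expectation (\<lambda>\<omega>. of_real (1 + ?I \<omega>) * iexp (b * Y \<omega>)) = expectation (\<lambda>\<omega>. iexp (b * Y \<omega>) + of_real (?I \<omega>) * iexp (b * Y \<omega>))"
        by (intro Bochner_Integration.integral_cong) (auto simp: distrib_right)
      also have "\<dots> = expectation (\<lambda>\<omega>. iexp (b * Y \<omega>)) + expectation (\<lambda>\<omega>. of_real (?I \<omega>) * iexp (b * Y \<omega>))"
        by (intro Bochner_Integration.integral_add intc integrable_iexp_real) measurable
      also have "\<dots> = of_real (1 + expectation ?I) * expectation (\<lambda>\<omega>. iexp (b * Y \<omega>))"
        by (subst iexp_A) (auto simp: distrib_right)
      also have "1 + expectation ?I = expectation (\<lambda>\<omega>. 1 + ?I \<omega>)" using int by (simp add: prob_space del: integral_indicator)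
      finally show "expectation (\<lambda>\<omega>. of_real (1 + ?I \<omega>) * iexp (b * Y \<omega>)) = of_real (expectation (\<lambda>\<omega>. 1 + ?I \<omega>)) * expectation (\<lambda>\<omega>. iexp (b * Y \<omega>))" .
    qed (auto simp: indicator_def)
    then have "expectation (\<lambda>\<omega>. ?I \<omega> * ?J \<omega>) = expectation ?I * expectation ?J"
      using int by (simp add: distrib_right prob_space del: integral_indicator)
    moreover have "expectation (\<lambda>\<omega>. indicat_real A (X \<omega>) * indicat_real C (Y \<omega>)) = prob (X -` A \<inter> space M \<inter> (Y -` C \<inter> space M))"
    proof -
      have "expectation (\<lambda>\<omega>. indicat_real A (X \<omega>) * indicat_real C (Y \<omega>)) = expectation (indicat_real (X -` A \<inter> space M \<inter> (Y -` C \<inter> space M)))"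
        by (intro Bochner_Integration.integral_cong) (auto simp: indicator_def)
      then show ?thesis by simp
    qed
    moreover have "expectation (\<lambda>\<omega>. indicat_real A (X \<omega>)) = prob (X -` A \<inter> space M)" if [measurable]: "X \<in> borel_measurable M" "A \<in> sets borel" for X :: "'a \<Rightarrow> real" and A
    proof -
      have "expectation (\<lambda>\<omega>. indicat_real A (X \<omega>)) = expectation (indicat_real (X -` A \<inter> space M))"
        by (intro Bochner_Integration.integral_cong) (auto simp: indicator_def)
      then show ?thesis by simp
    qed
    ultimately show ?thesis by (simp del: integral_indicator)
  qed
  have st: "Int_stable {Z -` A \<inter> space M |A. A \<in> sets borel}" for Z :: "'a \<Rightarrow> real"
    unfolding Int_stable_def
  proof safe
    fix A C :: "real set" assume "A \<in> sets borel" "C \<in> sets borel"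
    then show "\<exists>D. Z -` A \<inter> space M \<inter> (Z -` C \<inter> space M) = Z -` D \<inter> space M \<and> D \<in> sets borel"
      by (intro exI[of _ "A \<inter> C"]) auto
  qed
  have "indep_set {X -` A \<inter> space M |A. A \<in> sets borel} {Y -` A \<inter> space M |A. A \<in> sets borel}"
    using prod by (intro indep_setI) auto
  then have "indep_set (sigma_sets (space M) {X -` A \<inter> space M |A. A \<in> sets borel}) (sigma_sets (space M) {Y -` A \<inter> space M |A. A \<in> sets borel})"
    by (intro indep_set_sigma_sets st)
  then show ?thesis by (auto simp: indep_var_eq)
qed

end

section \<open>Area increments of Brownian motion\<close>

text \<open>Uniform continuity bounds the error on a cell by e' times its length, and an induction
  over the cells adds these errors up.\<close>

lemma Riemann_sum_tendsto_integral:
  fixes f :: "real \<Rightarrow> real"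
  assumes cont: "continuous_on {a..a + r} f" and r: "0 \<le> r"
  shows "(\<lambda>K. \<Sum>i<K. r / real K * f (a + r * real i / real K)) \<longlonglongrightarrow> integral {a..a + r} f"
proof (rule LIMSEQ_I)
  fix e :: real assume "0 < e"
  \<comment> \<open>Division by r + 1 instead of r keeps e' meaningful for r = 0 and still gives e'
    r < e.\<close>
  define e' where "e' = e / (r + 1)"
  have e': "0 < e'" "e' * r < e" using \<open>0 < e\<close> r by (auto simp: e'_def field_simps)
  have "uniformly_continuous_on {a..a + r} f" using cont by (rule compact_uniformly_continuous) simp
  then obtain d where d: "0 < d" "\<And>x y. x \<in> {a..a + r} \<Longrightarrow> y \<in> {a..a + r} \<Longrightarrow> dist y x < d \<Longrightarrow> dist (f y) (f x) < e'"
    using e'(1) unfolding uniformly_continuous_on_def by metis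
  obtain K0 :: nat where K0: "r / d < real K0" using reals_Archimedean2 by blast
  have "norm ((\<Sum>i<K. r / real K * f (a + r * real i / real K)) - integral {a..a + r} f) < e" if K: "Suc K0 \<le> K" for K
  proof -
    have Kpos: "0 < real K" using K by simp
    have small: "r / real K < d"
    proof -
      have "r / d < real K" using K0 K by simp
      then show ?thesis using d(1) Kpos by (simp add: field_simps)
    qed
    have nn: "0 \<le> r / real K" using r by simp
    have "norm (integral {a..a + r * real j / real K} f - (\<Sum>i<j. r / real K * f (a + r * real i / real K))) \<le> e' * (r * real j / real K)"
      if "j \<le> K" for j using that
    proof (induction j)
      case (Suc j)
      define t where "t i = a + r * real i / real K" for i
      have tS: "t (Suc j) = t j + r / real K" by (simp add: t_def add_divide_distrib distrib_left)
      have t_le: "t (Suc j) \<le> a + r"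
      proof -
        have "r * real (Suc j) \<le> r * real K" using Suc.prems r by (intro mult_left_mono) auto
        then show ?thesis using Kpos by (simp add: t_def field_simps)
      qed
      have a_le: "a \<le> t j" using r by (simp add: t_def)
      have int: "f integrable_on {a..t (Suc j)}"
        using t_le by (intro integrable_continuous_interval continuous_on_subset[OF cont]) auto
      have comb: "integral {a..t j} f + integral {t j..t (Suc j)} f = integral {a..t (Suc j)} f"
        using a_le tS nn int by (intro Henstock_Kurzweil_Integration.integral_combine) auto
      have int2: "f integrable_on {t j..t (Suc j)}"
        using int by (rule integrable_subinterval_real) (use a_le in auto)
      have "norm (integral {t j..t (Suc j)} (\<lambda>x. f x - f (t j))) \<le> e' * (t (Suc j) - t j)"
      proof (rule integral_bound)
        show "t j \<le> t (Suc j)" using tS nn by simp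
        show "continuous_on {t j..t (Suc j)} (\<lambda>x. f x - f (t j))"
          using t_le a_le by (intro continuous_intros continuous_on_subset[OF cont]) auto
        fix x assume x: "x \<in> {t j..t (Suc j)}"
        then have "dist (f x) (f (t j)) < e'"
          using t_le a_le tS nn small by (intro d(2)) (auto simp: dist_real_def)
        then show "norm (f x - f (t j)) \<le> e'" by (simp add: dist_norm)
      qed
      moreover have "integral {t j..t (Suc j)} (\<lambda>x. f x - f (t j)) = integral {t j..t (Suc j)} f - r / real K * f (t j)"
        using int2 tS nn by (subst Henstock_Kurzweil_Integration.integral_diff) auto
      ultimately have "norm (integral {t j..t (Suc j)} f - r / real K * f (t j)) \<le> e' * (r / real K)" using tS by simp
      moreover have "norm (integral {a..t j} f - (\<Sum>i<j. r / real K * f (t i))) \<le> e' * (r * real j / real K)"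
        using Suc by (simp add: t_def)
      moreover have "integral {a..t (Suc j)} f - (\<Sum>i<Suc j. r / real K * f (t i)) =
        (integral {a..t j} f - (\<Sum>i<j. r / real K * f (t i))) + (integral {t j..t (Suc j)} f - r / real K * f (t j))"
        using comb by simp
      ultimately have "norm (integral {a..t (Suc j)} f - (\<Sum>i<Suc j. r / real K * f (t i))) \<le> e' * (r * real j / real K) + e' * (r / real K)"
        by (metis add_mono norm_triangle_le)
      also have "\<dots> = e' * (r * real (Suc j) / real K)" by (simp add: field_simps add_divide_distrib)
      finally show ?case by (simp add: t_def)
    qed simp
    from this[of K] have "norm (integral {a..a + r} f - (\<Sum>i<K. r / real K * f (a + r * real i / real K))) \<le> e' * r"
      using Kpos by simp
    then show ?thesis using e'(2) by (simp add: norm_minus_commute)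
  qed
  then show "\<exists>no. \<forall>n\<ge>no. norm ((\<Sum>i<n. r / real n * f (a + r * real i / real n)) - integral {a..a + r} f) < e" by blast
qed

abbreviation (input) gaussian :: "real measure" ("\<gamma>") where "\<gamma> \<equiv> std_normal_distribution"

lemma (in prob_space) expectation_iexp_normal:
  assumes Y: "distributed M lborel Y (normal_density 0 \<sigma>)" and \<sigma>: "0 < \<sigma>"
  shows "expectation (\<lambda>\<omega>. iexp (d * Y \<omega>)) = of_real (exp (- (d * \<sigma>)\<^sup>2 / 2))"
proof -
  have [measurable]: "Y \<in> borel_measurable M" using distributed_measurable[OF Y] by simp
  have "distributed M lborel (\<lambda>\<omega>. (Y \<omega> - 0) / \<sigma>) std_normal_density"
    using Y normal_standard_normal_convert[OF \<sigma>, of Y 0] by simp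
  then have eq: "distr M lborel (\<lambda>\<omega>. Y \<omega> / \<sigma>) = \<gamma>"
    by (simp add: distributed_def)
  have "expectation (\<lambda>\<omega>. iexp (d * Y \<omega>)) = expectation (\<lambda>\<omega>. iexp ((d * \<sigma>) * (Y \<omega> / \<sigma>)))"
    using \<sigma> by simp
  also have "\<dots> = (CLINT x|distr M lborel (\<lambda>\<omega>. Y \<omega> / \<sigma>). iexp ((d * \<sigma>) * x))"
    by (subst integral_distr) auto
  also have "\<dots> = char \<gamma> (d * \<sigma>)" by (simp add: eq char_def)
  finally show ?thesis by (simp add: char_std_normal_distribution)
qed

text \<open>Pathwise and measurability facts are separated from the distributional ones: they are
  needed for the given motion, which vanishes at time 0 only almost surely, and for its recentred
  version, which alone fits \<open>brownian\<close>.\<close>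

locale continuous_process =
  fixes M :: "'a measure" and B :: "real \<Rightarrow> 'a \<Rightarrow> real"
  assumes B_measurable: "0 \<le> t \<Longrightarrow> B t \<in> borel_measurable M"
    and B_continuous: "\<omega> \<in> space M \<Longrightarrow> continuous_on {0..} (\<lambda>t. B t \<omega>)"

locale brownian = prob_space M + continuous_process M B for M :: "'a measure" and B :: "real \<Rightarrow> 'a \<Rightarrow> real" +
  assumes B_zero: "\<omega> \<in> space M \<Longrightarrow> B 0 \<omega> = 0"
    and B_indep: "\<And>\<tau> n. 0 \<le> \<tau> 0 \<Longrightarrow> (\<And>i. i < n \<Longrightarrow> \<tau> i < \<tau> (Suc i)) \<Longrightarrow>
        indep_vars (\<lambda>_. borel) (\<lambda>i \<omega>. B (\<tau> (Suc i)) \<omega> - B (\<tau> i) \<omega>) {..<(n::nat)}"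
    and B_normal: "0 \<le> s \<Longrightarrow> s < t \<Longrightarrow> distributed M lborel (\<lambda>\<omega>. B t \<omega> - B s \<omega>) (normal_density 0 (sqrt (t - s)))"
begin

text \<open>The part of the area increment over \<open>[s, s + r]\<close> orthogonal to the increment of \<open>B\<close>.\<close>

definition area :: "real \<Rightarrow> real \<Rightarrow> 'a \<Rightarrow> real" where
  "area s r \<omega> = integral {s..s + r} (\<lambda>t. B t \<omega> - B s \<omega>) - r / 2 * (B (s + r) \<omega> - B s \<omega>)"

text \<open>The extra term with weight r / K tends to 0. It is the boundary term of a summation by
  parts, so that the K-th approximation is exactly a weighted sum of grid increments.\<close>

lemma area_tendsto:
  assumes "\<omega> \<in> space M" "0 \<le> s" "0 \<le> r"
  shows "(\<lambda>K. (\<Sum>i<K. r / real K * (B (s + r * real i / real K) \<omega> - B s \<omega>)) + r / real K * (B (s + r) \<omega> - B s \<omega>)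
    - r / 2 * (B (s + r) \<omega> - B s \<omega>)) \<longlonglongrightarrow> area s r \<omega>"
proof -
  have "continuous_on {s..s + r} (\<lambda>t. B t \<omega> - B s \<omega>)"
    using assms by (intro continuous_intros continuous_on_subset[OF B_continuous]) auto
  then have "(\<lambda>K. (\<Sum>i<K. r / real K * (B (s + r * real i / real K) \<omega> - B s \<omega>))) \<longlonglongrightarrow> integral {s..s + r} (\<lambda>t. B t \<omega> - B s \<omega>)"
    using assms by (intro Riemann_sum_tendsto_integral)
  moreover have "(\<lambda>K. r / real K * (B (s + r) \<omega> - B s \<omega>)) \<longlonglongrightarrow> 0 * (B (s + r) \<omega> - B s \<omega>)"
    by (intro tendsto_intros)
  ultimately have "(\<lambda>K. (\<Sum>i<K. r / real K * (B (s + r * real i / real K) \<omega> - B s \<omega>)) + r / real K * (B (s + r) \<omega> - B s \<omega>)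
    - r / 2 * (B (s + r) \<omega> - B s \<omega>)) \<longlonglongrightarrow> integral {s..s + r} (\<lambda>t. B t \<omega> - B s \<omega>) + 0 * (B (s + r) \<omega> - B s \<omega>) - r / 2 * (B (s + r) \<omega> - B s \<omega>)"
    by (intro tendsto_intros)
  then show ?thesis by (simp add: area_def)
qed

lemma measurable_area [measurable]:
  assumes "0 \<le> s" "0 \<le> r"
  shows "area s r \<in> borel_measurable M"
proof (rule borel_measurable_LIMSEQ_real[OF area_tendsto])
  fix K :: nat
  have [measurable]: "B s \<in> borel_measurable M" "B (s + r) \<in> borel_measurable M" "B (s + r * real i / real K) \<in> borel_measurable M" for i
    using assms by (auto intro!: B_measurable)
  show "(\<lambda>\<omega>. (\<Sum>i<K. r / real K * (B (s + r * real i / real K) \<omega> - B s \<omega>)) + r / real K * (B (s + r) \<omega> - B s \<omega>)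
    - r / 2 * (B (s + r) \<omega> - B s \<omega>)) \<in> borel_measurable M" by measurable
qed (use assms in auto)

text \<open>By summation by parts, a times the area plus b times the increment is a limit of sums of
  independent increments with weights c(u) = a (r/2 - r u) + b. Characteristic functions multiply,
  and the exponents form Riemann sums for -(r/2) times the integral of c^2 over [0, 1].\<close>

lemma joint_char_area_increment:
  assumes s: "0 \<le> s" and r: "0 < r"
  shows "expectation (\<lambda>\<omega>. iexp (a * area s r \<omega> + b * (B (s + r) \<omega> - B s \<omega>))) = of_real (exp (- (r / 2) * (a\<^sup>2 * r\<^sup>2 / 12 + b\<^sup>2)))"
proof -
  define Y where "Y K i \<omega> = B (s + r * real (Suc i) / real K) \<omega> - B (s + r * real i / real K) \<omega>" for K i \<omega>
  define c where "c u = a * (r / 2 - r * u) + b" for u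
  define S where "S K \<omega> = (\<Sum>i<K. c (real i / real K) * Y K i \<omega>)" for K \<omega>
  have [measurable]: "Y K i \<in> borel_measurable M" for K i
    unfolding Y_def using s r by (intro borel_measurable_diff B_measurable) auto
  have S_eq: "S K \<omega> = a * ((\<Sum>i<K. r / real K * (B (s + r * real i / real K) \<omega> - B s \<omega>)) + r / real K * (B (s + r) \<omega> - B s \<omega>)
    - r / 2 * (B (s + r) \<omega> - B s \<omega>)) + b * (B (s + r) \<omega> - B s \<omega>)" if K: "0 < K" for K \<omega>
  proof -
    define f where "f i = B (s + r * real i / real K) \<omega> - B s \<omega>" for i
    \<comment> \<open>Summation by parts, stated for every partial sum so that induction applies;
      \<open>c\<close> drops by a r / K from one grid point to the next.\<close>
    have "(\<Sum>i<j. c (real i / real K) * (f (Suc i) - f i)) = c (real j / real K) * f j + a * (\<Sum>i<j. r / real K * f i) + a * r / real K * f j" for j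
    proof (induction j)
      case (Suc j)
      have "c (real j / real K) = c (real (Suc j) / real K) + a * r / real K"
        by (simp add: c_def field_simps add_divide_distrib)
      then show ?case using Suc by (simp only: sum.lessThan_Suc) (simp add: algebra_simps add_divide_distrib diff_divide_distrib)
    qed (simp add: f_def)
    from this[of K] have "S K \<omega> = c 1 * f K + a * (\<Sum>i<K. r / real K * f i) + a * r / real K * f K"
      using K by (simp add: S_def Y_def f_def)
    moreover have "f K = B (s + r) \<omega> - B s \<omega>" using K by (simp add: f_def)
    ultimately show ?thesis by (simp add: f_def c_def algebra_simps)
  qed
  have ES: "expectation (\<lambda>\<omega>. iexp (S K \<omega>)) = of_real (exp (- (r / 2) * (\<Sum>i<K. 1 / real K * (c (0 + 1 * real i / real K))\<^sup>2)))" if K: "0 < K" for K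
  proof -
    have "indep_vars (\<lambda>_. borel) (Y K) {..<K}"
      unfolding Y_def using s r K by (intro B_indep[where \<tau> = "\<lambda>i. s + r * real i / real K"]) (auto simp: field_simps)
    then have ind: "indep_vars (\<lambda>_. borel) (\<lambda>i \<omega>. c (real i / real K) * Y K i \<omega>) {..<K}"
      by (rule indep_vars_compose2[where Y = "\<lambda>i y. c (real i / real K) * y"]) auto
    have nrm: "distributed M lborel (Y K i) (normal_density 0 (sqrt (r / real K)))" for i
    proof -
      have eq: "s + r * real (Suc i) / real K - (s + r * real i / real K) = r / real K"
        by (simp add: algebra_simps add_divide_distrib)
      have "0 < r / real K" using r K by simp
      then have "s + r * real i / real K < s + r * real (Suc i) / real K" using eq by linarith
      moreover have "0 \<le> s + r * real i / real K" using s r by simp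
      ultimately show ?thesis
        using B_normal unfolding Y_def eq[symmetric] by blast
    qed
    have "expectation (\<lambda>\<omega>. iexp (S K \<omega>)) = char (distr M borel (S K)) 1"
      unfolding char_def S_def by (subst integral_distr) auto
    also have "\<dots> = (\<Prod>i<K. char (distr M borel (\<lambda>\<omega>. c (real i / real K) * Y K i \<omega>)) 1)"
      unfolding S_def by (rule char_distr_sum[OF ind])
    also have "\<dots> = (\<Prod>i<K. of_real (exp (- (c (real i / real K) * sqrt (r / real K))\<^sup>2 / 2)))"
    proof (rule prod.cong[OF refl])
      fix i
      show "char (distr M borel (\<lambda>\<omega>. c (real i / real K) * Y K i \<omega>)) 1 = of_real (exp (- (c (real i / real K) * sqrt (r / real K))\<^sup>2 / 2))"
        using expectation_iexp_normal[OF nrm, of "c (real i / real K)" i] r K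
        unfolding char_def by (subst integral_distr) auto
    qed
    also have "\<dots> = of_real (exp (\<Sum>i<K. - (c (real i / real K) * sqrt (r / real K))\<^sup>2 / 2))"
      by (simp add: exp_sum)
    also have "(\<Sum>i<K. - (c (real i / real K) * sqrt (r / real K))\<^sup>2 / 2) = - (r / 2) * (\<Sum>i<K. 1 / real K * (c (0 + 1 * real i / real K))\<^sup>2)"
      using r by (simp add: sum_distrib_left power_mult_distrib mult_ac sum_negf)
    finally show ?thesis .
  qed
  have "(\<lambda>K. \<Sum>i<K. 1 / real K * (c (0 + 1 * real i / real K))\<^sup>2) \<longlonglongrightarrow> integral {0..0 + 1} (\<lambda>u. (c u)\<^sup>2)"
    by (intro Riemann_sum_tendsto_integral) (auto simp: c_def intro!: continuous_intros)
  \<comment> \<open>The centred part a (r/2 - r u) of the weight has mean 0 and second moment a^2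
    r^2 / 12, so no mixed term in a and b survives. This is the independence of area and
    increment.\<close>
  moreover have "((\<lambda>u. (c u)\<^sup>2) has_integral (a\<^sup>2 * r\<^sup>2 / 12 + b\<^sup>2)) {0..1}"
  proof -
    define G where "G u = (a * r / 2 + b)\<^sup>2 * u - (a * r / 2 + b) * (a * r) * u\<^sup>2 + a\<^sup>2 * r\<^sup>2 * u ^ 3 / 3" for u
    have "((\<lambda>u. (c u)\<^sup>2) has_integral (G 1 - G 0)) {0..1}"
      unfolding G_def c_def
      by (rule fundamental_theorem_of_calculus)
         (auto intro!: derivative_eq_intros simp: has_real_derivative_iff_has_vector_derivative[symmetric] power2_eq_square algebra_simps)
    moreover have "G 1 - G 0 = a\<^sup>2 * r\<^sup>2 / 12 + b\<^sup>2" by (simp add: G_def power2_eq_square field_simps)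
    ultimately show ?thesis by simp
  qed
  ultimately have lim: "(\<lambda>K. \<Sum>i<K. 1 / real K * (c (0 + 1 * real i / real K))\<^sup>2) \<longlonglongrightarrow> a\<^sup>2 * r\<^sup>2 / 12 + b\<^sup>2"
    by (simp add: integral_unique)
  have "(\<lambda>K. expectation (\<lambda>\<omega>. iexp (S (Suc K) \<omega>))) \<longlonglongrightarrow> of_real (exp (- (r / 2) * (a\<^sup>2 * r\<^sup>2 / 12 + b\<^sup>2)))"
    using ES by (simp only: zero_less_Suc) (intro tendsto_intros LIMSEQ_Suc[OF lim])
  moreover have "(\<lambda>K. expectation (\<lambda>\<omega>. iexp (S (Suc K) \<omega>))) \<longlonglongrightarrow> expectation (\<lambda>\<omega>. iexp (a * area s r \<omega> + b * (B (s + r) \<omega> - B s \<omega>)))"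
  proof (rule integral_dominated_convergence[where w = "\<lambda>_. 1"])
    have [measurable]: "area s r \<in> borel_measurable M" "B (s + r) \<in> borel_measurable M" "B s \<in> borel_measurable M"
      using s r by (auto intro!: B_measurable measurable_area)
    show "(\<lambda>\<omega>. iexp (a * area s r \<omega> + b * (B (s + r) \<omega> - B s \<omega>))) \<in> borel_measurable M" by measurable
    show "(\<lambda>\<omega>. iexp (S (Suc K) \<omega>)) \<in> borel_measurable M" for K unfolding S_def by measurable
    show "AE \<omega> in M. (\<lambda>K. iexp (S (Suc K) \<omega>)) \<longlonglongrightarrow> iexp (a * area s r \<omega> + b * (B (s + r) \<omega> - B s \<omega>))"
    proof (rule AE_I2)
      fix \<omega> assume "\<omega> \<in> space M"
      from LIMSEQ_Suc[OF area_tendsto[OF this s less_imp_le[OF r]]]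
      show "(\<lambda>K. iexp (S (Suc K) \<omega>)) \<longlonglongrightarrow> iexp (a * area s r \<omega> + b * (B (s + r) \<omega> - B s \<omega>))"
        unfolding S_eq[OF zero_less_Suc] by (intro tendsto_intros)
    qed
  qed auto
  ultimately show ?thesis using LIMSEQ_unique by blast
qed

end

section \<open>Independence of past and future\<close>

text \<open>Because the stages grow, sets taken from stages m and n both lie in stage
  \<open>max m n\<close>. Hence the unions are again stable under intersection, and independence can
  be checked within one stage.\<close>

lemma (in prob_space) indep_set_sigma_UN:
  fixes \<A> \<C> :: "nat \<Rightarrow> 'a set set"
  assumes ind: "\<And>n. indep_set (\<A> n) (\<C> n)"
    and mono: "\<And>n. \<A> n \<subseteq> \<A> (Suc n)" "\<And>n. \<C> n \<subseteq> \<C> (Suc n)"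
    and stable: "\<And>n. Int_stable (\<A> n)" "\<And>n. Int_stable (\<C> n)"
  shows "indep_set (sigma_sets (space M) (\<Union>n. \<A> n)) (sigma_sets (space M) (\<Union>n. \<C> n))"
proof (rule indep_set_sigma_sets)
  have inc: "m \<le> n \<Longrightarrow> \<D> m \<subseteq> \<D> n" if "\<And>n. \<D> n \<subseteq> \<D> (Suc n)" for \<D> :: "nat \<Rightarrow> 'a set set" and m n
    using that by (rule lift_Suc_mono_le)
  have st: "Int_stable (\<Union>n. \<D> n)" if D: "\<And>n. \<D> n \<subseteq> \<D> (Suc n)" "\<And>n. Int_stable (\<D> n)" for \<D> :: "nat \<Rightarrow> 'a set set"
    unfolding Int_stable_def
  proof (intro ballI)
    fix a b assume "a \<in> (\<Union>n. \<D> n)" "b \<in> (\<Union>n. \<D> n)"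
    then obtain m n where "a \<in> \<D> m" "b \<in> \<D> n" by auto
    then have "a \<in> \<D> (max m n)" "b \<in> \<D> (max m n)"
      using inc[of \<D> m "max m n"] inc[of \<D> n "max m n"] D(1) by auto
    then have "a \<inter> b \<in> \<D> (max m n)" using D(2)[of "max m n"] by (auto simp: Int_stable_def)
    then show "a \<inter> b \<in> (\<Union>n. \<D> n)" by auto
  qed
  show "Int_stable (\<Union>n. \<A> n)" by (rule st) (use mono stable in auto)
  show "Int_stable (\<Union>n. \<C> n)" by (rule st) (use mono stable in auto)
  show "indep_set (\<Union>n. \<A> n) (\<Union>n. \<C> n)"
  proof (rule indep_setI)
    show "(\<Union>n. \<A> n) \<subseteq> events" "(\<Union>n. \<C> n) \<subseteq> events"
      using indep_setD_ev1[OF ind] indep_setD_ev2[OF ind] by auto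
    fix a b assume "a \<in> (\<Union>n. \<A> n)" "b \<in> (\<Union>n. \<C> n)"
    then obtain m n where "a \<in> \<A> m" "b \<in> \<C> n" by auto
    then have "a \<in> \<A> (max m n)" "b \<in> \<C> (max m n)"
      using inc[of \<A> m "max m n"] inc[of \<C> n "max m n"] mono by auto
    then show "prob (a \<inter> b) = prob a * prob b" by (rule indep_setD[OF ind])
  qed
qed

lemma Int_stable_vimage_sets:
  "Int_stable {f -` A \<inter> \<Omega> | A. A \<in> sets N}"
  unfolding Int_stable_def
proof safe
  fix A C assume "A \<in> sets N" "C \<in> sets N"
  then show "\<exists>D. f -` A \<inter> \<Omega> \<inter> (f -` C \<inter> \<Omega>) = f -` D \<inter> \<Omega> \<and> D \<in> sets N"
    by (intro exI[of _ "A \<inter> C"]) auto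
qed

text \<open>Rounding down to dyadic times is how countably many times control a continuous
  path.\<close>

lemma dyadic_floor_tendsto:
  fixes f :: "real \<Rightarrow> real"
  assumes f: "continuous_on {0..} f" and u: "0 \<le> u"
  shows "(\<lambda>n. f (real_of_int \<lfloor>u * 2 ^ n\<rfloor> / 2 ^ n)) \<longlonglongrightarrow> f u"
proof -
  have "(\<lambda>n. real_of_int \<lfloor>u * 2 ^ n\<rfloor> / 2 ^ n) \<longlonglongrightarrow> u"
  proof (rule tendsto_sandwich)
    show "(\<lambda>n. u - 1 / 2 ^ n) \<longlonglongrightarrow> u" by real_asymp
    show "(\<lambda>n. u) \<longlonglongrightarrow> u" by simp
    show "\<forall>\<^sub>F n in sequentially. real_of_int \<lfloor>u * 2 ^ n\<rfloor> / 2 ^ n \<le> u" by (simp add: divide_le_eq)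
    show "\<forall>\<^sub>F n in sequentially. u - 1 / 2 ^ n \<le> real_of_int \<lfloor>u * 2 ^ n\<rfloor> / 2 ^ n"
    proof (rule always_eventually, rule allI)
      fix n :: nat
      have "u * 2 ^ n - 1 \<le> real_of_int \<lfloor>u * 2 ^ n\<rfloor>" by linarith
      then have "(u * 2 ^ n - 1) / 2 ^ n \<le> real_of_int \<lfloor>u * 2 ^ n\<rfloor> / 2 ^ n" by (rule divide_right_mono) simp
      then show "u - 1 / 2 ^ n \<le> real_of_int \<lfloor>u * 2 ^ n\<rfloor> / 2 ^ n" by (simp add: diff_divide_distrib)
    qed
  qed
  with f u show ?thesis
    by (intro continuous_on_tendsto_compose[OF f]) (auto intro!: always_eventually)
qed

context brownian
begin

text \<open>\<open>grid_increment s r n i\<close> is the \<open>i\<close>-th increment along the grid that cuts each of \<open>[0, s]\<close> and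
  \<open>[s, s + r]\<close> into \<open>2\<^sup>n\<close> equal pieces.\<close>

definition grid_time :: "real \<Rightarrow> real \<Rightarrow> nat \<Rightarrow> nat \<Rightarrow> real" where
  "grid_time s r n i = (if i \<le> 2 ^ n then s * real i / 2 ^ n else s + r * (real i - 2 ^ n) / 2 ^ n)"

definition grid_increment :: "real \<Rightarrow> real \<Rightarrow> nat \<Rightarrow> nat \<Rightarrow> 'a \<Rightarrow> real" where
  "grid_increment s r n i \<omega> = B (grid_time s r n (Suc i)) \<omega> - B (grid_time s r n i) \<omega>"

definition grid_sets :: "real \<Rightarrow> real \<Rightarrow> (nat \<Rightarrow> nat set) \<Rightarrow> nat \<Rightarrow> 'a set set" where
  "grid_sets s r I n = {(\<lambda>\<omega>. \<lambda>i\<in>I n. grid_increment s r n i \<omega>) -` A \<inter> space M | A. A \<in> sets (Pi\<^sub>M (I n) (\<lambda>_. borel))}"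

definition past_indices :: "nat \<Rightarrow> nat set" where "past_indices n = {..<2 ^ n}"
definition future_indices :: "nat \<Rightarrow> nat set" where "future_indices n = {2 ^ n..<2 * 2 ^ n}"

text \<open>Generated by finite vectors of grid increments, since independence is given only for
  those. Continuity of paths recovers the intermediate times later.\<close>

definition past :: "real \<Rightarrow> real \<Rightarrow> 'a measure" where
  "past s r = sigma (space M) (\<Union>n. grid_sets s r past_indices n)"
definition future :: "real \<Rightarrow> real \<Rightarrow> 'a measure" where
  "future s r = sigma (space M) (\<Union>n. grid_sets s r future_indices n)"

lemma grid_time_Suc: "grid_time s r (Suc n) (2 * i) = grid_time s r n i"
  by (auto simp: grid_time_def field_simps)

lemma grid_time_nonneg: "0 \<le> s \<Longrightarrow> 0 \<le> r \<Longrightarrow> 0 \<le> grid_time s r n i"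
proof -
  assume "0 \<le> s" "0 \<le> r"
  moreover have "2 ^ n \<le> real i" if "\<not> i \<le> 2 ^ n"
    using that by (metis linear of_nat_le_iff of_nat_numeral of_nat_power)
  ultimately show ?thesis by (auto simp: grid_time_def)
qed

lemma grid_increment_Suc:
  "grid_increment s r n i \<omega> = grid_increment s r (Suc n) (2 * i) \<omega> + grid_increment s r (Suc n) (2 * i + 1) \<omega>"
  using grid_time_Suc[of s r n "Suc i"] by (simp add: grid_increment_def grid_time_Suc)

lemma space_past [simp]: "space (past s r) = space M" and space_future [simp]: "space (future s r) = space M"
  by (auto simp: past_def future_def space_measure_of_conv)

lemma sets_past: "sets (past s r) = sigma_sets (space M) (\<Union>n. grid_sets s r past_indices n)"
  and sets_future: "sets (future s r) = sigma_sets (space M) (\<Union>n. grid_sets s r future_indices n)"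
  by (auto simp: past_def future_def grid_sets_def intro!: sets_measure_of)

text \<open>At each level the increments before and after index 2^n are disjoint subfamilies of one
  independent family. The levels are nested because the grid is refined by halving, so independence
  passes to the generated sigma-algebras.\<close>

lemma indep_past_future:
  assumes s: "0 < s" and r: "0 < r"
  shows "indep_set (sets (past s r)) (sets (future s r))"
  unfolding sets_past sets_future
proof (rule indep_set_sigma_UN)
  fix n
  have lt: "grid_time s r n i < grid_time s r n (Suc i)" for i
  proof -
    have *: "Suc i \<le> 2 ^ n \<or> i = 2 ^ n \<or> 2 ^ n < i" by linarith
    have **: "real i = 2 ^ n" if "i = 2 ^ n" using that by simp
    show ?thesis using * ** s r by (auto simp: grid_time_def divide_strict_right_mono)
  qed
  have "indep_vars (\<lambda>_. borel) (grid_increment s r n) {..<2 * 2 ^ n}"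
    unfolding grid_increment_def using s r lt by (intro B_indep grid_time_nonneg) auto
  then have iv: "indep_var (Pi\<^sub>M (past_indices n) (\<lambda>_. borel)) (\<lambda>\<omega>. \<lambda>i\<in>past_indices n. grid_increment s r n i \<omega>)
     (Pi\<^sub>M (future_indices n) (\<lambda>_. borel)) (\<lambda>\<omega>. \<lambda>i\<in>future_indices n. grid_increment s r n i \<omega>)"
    by (rule indep_var_restrict) (auto simp: past_indices_def future_indices_def)
  then have "indep_set (sigma_sets (space M) (grid_sets s r past_indices n)) (sigma_sets (space M) (grid_sets s r future_indices n))"
    by (simp add: indep_var_eq grid_sets_def)
  then show "indep_set (grid_sets s r past_indices n) (grid_sets s r future_indices n)"
    unfolding indep_set_def by (rule indep_sets_mono_sets) (auto split: bool.split)
  show "Int_stable (grid_sets s r past_indices n)" "Int_stable (grid_sets s r future_indices n)"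
    unfolding grid_sets_def by (rule Int_stable_vimage_sets)+
  \<comment> \<open>An increment of level n is the sum of the increments 2i and 2i + 1 of the next
    level; its events are thus preimages under an additive map of the finer vector.\<close>
  have mono: "grid_sets s r I n \<subseteq> grid_sets s r I (Suc n)" if I: "\<And>i. i \<in> I n \<Longrightarrow> 2 * i \<in> I (Suc n) \<and> 2 * i + 1 \<in> I (Suc n)" for I
  proof
    fix X assume "X \<in> grid_sets s r I n"
    then obtain A where A: "A \<in> sets (Pi\<^sub>M (I n) (\<lambda>_. borel))" and X: "X = (\<lambda>\<omega>. \<lambda>i\<in>I n. grid_increment s r n i \<omega>) -` A \<inter> space M"
      by (auto simp: grid_sets_def)
    let ?g = "\<lambda>x. \<lambda>i\<in>I n. x (2 * i) + x (2 * i + 1) :: real"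
    have "?g \<in> measurable (Pi\<^sub>M (I (Suc n)) (\<lambda>_. borel)) (Pi\<^sub>M (I n) (\<lambda>_. borel))"
      using I by (intro measurable_restrict borel_measurable_add measurable_component_singleton) auto
    then have "?g -` A \<inter> space (Pi\<^sub>M (I (Suc n)) (\<lambda>_. borel)) \<in> sets (Pi\<^sub>M (I (Suc n)) (\<lambda>_. borel))"
      using A by (rule measurable_sets)
    moreover have "X = (\<lambda>\<omega>. \<lambda>i\<in>I (Suc n). grid_increment s r (Suc n) i \<omega>) -` (?g -` A \<inter> space (Pi\<^sub>M (I (Suc n)) (\<lambda>_. borel))) \<inter> space M"
    proof -
      have "?g (\<lambda>i\<in>I (Suc n). grid_increment s r (Suc n) i \<omega>) = (\<lambda>i\<in>I n. grid_increment s r n i \<omega>)" for \<omega>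
        using I by (auto simp: fun_eq_iff restrict_def grid_increment_Suc[of s r n])
      then show ?thesis by (auto simp: X space_PiM)
    qed
    ultimately show "X \<in> grid_sets s r I (Suc n)" unfolding grid_sets_def by blast
  qed
  show "grid_sets s r past_indices n \<subseteq> grid_sets s r past_indices (Suc n)"
    by (rule mono) (auto simp: past_indices_def)
  show "grid_sets s r future_indices n \<subseteq> grid_sets s r future_indices (Suc n)"
    by (rule mono) (auto simp: future_indices_def)
qed

lemma measurable_grid_increment:
  "i < 2 ^ n \<Longrightarrow> grid_increment s r n i \<in> borel_measurable (past s r)"
  "i < 2 ^ n \<Longrightarrow> grid_increment s r n (2 ^ n + i) \<in> borel_measurable (future s r)"
proof -
  have gen: "grid_increment s r n i \<in> borel_measurable N"
    if N: "space N = space M" "\<And>n. grid_sets s r I n \<subseteq> sets N" and i: "i \<in> I n" for N I i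
  proof (rule measurableI)
    fix A :: "real set" assume A: "A \<in> sets borel"
    have "(\<lambda>x. x i) -` A \<inter> space (Pi\<^sub>M (I n) (\<lambda>_. borel)) \<in> sets (Pi\<^sub>M (I n) (\<lambda>_. borel :: real measure))"
      using i A by (intro measurable_sets[OF measurable_component_singleton]) auto
    then have "(\<lambda>\<omega>. \<lambda>i\<in>I n. grid_increment s r n i \<omega>) -` ((\<lambda>x. x i) -` A \<inter> space (Pi\<^sub>M (I n) (\<lambda>_. borel))) \<inter> space M \<in> grid_sets s r I n"
      unfolding grid_sets_def by blast
    also have "(\<lambda>\<omega>. \<lambda>i\<in>I n. grid_increment s r n i \<omega>) -` ((\<lambda>x. x i) -` A \<inter> space (Pi\<^sub>M (I n) (\<lambda>_. borel))) \<inter> space M = grid_increment s r n i -` A \<inter> space N"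
      using i by (auto simp: space_PiM N)
    finally show "grid_increment s r n i -` A \<inter> space N \<in> sets N" using N by blast
  qed simp
  show "i < 2 ^ n \<Longrightarrow> grid_increment s r n i \<in> borel_measurable (past s r)"
    by (rule gen[of "past s r" past_indices]) (auto simp: sets_past past_indices_def)
  show "i < 2 ^ n \<Longrightarrow> grid_increment s r n (2 ^ n + i) \<in> borel_measurable (future s r)"
    by (rule gen[of "future s r" future_indices]) (auto simp: sets_future future_indices_def)
qed

text \<open>At a grid time B is a telescoping sum of increments, which needs B 0 = 0 at every sample
  point; the other times follow by dyadic approximation.\<close>

lemma measurable_B_past:
  assumes s: "0 < s" and u: "0 \<le> u" "u \<le> s"
  shows "B u \<in> borel_measurable (past s r)"
proof -
  have dyadic: "B (s * (real j / 2 ^ n)) \<in> borel_measurable (past s r)" if j: "j \<le> 2 ^ n" for j n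
  proof -
    have "(\<lambda>\<omega>. \<Sum>i<j. grid_increment s r n i \<omega>) \<in> borel_measurable (past s r)"
      using j by (intro borel_measurable_sum measurable_grid_increment) auto
    also have "?this \<longleftrightarrow> ?thesis"
    proof (rule measurable_cong)
      fix \<omega> assume "\<omega> \<in> space (past s r)"
      then have "B 0 \<omega> = 0" by (simp add: B_zero)
      moreover have "(\<Sum>i<j. grid_increment s r n i \<omega>) = (\<Sum>i<j. B (grid_time s r n (Suc i)) \<omega> - B (grid_time s r n i) \<omega>)"
        by (simp add: grid_increment_def)
      moreover have "\<dots> = B (grid_time s r n j) \<omega> - B (grid_time s r n 0) \<omega>"
        by (rule sum_lessThan_telescope)
      ultimately show "(\<Sum>i<j. grid_increment s r n i \<omega>) = B (s * (real j / 2 ^ n)) \<omega>"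
        using j by (simp add: grid_time_def)
    qed
    finally show ?thesis .
  qed
  show ?thesis
  proof (rule borel_measurable_LIMSEQ_real)
    fix \<omega> assume "\<omega> \<in> space (past s r)"
    then have "continuous_on {0..} (\<lambda>v. B (s * v) \<omega>)"
      using s by (intro continuous_on_compose2[OF B_continuous]) (auto intro!: continuous_intros)
    from dyadic_floor_tendsto[OF this, of "u / s"] s u
    show "(\<lambda>n. B (s * (real_of_int \<lfloor>u / s * 2 ^ n\<rfloor> / 2 ^ n)) \<omega>) \<longlonglongrightarrow> B u \<omega>" by simp
  next
    fix n
    have "u / s * 2 ^ n \<le> 1 * 2 ^ n" using s u by (intro mult_right_mono) auto
    then have "u / s * 2 ^ n \<le> 2 ^ n" by simp
    then have "\<lfloor>u / s * 2 ^ n\<rfloor> \<le> 2 ^ n" by (metis floor_mono floor_numeral_power)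
    moreover have "0 \<le> \<lfloor>u / s * 2 ^ n\<rfloor>" using s u by simp
    ultimately obtain j where "\<lfloor>u / s * 2 ^ n\<rfloor> = int j" "j \<le> 2 ^ n"
      by (metis nonneg_int_cases of_nat_le_iff of_nat_numeral of_nat_power)
    then show "(\<lambda>\<omega>. B (s * (real_of_int \<lfloor>u / s * 2 ^ n\<rfloor> / 2 ^ n)) \<omega>) \<in> borel_measurable (past s r)"
      using dyadic[of j n] by simp
  qed
qed

text \<open>The Riemann sums for the area are taken along K = 2^n only, where all evaluation points
  belong to the grid that generates \<open>future\<close>.\<close>

lemma measurable_future:
  assumes s: "0 < s" and r: "0 < r"
  shows "(\<lambda>\<omega>. B (s + r) \<omega> - B s \<omega>) \<in> borel_measurable (future s r)"
    and "area s r \<in> borel_measurable (future s r)"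
proof -
  have dyadic: "(\<lambda>\<omega>. B (s + r * real j / 2 ^ n) \<omega> - B s \<omega>) \<in> borel_measurable (future s r)" if j: "j \<le> 2 ^ n" for j n
  proof -
    have "(\<lambda>\<omega>. \<Sum>i<j. grid_increment s r n (2 ^ n + i) \<omega>) \<in> borel_measurable (future s r)"
      using j by (intro borel_measurable_sum measurable_grid_increment) auto
    also have "(\<lambda>\<omega>. \<Sum>i<j. grid_increment s r n (2 ^ n + i) \<omega>) = (\<lambda>\<omega>. B (s + r * real j / 2 ^ n) \<omega> - B s \<omega>)"
    proof
      fix \<omega>
      have "(\<Sum>i<j. grid_increment s r n (2 ^ n + i) \<omega>) = (\<Sum>i<j. B (grid_time s r n (2 ^ n + Suc i)) \<omega> - B (grid_time s r n (2 ^ n + i)) \<omega>)"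
        by (simp add: grid_increment_def)
      also have "\<dots> = B (grid_time s r n (2 ^ n + j)) \<omega> - B (grid_time s r n (2 ^ n + 0)) \<omega>"
        by (rule sum_lessThan_telescope)
      finally show "(\<Sum>i<j. grid_increment s r n (2 ^ n + i) \<omega>) = B (s + r * real j / 2 ^ n) \<omega> - B s \<omega>"
        by (simp add: grid_time_def)
    qed
    finally show ?thesis .
  qed
  from dyadic[of "2 ^ 0" 0] show inc [measurable]: "(\<lambda>\<omega>. B (s + r) \<omega> - B s \<omega>) \<in> borel_measurable (future s r)" by simp
  let ?a = "\<lambda>K \<omega>. (\<Sum>i<K. r / real K * (B (s + r * real i / real K) \<omega> - B s \<omega>)) + r / real K * (B (s + r) \<omega> - B s \<omega>)
    - r / 2 * (B (s + r) \<omega> - B s \<omega>)"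
  show "area s r \<in> borel_measurable (future s r)"
  proof (rule borel_measurable_LIMSEQ_real)
    fix \<omega> assume "\<omega> \<in> space (future s r)"
    then have "(\<lambda>K. ?a K \<omega>) \<longlonglongrightarrow> area s r \<omega>" using s r by (intro area_tendsto) auto
    moreover have "filterlim (\<lambda>n. 2 ^ n :: nat) at_top sequentially" by (rule filterlim_subseq) (auto simp: strict_mono_def)
    ultimately show "(\<lambda>n. ?a (2 ^ n) \<omega>) \<longlonglongrightarrow> area s r \<omega>" by (rule filterlim_compose)
  next
    fix n
    have "(\<lambda>\<omega>. \<Sum>i<2 ^ n. r / real (2 ^ n) * (B (s + r * real i / real (2 ^ n)) \<omega> - B s \<omega>)) \<in> borel_measurable (future s r)"
      by (intro borel_measurable_sum borel_measurable_times borel_measurable_const) (use dyadic[of _ n] in auto)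
    then show "?a (2 ^ n) \<in> borel_measurable (future s r)"
      by (intro borel_measurable_diff[OF borel_measurable_add[OF _ borel_measurable_times[OF borel_measurable_const inc]] borel_measurable_times[OF borel_measurable_const inc]])
  qed
qed

end

section \<open>The Markov property\<close>

definition kolmogorov_step :: "real \<Rightarrow> real \<times> real \<Rightarrow> real \<Rightarrow> real \<Rightarrow> real \<times> real" where
  "kolmogorov_step r z \<xi> \<eta> =
    (fst z + r * snd z + r / 2 * sqrt (2 * r) * \<eta> + sqrt (r ^ 3 / 6) * \<xi>, snd z + sqrt (2 * r) * \<eta>)"

text \<open>Expressed through two standard normal variables, \<xi> for the orthogonal area and
  \<eta> for the velocity, and not through the density: time 0 is then included, and continuity in
  time and starting point can be read off the integrand.\<close>

definition kolmogorov_semigroup :: "real \<Rightarrow> (real \<times> real \<Rightarrow> ennreal) \<Rightarrow> real \<times> real \<Rightarrow> ennreal" where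
  "kolmogorov_semigroup r \<phi> z =
    (\<integral>\<^sup>+\<xi>. \<integral>\<^sup>+\<eta>. \<phi> (kolmogorov_step r z \<xi> \<eta>) \<partial>\<gamma> \<partial>\<gamma>)"

context continuous_process
begin

definition phase :: "real \<Rightarrow> real \<Rightarrow> 'a \<Rightarrow> real \<times> real" where
  "phase x t \<omega> = (X_proc B x 0 t \<omega>, L_proc B 0 t \<omega>)"

lemma B_integrable_on:
  assumes "\<omega> \<in> space M" "0 \<le> a"
  shows "(\<lambda>t. B t \<omega>) integrable_on {a..b}"
  using assms by (intro integrable_continuous_interval continuous_on_subset[OF B_continuous]) auto

text \<open>The sigma-algebra \<open>F\<close> is left open so that the same argument serves the
  whole space and the past up to a given time.\<close>

lemma measurable_phase_sub:
  assumes space: "space F = space M" and u: "0 \<le> u" and m: "\<And>v. 0 \<le> v \<Longrightarrow> v \<le> u \<Longrightarrow> B v \<in> borel_measurable F"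
  shows "phase x u \<in> measurable F (borel \<Otimes>\<^sub>M borel)"
proof -
  have I: "(\<lambda>\<omega>. integral {0..u} (\<lambda>t. B t \<omega>)) \<in> borel_measurable F"
  proof (rule borel_measurable_LIMSEQ_real)
    fix \<omega> assume "\<omega> \<in> space F"
    then have "continuous_on {0..0 + u} (\<lambda>t. B t \<omega>)" by (intro continuous_on_subset[OF B_continuous]) (auto simp: space)
    from Riemann_sum_tendsto_integral[OF this u]
    show "(\<lambda>K. \<Sum>i<K. u / real K * B (0 + u * real i / real K) \<omega>) \<longlonglongrightarrow> integral {0..u} (\<lambda>t. B t \<omega>)" by simp
  next
    fix K :: nat
    have "u * real i / real K \<le> u" if "i < K" for i
    proof -
      have "u * (real i / real K) \<le> u * 1" using that u by (intro mult_left_mono) auto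
      then show ?thesis by simp
    qed
    then show "(\<lambda>\<omega>. \<Sum>i<K. u / real K * B (0 + u * real i / real K) \<omega>) \<in> borel_measurable F"
      using u by (intro borel_measurable_sum borel_measurable_times borel_measurable_const m) auto
  qed
  note [measurable] = m[OF u order_refl] I
  have "phase x u = (\<lambda>\<omega>. (x + sqrt 2 * integral {0..u} (\<lambda>t. B t \<omega>), sqrt 2 * B u \<omega>))"
    by (simp add: fun_eq_iff phase_def X_proc_def L_proc_def)
  then show ?thesis by simp
qed

lemma measurable_phase: "0 \<le> t \<Longrightarrow> phase x t \<in> measurable M (borel \<Otimes>\<^sub>M borel)"
  by (intro measurable_phase_sub B_measurable) auto

end

context brownian
begin

text \<open>The joint characteristic function is a product, which gives independence; each factor is
  that of a centred Gaussian, with variances r^3 / 12 and r.\<close>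

lemma increment_law:
  assumes s: "0 \<le> s" and r: "0 < r"
  defines "D \<equiv> \<lambda>\<omega>. B (s + r) \<omega> - B s \<omega>"
  shows "distr M (borel \<Otimes>\<^sub>M borel) (\<lambda>\<omega>. (area s r \<omega>, D \<omega>)) =
    distr \<gamma> borel (\<lambda>\<xi>. sqrt (r ^ 3 / 12) * \<xi>) \<Otimes>\<^sub>M distr \<gamma> borel (\<lambda>\<eta>. sqrt r * \<eta>)"
proof -
  interpret N: real_distribution \<gamma> by (rule real_dist_normal_dist)
  have [measurable]: "area s r \<in> borel_measurable M" "D \<in> borel_measurable M"
    using s r by (auto simp: D_def intro!: borel_measurable_diff B_measurable measurable_area)
  have jc: "expectation (\<lambda>\<omega>. iexp (a * area s r \<omega> + b * D \<omega>)) = of_real (exp (- (r / 2) * (a\<^sup>2 * r\<^sup>2 / 12 + b\<^sup>2)))" for a b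
    unfolding D_def by (rule joint_char_area_increment[OF s r])
  have jc1: "expectation (\<lambda>\<omega>. iexp (a * area s r \<omega>)) = of_real (exp (- (r / 2) * (a\<^sup>2 * r\<^sup>2 / 12)))" for a
    using jc[of a 0] by simp
  have jc2: "expectation (\<lambda>\<omega>. iexp (b * D \<omega>)) = of_real (exp (- (r / 2) * b\<^sup>2))" for b
    using jc[of 0 b] by simp
  have ind: "indep_var borel (area s r) borel D"
  proof (rule indep_var_if_joint_char)
    fix a b
    show "expectation (\<lambda>\<omega>. iexp (a * area s r \<omega> + b * D \<omega>)) = expectation (\<lambda>\<omega>. iexp (a * area s r \<omega>)) * expectation (\<lambda>\<omega>. iexp (b * D \<omega>))"
      unfolding jc jc1 jc2 of_real_mult[symmetric] mult_exp_exp distrib_left ..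
  qed measurable
  have law: "distr M borel Y = distr \<gamma> borel (\<lambda>\<xi>. sqrt c * \<xi>)"
    if [measurable]: "Y \<in> borel_measurable M" and "0 \<le> c" and Y: "\<And>a. expectation (\<lambda>\<omega>. iexp (a * Y \<omega>)) = of_real (exp (- (c * a\<^sup>2) / 2))" for Y c
  proof (rule Levy_uniqueness)
    show "real_distribution (distr M borel Y)" "real_distribution (distr \<gamma> borel ((*) (sqrt c)))"
      by (auto simp: real_distribution_def real_distribution_axioms_def intro!: prob_space_distr N.prob_space_distr)
    show "char (distr M borel Y) = char (distr \<gamma> borel ((*) (sqrt c)))"
    proof
      fix a
      have "char (distr \<gamma> borel ((*) (sqrt c))) a = char \<gamma> (a * sqrt c)"
        unfolding char_def by (subst integral_distr) (auto simp: mult.assoc)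
      also have "\<dots> = of_real (exp (- (c * a\<^sup>2) / 2))"
        using \<open>0 \<le> c\<close> by (simp add: char_std_normal_distribution power_mult_distrib mult.commute)
      also have "\<dots> = expectation (\<lambda>\<omega>. iexp (a * Y \<omega>))" by (rule Y[symmetric])
      also have "\<dots> = char (distr M borel Y) a"
        unfolding char_def by (subst integral_distr) auto
      finally show "char (distr M borel Y) a = char (distr \<gamma> borel ((*) (sqrt c))) a" ..
    qed
  qed
  have "distr M borel (area s r) = distr \<gamma> borel (\<lambda>\<xi>. sqrt (r ^ 3 / 12) * \<xi>)"
  proof (rule law)
    fix a
    have "- (r / 2) * (a\<^sup>2 * r\<^sup>2 / 12) = - (r ^ 3 / 12 * a\<^sup>2) / 2" by (simp add: power3_eq_cube power2_eq_square)
    then show "expectation (\<lambda>\<omega>. iexp (a * area s r \<omega>)) = of_real (exp (- (r ^ 3 / 12 * a\<^sup>2) / 2))"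
      by (simp only: jc1)
  qed (use r in auto)
  moreover have "distr M borel D = distr \<gamma> borel (\<lambda>\<eta>. sqrt r * \<eta>)"
  proof (rule law)
    fix b
    have "- (r / 2) * b\<^sup>2 = - (r * b\<^sup>2) / 2" by simp
    then show "expectation (\<lambda>\<omega>. iexp (b * D \<omega>)) = of_real (exp (- (r * b\<^sup>2) / 2))"
      by (simp only: jc2)
  qed (use r in auto)
  ultimately show ?thesis
    using ind unfolding indep_var_distribution_eq by simp
qed

lemma nn_integral_increment:
  fixes f :: "real \<times> real \<Rightarrow> ennreal"
  assumes s: "0 \<le> s" and r: "0 < r" and [measurable]: "f \<in> borel_measurable (borel \<Otimes>\<^sub>M borel)"
  shows "(\<integral>\<^sup>+v. f v \<partial>distr M (borel \<Otimes>\<^sub>M borel) (\<lambda>\<omega>. (area s r \<omega>, B (s + r) \<omega> - B s \<omega>)))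
    = (\<integral>\<^sup>+\<xi>. \<integral>\<^sup>+\<eta>. f (sqrt (r ^ 3 / 12) * \<xi>, sqrt r * \<eta>) \<partial>\<gamma> \<partial>\<gamma>)"
proof -
  interpret N: real_distribution \<gamma> by (rule real_dist_normal_dist)
  interpret N1: prob_space "distr \<gamma> borel (\<lambda>\<xi>. sqrt (r ^ 3 / 12) * \<xi>)" by (rule N.prob_space_distr) simp
  interpret N2: prob_space "distr \<gamma> borel (\<lambda>\<xi>. sqrt r * \<xi>)" by (rule N.prob_space_distr) simp
  have m: "f \<in> borel_measurable (distr \<gamma> borel (\<lambda>\<xi>. sqrt (r ^ 3 / 12) * \<xi>) \<Otimes>\<^sub>M distr \<gamma> borel (\<lambda>\<eta>. sqrt r * \<eta>))"
    by measurable
  have "(\<integral>\<^sup>+v. f v \<partial>(distr \<gamma> borel (\<lambda>\<xi>. sqrt (r ^ 3 / 12) * \<xi>) \<Otimes>\<^sub>M distr \<gamma> borel (\<lambda>\<eta>. sqrt r * \<eta>)))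
    = (\<integral>\<^sup>+a. \<integral>\<^sup>+b. f (a, b) \<partial>distr \<gamma> borel (\<lambda>\<eta>. sqrt r * \<eta>) \<partial>distr \<gamma> borel (\<lambda>\<xi>. sqrt (r ^ 3 / 12) * \<xi>))"
    by (rule N2.nn_integral_fst[OF m, symmetric])
  also have "\<dots> = (\<integral>\<^sup>+\<xi>. \<integral>\<^sup>+\<eta>. f (sqrt (r ^ 3 / 12) * \<xi>, sqrt r * \<eta>) \<partial>\<gamma> \<partial>\<gamma>)"
    by (subst (1 2) nn_integral_distr) auto
  finally show ?thesis by (simp add: increment_law[OF s r])
qed

text \<open>A variable U of the past and the pair of area and increment generate independent events,
  so their joint law is a product and the pair can be integrated out separately. U takes values in
  an arbitrary space, so it may carry an event along with the current state.\<close>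

lemma nn_integral_past_increment:
  assumes s: "0 < s" and r: "0 < r"
    and U: "U \<in> measurable (past s r) N"
    and \<Phi> [measurable]: "\<Phi> \<in> borel_measurable (N \<Otimes>\<^sub>M (borel \<Otimes>\<^sub>M borel))"
  shows "(\<integral>\<^sup>+\<omega>. \<Phi> (U \<omega>, (area s r \<omega>, B (s + r) \<omega> - B s \<omega>)) \<partial>M) =
    (\<integral>\<^sup>+\<omega>. \<integral>\<^sup>+\<xi>. \<integral>\<^sup>+\<eta>. \<Phi> (U \<omega>, (sqrt (r ^ 3 / 12) * \<xi>, sqrt r * \<eta>)) \<partial>\<gamma> \<partial>\<gamma> \<partial>M)"
proof -
  define V where "V \<omega> = (area s r \<omega>, B (s + r) \<omega> - B s \<omega>)" for \<omega>
  have V: "V \<in> measurable (future s r) (borel \<Otimes>\<^sub>M borel)"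
    unfolding V_def using measurable_future[OF s r] by (intro measurable_Pair)
  have ind: "indep_set (sets (past s r)) (sets (future s r))" by (rule indep_past_future[OF s r])
  then have sub: "sets (past s r) \<subseteq> events" "sets (future s r) \<subseteq> events"
    by (rule indep_setD_ev1 indep_setD_ev2)+
  have U' [measurable]: "U \<in> measurable M N" using U sub(1) by (auto simp: measurable_def)
  have V' [measurable]: "V \<in> measurable M (borel \<Otimes>\<^sub>M borel)" using V sub(2) by (auto simp: measurable_def)
  interpret V: prob_space "distr M (borel \<Otimes>\<^sub>M borel) V" by (rule prob_space_distr) measurable
  interpret U: prob_space "distr M N U" by (rule prob_space_distr) measurable
  have joint: "distr M N U \<Otimes>\<^sub>M distr M (borel \<Otimes>\<^sub>M borel) V = distr M (N \<Otimes>\<^sub>M (borel \<Otimes>\<^sub>M borel)) (\<lambda>\<omega>. (U \<omega>, V \<omega>))"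
  proof (rule pair_measure_eqI)
    show "sigma_finite_measure (distr M N U)" "sigma_finite_measure (distr M (borel \<Otimes>\<^sub>M borel) V)"
      by unfold_locales
    show "sets (distr M N U \<Otimes>\<^sub>M distr M (borel \<Otimes>\<^sub>M borel) V) = sets (distr M (N \<Otimes>\<^sub>M (borel \<Otimes>\<^sub>M borel)) (\<lambda>\<omega>. (U \<omega>, V \<omega>)))"
      by (simp cong: sets_pair_measure_cong)
    fix A C assume "A \<in> sets (distr M N U)" "C \<in> sets (distr M (borel \<Otimes>\<^sub>M borel) V)"
    then have [measurable]: "A \<in> sets N" "C \<in> sets (borel \<Otimes>\<^sub>M borel)" by auto
    have "U -` A \<inter> space M \<in> sets (past s r)" "V -` C \<inter> space M \<in> sets (future s r)"
      using measurable_sets[OF U, of A] measurable_sets[OF V, of C] by auto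
    from indep_setD[OF ind this]
    have "prob (U -` A \<inter> space M \<inter> (V -` C \<inter> space M)) = prob (U -` A \<inter> space M) * prob (V -` C \<inter> space M)" .
    moreover have "U -` A \<inter> space M \<inter> (V -` C \<inter> space M) = (\<lambda>\<omega>. (U \<omega>, V \<omega>)) -` (A \<times> C) \<inter> space M" by auto
    ultimately show "emeasure (distr M N U) A * emeasure (distr M (borel \<Otimes>\<^sub>M borel) V) C = emeasure (distr M (N \<Otimes>\<^sub>M (borel \<Otimes>\<^sub>M borel)) (\<lambda>\<omega>. (U \<omega>, V \<omega>))) (A \<times> C)"
      by (simp add: emeasure_distr emeasure_eq_measure ennreal_mult'[symmetric])
  qed
  have "(\<integral>\<^sup>+\<omega>. \<Phi> (U \<omega>, V \<omega>) \<partial>M) = (\<integral>\<^sup>+p. \<Phi> p \<partial>distr M (N \<Otimes>\<^sub>M (borel \<Otimes>\<^sub>M borel)) (\<lambda>\<omega>. (U \<omega>, V \<omega>)))"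
    by (subst nn_integral_distr) auto
  also have "\<dots> = (\<integral>\<^sup>+p. \<Phi> p \<partial>(distr M N U \<Otimes>\<^sub>M distr M (borel \<Otimes>\<^sub>M borel) V))"
    by (simp add: joint)
  also have "\<dots> = (\<integral>\<^sup>+u. \<integral>\<^sup>+v. \<Phi> (u, v) \<partial>distr M (borel \<Otimes>\<^sub>M borel) V \<partial>distr M N U)"
    by (rule V.nn_integral_fst[symmetric]) measurable
  also have "\<dots> = (\<integral>\<^sup>+\<omega>. \<integral>\<^sup>+v. \<Phi> (U \<omega>, v) \<partial>distr M (borel \<Otimes>\<^sub>M borel) V \<partial>M)"
    by (subst nn_integral_distr) (auto intro!: V.borel_measurable_nn_integral)
  also have "\<dots> = (\<integral>\<^sup>+\<omega>. \<integral>\<^sup>+\<xi>. \<integral>\<^sup>+\<eta>. \<Phi> (U \<omega>, (sqrt (r ^ 3 / 12) * \<xi>, sqrt r * \<eta>)) \<partial>\<gamma> \<partial>\<gamma> \<partial>M)"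
  proof (rule nn_integral_cong)
    fix \<omega> assume "\<omega> \<in> space M"
    then have "U \<omega> \<in> space N" using U' by (rule measurable_space[rotated])
    then have "(\<lambda>v. \<Phi> (U \<omega>, v)) \<in> borel_measurable (borel \<Otimes>\<^sub>M borel)" by measurable
    then show "(\<integral>\<^sup>+v. \<Phi> (U \<omega>, v) \<partial>distr M (borel \<Otimes>\<^sub>M borel) V) = (\<integral>\<^sup>+\<xi>. \<integral>\<^sup>+\<eta>. \<Phi> (U \<omega>, (sqrt (r ^ 3 / 12) * \<xi>, sqrt r * \<eta>)) \<partial>\<gamma> \<partial>\<gamma>)"
      unfolding V_def using s r by (intro nn_integral_increment) auto
  qed
  finally show ?thesis by (simp add: V_def)
qed

text \<open>The displacement splits into the drift at the old velocity, half of the velocity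
  increment times r, and the orthogonal area; everything beyond the old state is measurable with
  respect to the future.\<close>

lemma phase_add:
  assumes \<omega>: "\<omega> \<in> space M" and s: "0 \<le> s" and r: "0 \<le> r"
  shows "phase x (s + r) \<omega> = (fst (phase x s \<omega>) + r * snd (phase x s \<omega>) + r / 2 * sqrt 2 * (B (s + r) \<omega> - B s \<omega>) + sqrt 2 * area s r \<omega>,
     snd (phase x s \<omega>) + sqrt 2 * (B (s + r) \<omega> - B s \<omega>))"
proof -
  have int: "(\<lambda>t. sqrt 2 * B t \<omega>) integrable_on {a..b}" if "0 \<le> a" for a b
    using B_integrable_on[OF \<omega> that] by (intro integrable_on_mult_right) auto
  have "integral {0..s} (\<lambda>t. sqrt 2 * B t \<omega>) + integral {s..s + r} (\<lambda>t. sqrt 2 * B t \<omega>) = integral {0..s + r} (\<lambda>t. sqrt 2 * B t \<omega>)"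
    using s r int by (intro Henstock_Kurzweil_Integration.integral_combine) auto
  moreover have "integral {s..s + r} (\<lambda>t. B t \<omega>) = area s r \<omega> + r * B s \<omega> + r / 2 * (B (s + r) \<omega> - B s \<omega>)"
    unfolding area_def using B_integrable_on[OF \<omega> s] r by (subst Henstock_Kurzweil_Integration.integral_diff) auto
  ultimately have "sqrt 2 * integral {0..s + r} (\<lambda>t. B t \<omega>) = sqrt 2 * integral {0..s} (\<lambda>t. B t \<omega>) + sqrt 2 * (area s r \<omega> + r * B s \<omega> + r / 2 * (B (s + r) \<omega> - B s \<omega>))"
    by simp
  then show ?thesis by (simp add: phase_def X_proc_def L_proc_def) (simp add: algebra_simps)
qed

lemma kolmogorov_semigroup_increment:
  "(\<integral>\<^sup>+\<xi>. \<integral>\<^sup>+\<eta>. \<phi> (fst z + r * snd z + r / 2 * sqrt 2 * (sqrt r * \<eta>) + sqrt 2 * (sqrt (r ^ 3 / 12) * \<xi>), snd z + sqrt 2 * (sqrt r * \<eta>)) \<partial>\<gamma> \<partial>\<gamma>)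
    = kolmogorov_semigroup r \<phi> z"
proof -
  have 1: "sqrt 2 * (sqrt (r ^ 3 / 12) * \<xi>) = sqrt (r ^ 3 / 6) * \<xi>" for \<xi>
    unfolding mult.assoc[symmetric] real_sqrt_mult[symmetric] by simp
  have 2: "r / 2 * sqrt 2 * (sqrt r * \<eta>) = r / 2 * sqrt (2 * r) * \<eta>" and 3: "sqrt 2 * (sqrt r * \<eta>) = sqrt (2 * r) * \<eta>" for \<eta>
    by (simp_all add: real_sqrt_mult)
  show ?thesis unfolding kolmogorov_semigroup_def kolmogorov_step_def by (simp only: 1 2 3)
qed

lemma measurable_phase_past:
  assumes s: "0 < s" and u: "0 \<le> u" "u \<le> s"
  shows "phase x u \<in> measurable (past s r) (borel \<Otimes>\<^sub>M borel)"
  using u by (intro measurable_phase_sub measurable_B_past[OF s]) auto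

lemma Markov_property:
  fixes \<phi> :: "real \<times> real \<Rightarrow> ennreal"
  assumes s: "0 < s" and r: "0 < r"
    and A: "A \<in> sets (past s r)" and \<phi> [measurable]: "\<phi> \<in> borel_measurable (borel \<Otimes>\<^sub>M borel)"
  shows "(\<integral>\<^sup>+\<omega>. indicator A \<omega> * \<phi> (phase x (s + r) \<omega>) \<partial>M) = (\<integral>\<^sup>+\<omega>. indicator A \<omega> * kolmogorov_semigroup r \<phi> (phase x s \<omega>) \<partial>M)"
proof -
  \<comment> \<open>The event A enters as its indicator value in the first coordinate, next to the
    state at time s; thus both are instances of one past variable.\<close>
  define \<Phi> :: "(ennreal \<times> (real \<times> real)) \<times> (real \<times> real) \<Rightarrow> ennreal" where
    "\<Phi> = (\<lambda>p. fst (fst p) * \<phi> (fst (snd (fst p)) + r * snd (snd (fst p)) + r / 2 * sqrt 2 * snd (snd p) + sqrt 2 * fst (snd p),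
        snd (snd (fst p)) + sqrt 2 * snd (snd p)))"
  have [measurable]: "phase x s \<in> measurable (past s r) (borel \<Otimes>\<^sub>M borel)" using s by (intro measurable_phase_past) auto
  have [measurable]: "A \<in> sets (past s r)" by fact
  have "(\<integral>\<^sup>+\<omega>. indicator A \<omega> * \<phi> (phase x (s + r) \<omega>) \<partial>M) = (\<integral>\<^sup>+\<omega>. \<Phi> ((indicator A \<omega>, phase x s \<omega>), (area s r \<omega>, B (s + r) \<omega> - B s \<omega>)) \<partial>M)"
    using s r by (intro nn_integral_cong) (simp add: \<Phi>_def phase_add)
  also have "\<dots> = (\<integral>\<^sup>+\<omega>. \<integral>\<^sup>+\<xi>. \<integral>\<^sup>+\<eta>. \<Phi> ((indicator A \<omega>, phase x s \<omega>), (sqrt (r ^ 3 / 12) * \<xi>, sqrt r * \<eta>)) \<partial>\<gamma> \<partial>\<gamma> \<partial>M)"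
    by (rule nn_integral_past_increment[OF s r, where N = "borel \<Otimes>\<^sub>M (borel \<Otimes>\<^sub>M borel)"]) (measurable, simp add: \<Phi>_def)
  also have "\<dots> = (\<integral>\<^sup>+\<omega>. indicator A \<omega> * kolmogorov_semigroup r \<phi> (phase x s \<omega>) \<partial>M)"
  proof (rule nn_integral_cong)
    fix \<omega>
    show "(\<integral>\<^sup>+\<xi>. \<integral>\<^sup>+\<eta>. \<Phi> ((indicator A \<omega>, phase x s \<omega>), (sqrt (r ^ 3 / 12) * \<xi>, sqrt r * \<eta>)) \<partial>\<gamma> \<partial>\<gamma>)
      = indicator A \<omega> * kolmogorov_semigroup r \<phi> (phase x s \<omega>)"
    proof (cases "\<omega> \<in> A")
      case True
      then show ?thesis
        by (simp only: \<Phi>_def fst_conv snd_conv indicator_simps mult_1 kolmogorov_semigroup_increment)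
    qed (simp add: \<Phi>_def)
  qed
  finally show ?thesis .
qed

text \<open>The Markov property above is confined to s > 0, where there is a nondegenerate past
  grid. The start at time 0 is deterministic and is treated directly.\<close>

lemma nn_integral_phase:
  fixes \<phi> :: "real \<times> real \<Rightarrow> ennreal"
  assumes r: "0 < r" and \<phi> [measurable]: "\<phi> \<in> borel_measurable (borel \<Otimes>\<^sub>M borel)"
  shows "(\<integral>\<^sup>+\<omega>. \<phi> (phase x r \<omega>) \<partial>M) = kolmogorov_semigroup r \<phi> (x, 0)"
proof -
  have [measurable]: "area 0 r \<in> borel_measurable M" "B r \<in> borel_measurable M" "B 0 \<in> borel_measurable M"
    using r by (auto intro!: B_measurable measurable_area)
  let ?f = "\<lambda>v. \<phi> (x + r / 2 * sqrt 2 * snd v + sqrt 2 * fst v, sqrt 2 * snd v)"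
  have "(\<integral>\<^sup>+\<omega>. \<phi> (phase x r \<omega>) \<partial>M) = (\<integral>\<^sup>+\<omega>. ?f (area 0 r \<omega>, B (0 + r) \<omega> - B 0 \<omega>) \<partial>M)"
  proof (rule nn_integral_cong)
    fix \<omega> assume \<omega>: "\<omega> \<in> space M"
    have "phase x 0 \<omega> = (x, 0)" by (simp add: phase_def X_proc_def L_proc_def B_zero[OF \<omega>])
    then show "\<phi> (phase x r \<omega>) = ?f (area 0 r \<omega>, B (0 + r) \<omega> - B 0 \<omega>)"
      using phase_add[OF \<omega>, of 0 r x] r by simp
  qed
  also have "\<dots> = (\<integral>\<^sup>+v. ?f v \<partial>distr M (borel \<Otimes>\<^sub>M borel) (\<lambda>\<omega>. (area 0 r \<omega>, B (0 + r) \<omega> - B 0 \<omega>)))"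
    by (subst nn_integral_distr) auto
  also have "\<dots> = kolmogorov_semigroup r \<phi> (x, 0)"
    using r kolmogorov_semigroup_increment[of \<phi> "(x, 0)" r] by (subst nn_integral_increment) auto
  finally show ?thesis .
qed

end

section \<open>The hitting time\<close>

lemma kolmogorov_semigroup_measurable [measurable]:
  assumes [measurable]: "\<phi> \<in> borel_measurable (borel \<Otimes>\<^sub>M borel)" "f \<in> borel_measurable N" "g \<in> measurable N (borel \<Otimes>\<^sub>M borel)"
  shows "(\<lambda>\<omega>. kolmogorov_semigroup (f \<omega>) \<phi> (g \<omega>)) \<in> borel_measurable N"
proof -
  interpret N: real_distribution \<gamma> by (rule real_dist_normal_dist)
  show ?thesis unfolding kolmogorov_semigroup_def kolmogorov_step_def by measurable
qed

lemma kolmogorov_semigroup_0: "kolmogorov_semigroup 0 \<phi> z = \<phi> z"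
proof -
  interpret N: real_distribution \<gamma> by (rule real_dist_normal_dist)
  show ?thesis using N.emeasure_space_1 by (simp add: kolmogorov_semigroup_def kolmogorov_step_def)
qed

lemma kolmogorov_semigroup_le:
  assumes "\<And>z. \<phi> z \<le> C"
  shows "kolmogorov_semigroup r \<phi> z \<le> C"
proof -
  interpret N: real_distribution \<gamma> by (rule real_dist_normal_dist)
  have "kolmogorov_semigroup r \<phi> z \<le> (\<integral>\<^sup>+\<xi>. \<integral>\<^sup>+\<eta>. C \<partial>\<gamma> \<partial>\<gamma>)"
    unfolding kolmogorov_semigroup_def by (intro nn_integral_mono assms)
  then show ?thesis using N.emeasure_space_1 by simp
qed

text \<open>\<open>kolmogorov_step\<close> depends continuously on time and starting point down to
  time 0, so two applications of dominated convergence with the constant bound suffice. This is the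
  regularity used when the hitting time is approximated.\<close>

lemma kolmogorov_semigroup_tendsto:
  fixes f :: "real \<times> real \<Rightarrow> real"
  assumes f: "continuous_on UNIV f" and C: "\<And>z. f z \<le> C"
    and r: "r \<longlonglongrightarrow> r0" and z: "z \<longlonglongrightarrow> z0"
  shows "(\<lambda>n. kolmogorov_semigroup (r n) (\<lambda>z. ennreal (f z)) (z n)) \<longlonglongrightarrow> kolmogorov_semigroup r0 (\<lambda>z. ennreal (f z)) z0"
proof -
  interpret N: real_distribution \<gamma> by (rule real_dist_normal_dist)
  have [measurable]: "f \<in> borel_measurable (borel \<Otimes>\<^sub>M borel)"
    using f by (simp add: borel_prod borel_measurable_continuous_onI)
  have step: "(\<lambda>n. kolmogorov_step (r n) (z n) \<xi> \<eta>) \<longlonglongrightarrow> kolmogorov_step r0 z0 \<xi> \<eta>" for \<xi> \<eta>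
    unfolding kolmogorov_step_def by (intro tendsto_intros r z) auto
  have fin: "(\<integral>\<^sup>+\<eta>. ennreal C \<partial>\<gamma>) = ennreal C" using N.emeasure_space_1 by simp
  have [measurable]: "(\<lambda>p. kolmogorov_step a b (fst p) (snd p)) \<in> measurable (borel \<Otimes>\<^sub>M borel) (borel \<Otimes>\<^sub>M borel)" for a b
    unfolding kolmogorov_step_def by measurable
  have m1 [measurable]: "(\<lambda>\<eta>. ennreal (f (kolmogorov_step a b \<xi> \<eta>))) \<in> borel_measurable borel" for a b \<xi>
    unfolding kolmogorov_step_def by measurable
  have m2: "(\<lambda>\<xi>. \<integral>\<^sup>+\<eta>. ennreal (f (kolmogorov_step a b \<xi> \<eta>)) \<partial>\<gamma>) \<in> borel_measurable borel" for a b
    unfolding kolmogorov_step_def by measurable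
  have inner: "(\<lambda>n. \<integral>\<^sup>+\<eta>. ennreal (f (kolmogorov_step (r n) (z n) \<xi> \<eta>)) \<partial>\<gamma>)
     \<longlonglongrightarrow> (\<integral>\<^sup>+\<eta>. ennreal (f (kolmogorov_step r0 z0 \<xi> \<eta>)) \<partial>\<gamma>)" for \<xi>
  proof (rule nn_integral_dominated_convergence[where w = "\<lambda>_. ennreal C"])
    show "AE \<eta> in \<gamma>. (\<lambda>n. ennreal (f (kolmogorov_step (r n) (z n) \<xi> \<eta>))) \<longlonglongrightarrow> ennreal (f (kolmogorov_step r0 z0 \<xi> \<eta>))"
      by (intro AE_I2 tendsto_ennrealI continuous_on_tendsto_compose[OF f step]) auto
  qed (use fin m1 in \<open>auto intro!: AE_I2 ennreal_leI C\<close>)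
  show ?thesis unfolding kolmogorov_semigroup_def
  proof (rule nn_integral_dominated_convergence[where w = "\<lambda>_. ennreal C"])
    show "AE \<xi> in \<gamma>. (\<integral>\<^sup>+\<eta>. ennreal (f (kolmogorov_step (r n) (z n) \<xi> \<eta>)) \<partial>\<gamma>) \<le> ennreal C" for n
    proof (rule AE_I2)
      fix \<xi>
      have "(\<integral>\<^sup>+\<eta>. ennreal (f (kolmogorov_step (r n) (z n) \<xi> \<eta>)) \<partial>\<gamma>) \<le> (\<integral>\<^sup>+\<eta>. ennreal C \<partial>\<gamma>)"
        by (intro nn_integral_mono ennreal_leI C)
      then show "(\<integral>\<^sup>+\<eta>. ennreal (f (kolmogorov_step (r n) (z n) \<xi> \<eta>)) \<partial>\<gamma>) \<le> ennreal C" by (simp only: fin)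
    qed
  qed (use fin m2 inner in auto)
qed

section \<open>Pathwise analysis of the first return to 0\<close>

locale started_process = continuous_process +
  fixes x :: real
  assumes start_neg: "x < 0"
begin

definition hits :: "'a \<Rightarrow> bool" where "hits \<omega> \<longleftrightarrow> T_zero B x 0 \<omega> < \<infinity>"
definition \<tau> :: "'a \<Rightarrow> real" where "\<tau> \<omega> = real_of_ereal (T_zero B x 0 \<omega>)"

abbreviation "X t \<omega> \<equiv> X_proc B x 0 t \<omega>"

lemma X_eq: "X t \<omega> = x + sqrt 2 * integral {0..t} (\<lambda>t. B t \<omega>)"
  by (simp add: X_proc_def L_proc_def)

lemma X_continuous:
  assumes \<omega>: "\<omega> \<in> space M"
  shows "continuous_on {0..} (\<lambda>t. X t \<omega>)"
proof -
  have "continuous_on {0..b} (\<lambda>t. X t \<omega>)" for b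
    unfolding X_eq by (intro continuous_intros indefinite_integral_continuous_1 B_integrable_on \<omega>) simp
  have "isCont (\<lambda>t. X t \<omega>) t" if "0 < t" for t
  proof -
    have "continuous_on {0<..<t + 1} (\<lambda>t. X t \<omega>)"
      by (rule continuous_on_subset[OF \<open>continuous_on {0..t + 1} (\<lambda>t. X t \<omega>)\<close>]) auto
    then show ?thesis using that by (simp add: continuous_on_eq_continuous_at)
  qed
  moreover have "continuous (at 0 within {0..}) (\<lambda>t. X t \<omega>)"
  proof -
    have "continuous (at 0 within {0..1}) (\<lambda>t. X t \<omega>)"
      using \<open>continuous_on {0..1} (\<lambda>t. X t \<omega>)\<close> by (simp add: continuous_on_eq_continuous_within)
    moreover have "at 0 within {0..1} = at (0::real) within {0..}"
      by (rule at_within_nhd[of _ "{..<1}"]) auto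
    ultimately show ?thesis by simp
  qed
  ultimately show ?thesis
    unfolding continuous_on_eq_continuous_within
    by (metis atLeast_iff continuous_at_imp_continuous_within order_le_less)
qed

lemma X_0: "X 0 \<omega> = x" by (simp add: X_proc_def)

lemma T_zero_nonneg: "0 \<le> T_zero B x 0 \<omega>"
  unfolding T_zero_def by (intro Inf_greatest) auto

text \<open>A nonnegative value up to time u forces a zero by the intermediate value theorem, at a
  positive time because X starts at x < 0. This replaces the infimum by a condition on the path up
  to u.\<close>

lemma less_T_zero_iff:
  assumes \<omega>: "\<omega> \<in> space M" and u: "0 \<le> u"
  shows "ereal u < T_zero B x 0 \<omega> \<longleftrightarrow> (\<forall>v\<in>{0..u}. X v \<omega> < 0)"
proof
  assume *: "ereal u < T_zero B x 0 \<omega>"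
  show "\<forall>v\<in>{0..u}. X v \<omega> < 0"
  proof (rule ccontr)
    assume "\<not> (\<forall>v\<in>{0..u}. X v \<omega> < 0)"
    then obtain v where v: "0 \<le> v" "v \<le> u" "0 \<le> X v \<omega>" by force
    have "\<exists>t\<ge>0. t \<le> v \<and> X t \<omega> = 0"
      using v start_neg X_0 by (intro IVT' continuous_on_subset[OF X_continuous[OF \<omega>]]) auto
    then obtain t where t: "0 \<le> t" "t \<le> v" "X t \<omega> = 0" by auto
    then have "t \<noteq> 0" using start_neg X_0[of \<omega>] by auto
    then have "T_zero B x 0 \<omega> \<le> ereal t"
      unfolding T_zero_def using t by (intro Inf_lower) auto
    also have "ereal t \<le> ereal u" using t v by simp
    finally show False using * by simp
  qed
next
  \<comment> \<open>Strictness needs room: X stays negative on a neighbourhood of u, so every zero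
    is at least e later.\<close>
  assume *: "\<forall>v\<in>{0..u}. X v \<omega> < 0"
  then have "X u \<omega> < 0" using u by auto
  then obtain e where e: "0 < e" "\<And>t. t \<in> {0..} \<Longrightarrow> dist t u < e \<Longrightarrow> dist (X t \<omega>) (X u \<omega>) < - X u \<omega>"
    using X_continuous[OF \<omega>] u unfolding continuous_on_iff by (metis atLeast_iff neg_0_less_iff_less)
  have "ereal (u + e) \<le> T_zero B x 0 \<omega>"
    unfolding T_zero_def
  proof (intro Inf_greatest, clarsimp)
    fix t assume t: "0 < t" "X t \<omega> = 0"
    show "u + e \<le> t"
    proof (rule ccontr)
      assume "\<not> u + e \<le> t"
      moreover have "\<not> t \<le> u"
      proof
        assume "t \<le> u"
        then have "X t \<omega> < 0" using * t(1) by auto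
        then show False using t(2) by simp
      qed
      ultimately have "dist t u < e" by (simp add: dist_real_def)
      then have "dist (X t \<omega>) (X u \<omega>) < - X u \<omega>" using t by (intro e) auto
      then show False using t by (simp add: dist_real_def)
    qed
  qed
  then show "ereal u < T_zero B x 0 \<omega>" using e(1) by (simp add: less_le_trans[of _ "ereal (u + e)"])
qed

lemma hits_T_zero: "hits \<omega> \<Longrightarrow> T_zero B x 0 \<omega> = ereal (\<tau> \<omega>)"
  using T_zero_nonneg[of \<omega>] by (auto simp: hits_def \<tau>_def ereal_real)

lemma \<tau>_nonneg: "0 \<le> \<tau> \<omega>"
  using T_zero_nonneg[of \<omega>] by (simp add: \<tau>_def real_of_ereal_pos)

text \<open>Before \<tau> the path is negative and somewhere up to \<tau> it is not, so \<tau>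
  itself is that time; continuity from the left makes the value 0.\<close>

lemma hitting:
  assumes \<omega>: "\<omega> \<in> space M" and hit: "hits \<omega>"
  shows \<tau>_pos: "0 < \<tau> \<omega>" and X_\<tau>: "X (\<tau> \<omega>) \<omega> = 0" and L_\<tau>: "0 \<le> L_proc B 0 (\<tau> \<omega>) \<omega>"
proof -
  note T = hits_T_zero[OF hit]
  have neg: "X v \<omega> < 0" if "0 \<le> v" "v < \<tau> \<omega>" for v
    using less_T_zero_iff[OF \<omega> that(1)] that by (auto simp: T)
  obtain v where v: "v \<in> {0..\<tau> \<omega>}" "0 \<le> X v \<omega>"
    using less_T_zero_iff[OF \<omega> \<tau>_nonneg] by (force simp: T)
  then have "v = \<tau> \<omega>" using neg[of v] by (cases "v < \<tau> \<omega>") auto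
  then have ge: "0 \<le> X (\<tau> \<omega>) \<omega>" using v by simp
  show pos: "0 < \<tau> \<omega>"
    using ge X_0[of \<omega>] start_neg \<tau>_nonneg[of \<omega>] by (cases "\<tau> \<omega> = 0") auto
  show X0: "X (\<tau> \<omega>) \<omega> = 0"
  proof (rule antisym[OF _ ge])
    have "(\<lambda>n. X (\<tau> \<omega> * (1 - 1 / real (Suc n))) \<omega>) \<longlonglongrightarrow> X (\<tau> \<omega> * (1 - 0)) \<omega>"
    proof (rule continuous_on_tendsto_compose[OF X_continuous[OF \<omega>]])
      show "(\<lambda>n. \<tau> \<omega> * (1 - 1 / real (Suc n))) \<longlonglongrightarrow> \<tau> \<omega> * (1 - 0)"
        by (intro tendsto_intros LIMSEQ_Suc[OF lim_1_over_n])
    qed (use pos in auto)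
    moreover have "X (\<tau> \<omega> * (1 - 1 / real (Suc n))) \<omega> \<le> 0" for n
      using pos by (intro less_imp_le[OF neg]) (auto simp: field_simps)
    ultimately have "X (\<tau> \<omega> * (1 - 0)) \<omega> \<le> 0" by (intro LIMSEQ_le_const2) auto
    then show "X (\<tau> \<omega>) \<omega> \<le> 0" by simp
  qed
  \<comment> \<open>A negative velocity at \<tau> would persist on a short interval before it, where
    X would then not increase; but X is negative there and 0 at \<tau>.\<close>
  show "0 \<le> L_proc B 0 (\<tau> \<omega>) \<omega>"
  proof (rule ccontr)
    assume "\<not> 0 \<le> L_proc B 0 (\<tau> \<omega>) \<omega>"
    then have Bneg: "B (\<tau> \<omega>) \<omega> < 0" by (simp add: L_proc_def zero_le_mult_iff)
    then obtain e where e: "0 < e" "\<And>t. t \<in> {0..} \<Longrightarrow> dist t (\<tau> \<omega>) < e \<Longrightarrow> dist (B t \<omega>) (B (\<tau> \<omega>) \<omega>) < - B (\<tau> \<omega>) \<omega>"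
      using B_continuous[OF \<omega>] pos unfolding continuous_on_iff by (metis atLeast_iff less_imp_le neg_0_less_iff_less)
    define h where "h = max 0 (\<tau> \<omega> - e / 2)"
    have h: "0 \<le> h" "h < \<tau> \<omega>" using e pos by (auto simp: h_def)
    have "integral {h..\<tau> \<omega>} (\<lambda>t. B t \<omega>) \<le> integral {h..\<tau> \<omega>} (\<lambda>t. 0)"
    proof (rule Henstock_Kurzweil_Integration.integral_le)
      show "(\<lambda>t. B t \<omega>) integrable_on {h..\<tau> \<omega>}" by (rule B_integrable_on[OF \<omega> h(1)])
      fix t assume t: "t \<in> {h..\<tau> \<omega>}"
      then have "dist t (\<tau> \<omega>) < e" using e h by (auto simp: dist_real_def h_def)
      then have "dist (B t \<omega>) (B (\<tau> \<omega>) \<omega>) < - B (\<tau> \<omega>) \<omega>" using t h by (intro e) auto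
      then show "B t \<omega> \<le> 0" by (simp add: dist_real_def)
    qed (rule integrable_0)
    moreover have "integral {0..h} (\<lambda>t. B t \<omega>) + integral {h..\<tau> \<omega>} (\<lambda>t. B t \<omega>) = integral {0..\<tau> \<omega>} (\<lambda>t. B t \<omega>)"
      using h by (intro Henstock_Kurzweil_Integration.integral_combine B_integrable_on \<omega>) auto
    ultimately have "X (\<tau> \<omega>) \<omega> \<le> X h \<omega>" by (simp add: X_eq)
    then show False using X0 neg[OF h] by simp
  qed
qed

text \<open>A continuous path that is negative on the compact interval [0, u] stays below some -1 /
  (m + 1), and dyadic multiples of u detect this. The event becomes countable in terms of states at
  times up to u.\<close>

lemma not_hit_sets:
  assumes space: "space F = space M" and u: "0 \<le> u" and m: "\<And>v. 0 \<le> v \<Longrightarrow> v \<le> u \<Longrightarrow> B v \<in> borel_measurable F"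
  shows "{\<omega> \<in> space M. ereal u < T_zero B x 0 \<omega>} \<in> sets F"
proof -
  have le: "u * (real j / 2 ^ n) \<le> u" "0 \<le> u * (real j / 2 ^ n)" if "j \<le> 2 ^ n" for j n :: nat
  proof -
    have "real j \<le> 2 ^ n" using that by (metis of_nat_le_iff of_nat_numeral of_nat_power)
    then have "u * (real j / 2 ^ n) \<le> u * 1" using u by (intro mult_left_mono) auto
    then show "u * (real j / 2 ^ n) \<le> u" "0 \<le> u * (real j / 2 ^ n)" using u by auto
  qed
  have "ereal u < T_zero B x 0 \<omega> \<longleftrightarrow> (\<exists>m. \<forall>n. \<forall>j\<in>{..2 ^ n}. X (u * (real j / 2 ^ n)) \<omega> \<le> - 1 / real (Suc m))" if \<omega>: "\<omega> \<in> space M" for \<omega>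
  proof
    assume "ereal u < T_zero B x 0 \<omega>"
    then have neg: "\<forall>v\<in>{0..u}. X v \<omega> < 0" by (simp add: less_T_zero_iff \<omega> u)
    have "\<exists>v\<in>{0..u}. \<forall>w\<in>{0..u}. X w \<omega> \<le> X v \<omega>"
      using u by (intro continuous_attains_sup continuous_on_subset[OF X_continuous[OF \<omega>]]) auto
    then obtain v where v: "v \<in> {0..u}" "\<And>w. w \<in> {0..u} \<Longrightarrow> X w \<omega> \<le> X v \<omega>" by blast
    obtain m where m: "inverse (real (Suc m)) < - X v \<omega>"
      using neg v(1) reals_Archimedean[of "- X v \<omega>"] by auto
    have "X (u * (real j / 2 ^ n)) \<omega> \<le> - 1 / real (Suc m)" if "j \<le> 2 ^ n" for j n
      using v(2)[of "u * (real j / 2 ^ n)"] le[OF that] m by (simp add: inverse_eq_divide)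
    then show "\<exists>m. \<forall>n. \<forall>j\<in>{..2 ^ n}. X (u * (real j / 2 ^ n)) \<omega> \<le> - 1 / real (Suc m)" by auto
  next
    assume "\<exists>m. \<forall>n. \<forall>j\<in>{..2 ^ n}. X (u * (real j / 2 ^ n)) \<omega> \<le> - 1 / real (Suc m)"
    then obtain m where m: "\<And>n j. j \<le> 2 ^ n \<Longrightarrow> X (u * (real j / 2 ^ n)) \<omega> \<le> - 1 / real (Suc m)" by auto
    have "X v \<omega> \<le> - 1 / real (Suc m)" if v: "v \<in> {0..u}" for v
    proof (cases "u = 0")
      case True
      then show ?thesis using m[of 0 0] v by simp
    next
      case False
      then have "0 < u" using u by simp
      have "continuous_on {0..} (\<lambda>q. X (u * q) \<omega>)"
        using u by (intro continuous_on_compose2[OF X_continuous[OF \<omega>]]) (auto intro!: continuous_intros)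
      from dyadic_floor_tendsto[OF this, of "v / u"]
      have "(\<lambda>n. X (u * (real_of_int \<lfloor>v / u * 2 ^ n\<rfloor> / 2 ^ n)) \<omega>) \<longlonglongrightarrow> X v \<omega>" using v \<open>0 < u\<close> by simp
      moreover have "X (u * (real_of_int \<lfloor>v / u * 2 ^ n\<rfloor> / 2 ^ n)) \<omega> \<le> - 1 / real (Suc m)" for n
      proof -
        have "v / u * 2 ^ n \<le> 1 * 2 ^ n" using v \<open>0 < u\<close> by (intro mult_right_mono) auto
        then have "\<lfloor>v / u * 2 ^ n\<rfloor> \<le> 2 ^ n" by (metis floor_mono floor_numeral_power mult_1)
        moreover have "0 \<le> \<lfloor>v / u * 2 ^ n\<rfloor>" using v \<open>0 < u\<close> by simp
        ultimately obtain j where "\<lfloor>v / u * 2 ^ n\<rfloor> = int j" "j \<le> 2 ^ n"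
          by (metis nonneg_int_cases of_nat_le_iff of_nat_numeral of_nat_power)
        then show ?thesis using m[of j n] by simp
      qed
      ultimately show ?thesis by (intro LIMSEQ_le_const2) auto
    qed
    moreover have "- 1 / real (Suc m) < 0" by simp
    ultimately show "ereal u < T_zero B x 0 \<omega>" unfolding less_T_zero_iff[OF \<omega> u] by (meson order_le_less_trans)
  qed
  then have "{\<omega> \<in> space M. ereal u < T_zero B x 0 \<omega>} = {\<omega> \<in> space F. \<exists>m. \<forall>n. \<forall>j\<in>{..2 ^ n}. X (u * (real j / 2 ^ n)) \<omega> \<le> - 1 / real (Suc m)}"
    by (auto simp: space)
  also have "\<dots> \<in> sets F"
  proof (intro sets.sets_Collect_countable_Ex sets.sets_Collect_countable_All sets.sets_Collect_finite_All)
    fix m n j :: nat assume "j \<in> {..2 ^ n}"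
    have "phase x (u * (real j / 2 ^ n)) \<in> measurable F (borel \<Otimes>\<^sub>M borel)"
      using le[of j n] \<open>j \<in> {..2 ^ n}\<close> u by (intro measurable_phase_sub[OF space] m) auto
    then have "(\<lambda>\<omega>. fst (phase x (u * (real j / 2 ^ n)) \<omega>)) \<in> borel_measurable F" by measurable
    then have [measurable]: "(\<lambda>\<omega>. X (u * (real j / 2 ^ n)) \<omega>) \<in> borel_measurable F" by (simp add: phase_def)
    show "{\<omega> \<in> space F. X (u * (real j / 2 ^ n)) \<omega> \<le> - 1 / real (Suc m)} \<in> sets F" by measurable
  qed auto
  finally show ?thesis .
qed

end

context started_process
begin

lemma not_hit_sets_M [measurable]: "0 \<le> u \<Longrightarrow> {\<omega> \<in> space M. ereal u < T_zero B x 0 \<omega>} \<in> sets M"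
  by (intro not_hit_sets B_measurable) auto

lemma hits_iff: "hits \<omega> \<longleftrightarrow> (\<exists>n::nat. \<not> ereal (real n) < T_zero B x 0 \<omega>)"
proof
  assume "hits \<omega>"
  then have "T_zero B x 0 \<omega> = ereal (\<tau> \<omega>)" by (rule hits_T_zero)
  moreover obtain n :: nat where "\<tau> \<omega> \<le> real n" using real_arch_simple by blast
  ultimately show "\<exists>n::nat. \<not> ereal (real n) < T_zero B x 0 \<omega>" by (auto intro!: exI[of _ n])
qed (auto simp: hits_def not_less intro: le_less_trans)

lemma hits_sets [measurable]: "{\<omega> \<in> space M. hits \<omega>} \<in> sets M"
proof -
  have "{\<omega> \<in> space M. hits \<omega>} = (\<Union>n::nat. space M - {\<omega> \<in> space M. ereal (real n) < T_zero B x 0 \<omega>})"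
    by (auto simp: hits_iff)
  then show ?thesis by auto
qed

lemma hit_before_iff: "0 \<le> a \<Longrightarrow> \<not> ereal a < T_zero B x 0 \<omega> \<longleftrightarrow> hits \<omega> \<and> \<tau> \<omega> \<le> a"
  using hits_T_zero[of \<omega>] by (cases "hits \<omega>") (auto simp: hits_def not_less)

lemma \<tau>_measurable [measurable]: "\<tau> \<in> borel_measurable M"
  unfolding borel_measurable_iff_le
proof
  fix a
  show "{\<omega> \<in> space M. \<tau> \<omega> \<le> a} \<in> sets M"
  proof (cases "0 \<le> a")
    case True
    have "{\<omega> \<in> space M. \<tau> \<omega> \<le> a} = (space M - {\<omega> \<in> space M. hits \<omega>}) \<union> (space M - {\<omega> \<in> space M. ereal a < T_zero B x 0 \<omega>})"
    proof -
      \<comment> \<open>Paths that never hit get the default value 0 of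
        \<open>real_of_ereal\<close>, so they belong to the sublevel set of every a \<ge> 0.\<close>
      have "\<tau> \<omega> = 0" if "\<not> hits \<omega>" for \<omega> using that by (simp add: hits_def \<tau>_def)
      then have "\<tau> \<omega> \<le> a \<longleftrightarrow> \<not> hits \<omega> \<or> \<not> ereal a < T_zero B x 0 \<omega>" for \<omega>
        using hit_before_iff[OF True, of \<omega>] True by metis
      then show ?thesis by blast
    qed
    then show ?thesis using True by auto
  next
    case False
    then have "{\<omega> \<in> space M. \<tau> \<omega> \<le> a} = {}" using \<tau>_nonneg by (auto simp: not_le intro: less_le_trans)
    then show ?thesis by (simp only: sets.empty_sets)
  qed
qed

definition L_hit :: "'a \<Rightarrow> real" where "L_hit \<omega> = L_at_T_zero B x 0 \<omega>"

lemma L_hit_eq: "L_hit \<omega> = L_proc B 0 (\<tau> \<omega>) \<omega>"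
  by (simp add: L_hit_def L_at_T_zero_def \<tau>_def)

text \<open>\<tau> rounded down to a dyadic time takes countably many values, at each of which B is
  measurable; continuity gives the limit, also on paths where \<tau> is the default 0.\<close>

lemma L_hit_measurable [measurable]: "L_hit \<in> borel_measurable M"
proof (rule borel_measurable_LIMSEQ_real)
  fix \<omega> assume \<omega>: "\<omega> \<in> space M"
  have "(\<lambda>n. B (real (nat \<lfloor>\<tau> \<omega> * 2 ^ n\<rfloor>) / 2 ^ n) \<omega>) \<longlonglongrightarrow> B (\<tau> \<omega>) \<omega>"
    using dyadic_floor_tendsto[OF B_continuous[OF \<omega>] \<tau>_nonneg] \<tau>_nonneg[of \<omega>] by simp
  then show "(\<lambda>n. sqrt 2 * B (real (nat \<lfloor>\<tau> \<omega> * 2 ^ n\<rfloor>) / 2 ^ n) \<omega>) \<longlonglongrightarrow> L_hit \<omega>"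
    unfolding L_hit_eq L_proc_def by (auto intro!: tendsto_intros)
next
  fix n
  have [measurable]: "B (real k / 2 ^ n) \<in> borel_measurable M" for k by (rule B_measurable) simp
  have "(\<lambda>\<omega>. nat \<lfloor>\<tau> \<omega> * 2 ^ n\<rfloor>) \<in> measurable M (count_space UNIV)" by measurable
  then show "(\<lambda>\<omega>. sqrt 2 * B (real (nat \<lfloor>\<tau> \<omega> * 2 ^ n\<rfloor>) / 2 ^ n) \<omega>) \<in> borel_measurable M"
    by (intro borel_measurable_times borel_measurable_const measurable_compose_countable[where g = "\<lambda>\<omega>. nat \<lfloor>\<tau> \<omega> * 2 ^ n\<rfloor>" and f = "\<lambda>k \<omega>. B (real k / 2 ^ n) \<omega>"]) auto
qed

lemma phase_\<tau>: "\<omega> \<in> space M \<Longrightarrow> hits \<omega> \<Longrightarrow> phase x (\<tau> \<omega>) \<omega> = (0, L_hit \<omega>)"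
  by (simp add: phase_def X_\<tau> L_hit_eq)

lemma L_hit_nonneg: "\<omega> \<in> space M \<Longrightarrow> hits \<omega> \<Longrightarrow> 0 \<le> L_hit \<omega>"
  by (simp add: L_\<tau> L_hit_eq)

end

section \<open>Strong Markov property and decomposition of potentials at the hitting time\<close>

locale started_below = brownian M B + started_process M B x
  for M :: "'a measure" and B :: "real \<Rightarrow> 'a \<Rightarrow> real" and x :: real
begin

lemma not_hit_past:
  assumes s: "0 < s" and u: "0 \<le> u" "u \<le> s"
  shows "{\<omega> \<in> space M. ereal u < T_zero B x 0 \<omega>} \<in> sets (past s r)"
  using u by (intro not_hit_sets measurable_B_past[OF s]) auto

text \<open>Discretising \<open>\<tau>\<close> from above on the grid \<open>t k / n\<close> reduces the strong Markov property at \<open>\<tau>\<close> to the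
  Markov property at deterministic times.\<close>

lemma strong_Markov_at_hitting:
  fixes f :: "real \<times> real \<Rightarrow> real"
  assumes t: "0 < t" and f: "continuous_on UNIV f" and bnd: "\<And>z. f z \<le> C"
    and supp: "\<And>z. fst z \<le> 0 \<Longrightarrow> f z = 0"
  shows "kolmogorov_semigroup t (\<lambda>z. ennreal (f z)) (x, 0) =
    (\<integral>\<^sup>+\<omega>. kolmogorov_semigroup (t - \<tau> \<omega>) (\<lambda>z. ennreal (f z)) (0, L_hit \<omega>) * indicator {\<omega> \<in> space M. hits \<omega> \<and> \<tau> \<omega> \<le> t} \<omega> \<partial>M)"
proof -
  let ?\<phi> = "\<lambda>z. ennreal (f z)"
  have [measurable]: "f \<in> borel_measurable (borel \<Otimes>\<^sub>M borel)"
    using f by (simp add: borel_prod borel_measurable_continuous_onI)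
  \<comment> \<open>The event that \<tau> lies in the half-open cell from t (k - 1) / n to t k / n,
    right end included. It is decided by time t k / n, which is what the Markov property at that
    time requires.\<close>
  define E where "E n k = {\<omega> \<in> space M. ereal (t * real (k - 1) / real n) < T_zero B x 0 \<omega>} - {\<omega> \<in> space M. ereal (t * real k / real n) < T_zero B x 0 \<omega>}" for n k :: nat
  define g where "g n \<omega> = (\<Sum>k\<in>{1..n}. indicator (E n k) \<omega> * kolmogorov_semigroup (t - t * real k / real n) ?\<phi> (phase x (t * real k / real n) \<omega>))" for n \<omega>
  define K where "K n \<omega> = nat \<lceil>\<tau> \<omega> * real n / t\<rceil>" for n \<omega>
  have E_past: "E n k \<in> sets (past (t * real k / real n) r)" if "1 \<le> k" "k \<le> n" for n k r
  proof -
    have "0 < t * real k / real n" using t that by simp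
    moreover have "t * real (k - 1) / real n \<le> t * real k / real n" using t by (intro divide_right_mono mult_left_mono) auto
    ultimately show ?thesis unfolding E_def using t by (intro sets.Diff not_hit_past) auto
  qed
  have E_ev [measurable]: "E n k \<in> events" for n k unfolding E_def using t by (intro sets.Diff not_hit_sets_M) auto
  have [measurable]: "phase x (t * real k / real n) \<in> measurable M (borel \<Otimes>\<^sub>M borel)" for k n :: nat
    using t by (intro measurable_phase) auto
  have mem_E: "\<omega> \<in> E n k \<longleftrightarrow> hits \<omega> \<and> \<tau> \<omega> \<le> t \<and> k = K n \<omega>" if \<omega>: "\<omega> \<in> space M" and n: "0 < n" and k: "1 \<le> k" "k \<le> n" for \<omega> n k
  proof -
    have "\<omega> \<in> E n k \<longleftrightarrow> hits \<omega> \<and> \<tau> \<omega> \<le> t * real k / real n \<and> t * real (k - 1) / real n < \<tau> \<omega>"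
      using \<omega> t hit_before_iff[of "t * real k / real n" \<omega>] hit_before_iff[of "t * real (k - 1) / real n" \<omega>]
      by (auto simp: E_def)
    also have "\<dots> \<longleftrightarrow> hits \<omega> \<and> \<tau> \<omega> * real n / t \<le> real k \<and> real k - 1 < \<tau> \<omega> * real n / t"
      using t n k by (simp add: field_simps of_nat_diff)
    also have "\<dots> \<longleftrightarrow> hits \<omega> \<and> \<lceil>\<tau> \<omega> * real n / t\<rceil> = int k"
      by (auto simp: ceiling_eq_iff)
    also have "\<dots> \<longleftrightarrow> hits \<omega> \<and> k = K n \<omega>"
      using k by (auto simp: K_def)
    also have "\<dots> \<longleftrightarrow> hits \<omega> \<and> \<tau> \<omega> \<le> t \<and> k = K n \<omega>"
    proof -
      have "\<tau> \<omega> \<le> t" if "k = K n \<omega>"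
      proof -
        have "\<tau> \<omega> * real n / t \<le> real n"
          using that k by (simp add: K_def nat_le_iff ceiling_le_iff)
        then show ?thesis using t n by (simp add: field_simps)
      qed
      then show ?thesis by auto
    qed
    finally show ?thesis .
  qed
  have K_range: "1 \<le> K n \<omega>" "K n \<omega> \<le> n" if "\<omega> \<in> space M" "hits \<omega>" "\<tau> \<omega> \<le> t" "0 < n" for n \<omega>
  proof -
    have "0 < \<tau> \<omega> * real n / t" using t that \<tau>_pos[of \<omega>] by simp
    then show "1 \<le> K n \<omega>" unfolding K_def by linarith
    have "\<tau> \<omega> * real n / t \<le> real n" using t that by (simp add: field_simps)
    then show "K n \<omega> \<le> n" unfolding K_def by (simp add: nat_le_iff ceiling_le_iff)
  qed
  have sum_E: "(\<Sum>k\<in>{1..n}. indicator (E n k) \<omega> * h k) = h (K n \<omega>) * indicator {\<omega> \<in> space M. hits \<omega> \<and> \<tau> \<omega> \<le> t} \<omega>"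
    if \<omega>: "\<omega> \<in> space M" and n: "0 < n" for \<omega> n and h :: "nat \<Rightarrow> ennreal"
  proof (cases "hits \<omega> \<and> \<tau> \<omega> \<le> t")
    case True
    have "(\<Sum>k\<in>{1..n}. indicator (E n k) \<omega> * h k) = (\<Sum>k\<in>{1..n}. if k = K n \<omega> then h k else 0)"
      using mem_E[OF \<omega> n] True by (intro sum.cong) (auto simp: indicator_def)
    also have "\<dots> = h (K n \<omega>)" using K_range[OF \<omega> _ _ n] True by (subst sum.delta) auto
    finally show ?thesis using True \<omega> by simp
  next
    case False
    then have "(\<Sum>k\<in>{1..n}. indicator (E n k) \<omega> * h k) = 0"
      using mem_E[OF \<omega> n] by (intro sum.neutral) (auto simp: indicator_def)
    then show ?thesis using False by simp
  qed
  have int_g: "(\<integral>\<^sup>+\<omega>. g (Suc n) \<omega> \<partial>M) = kolmogorov_semigroup t ?\<phi> (x, 0)" for n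
  proof -
    let ?n = "Suc n"
    have "(\<integral>\<^sup>+\<omega>. g ?n \<omega> \<partial>M) = (\<Sum>k\<in>{1..?n}. \<integral>\<^sup>+\<omega>. indicator (E ?n k) \<omega> * kolmogorov_semigroup (t - t * real k / real ?n) ?\<phi> (phase x (t * real k / real ?n) \<omega>) \<partial>M)"
      unfolding g_def by (rule nn_integral_sum) measurable
    also have "\<dots> = (\<Sum>k\<in>{1..?n}. \<integral>\<^sup>+\<omega>. indicator (E ?n k) \<omega> * ?\<phi> (phase x t \<omega>) \<partial>M)"
    proof (rule sum.cong[OF refl])
      fix k assume k: "k \<in> {1..?n}"
      show "(\<integral>\<^sup>+\<omega>. indicator (E ?n k) \<omega> * kolmogorov_semigroup (t - t * real k / real ?n) ?\<phi> (phase x (t * real k / real ?n) \<omega>) \<partial>M)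
        = (\<integral>\<^sup>+\<omega>. indicator (E ?n k) \<omega> * ?\<phi> (phase x t \<omega>) \<partial>M)"
      \<comment> \<open>In the last cell no time remains. The Markov property needs a positive step,
        while the semigroup at time 0 is the identity.\<close>
      proof (cases "k = ?n")
        case True
        then have "t * real k / real ?n = t" by simp
        then show ?thesis by (simp add: kolmogorov_semigroup_0)
      next
        case False
        then have "real k < real ?n" using k by simp
        then have "t * real k < t * real ?n" using t by (rule mult_strict_left_mono)
        then have "t * real k / real ?n < t" by (simp only: pos_divide_less_eq of_nat_0_less_iff zero_less_Suc)
        then have r: "0 < t - t * real k / real ?n" by simp
        have s: "0 < t * real k / real ?n" using k t by simp
        show ?thesis
          using Markov_property[OF s r E_past, where \<phi> = ?\<phi> and x = x] k by simp
      qed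
    qed
    also have "\<dots> = (\<integral>\<^sup>+\<omega>. (\<Sum>k\<in>{1..?n}. indicator (E ?n k) \<omega> * ?\<phi> (phase x t \<omega>)) \<partial>M)"
      using measurable_phase[of t x] t by (intro nn_integral_sum[symmetric]) (auto intro!: borel_measurable_times_ennreal borel_measurable_indicator)
    also have "\<dots> = (\<integral>\<^sup>+\<omega>. ?\<phi> (phase x t \<omega>) \<partial>M)"
    proof (rule nn_integral_cong)
      fix \<omega> assume \<omega>: "\<omega> \<in> space M"
      have "(\<Sum>k\<in>{1..?n}. indicator (E ?n k) \<omega> * ?\<phi> (phase x t \<omega>)) = ?\<phi> (phase x t \<omega>) * indicator {\<omega> \<in> space M. hits \<omega> \<and> \<tau> \<omega> \<le> t} \<omega>"
        by (rule sum_E[OF \<omega>]) simp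
      also have "\<dots> = ?\<phi> (phase x t \<omega>)"
      \<comment> \<open>A path that has not hit 0 by time t is still negative, where f vanishes;
        restricting to the hitting event loses nothing.\<close>
      proof (cases "hits \<omega> \<and> \<tau> \<omega> \<le> t")
        case False
        then have "ereal t < T_zero B x 0 \<omega>" using hit_before_iff[of t \<omega>] t by auto
        then have "X t \<omega> < 0" using less_T_zero_iff[OF \<omega>, of t] t by auto
        then have "f (phase x t \<omega>) = 0" by (intro supp) (simp add: phase_def)
        then show ?thesis by simp
      qed (simp add: \<omega>)
      finally show "(\<Sum>k\<in>{1..?n}. indicator (E ?n k) \<omega> * ?\<phi> (phase x t \<omega>)) = ?\<phi> (phase x t \<omega>)" .
    qed
    also have "\<dots> = kolmogorov_semigroup t ?\<phi> (x, 0)" by (rule nn_integral_phase[OF t]) measurable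
    finally show ?thesis .
  qed
  have "(\<lambda>n. \<integral>\<^sup>+\<omega>. g (Suc n) \<omega> \<partial>M) \<longlonglongrightarrow>
    (\<integral>\<^sup>+\<omega>. kolmogorov_semigroup (t - \<tau> \<omega>) ?\<phi> (0, L_hit \<omega>) * indicator {\<omega> \<in> space M. hits \<omega> \<and> \<tau> \<omega> \<le> t} \<omega> \<partial>M)"
  proof (rule nn_integral_dominated_convergence[where w = "\<lambda>_. ennreal C"])
    show "g (Suc n) \<in> borel_measurable M" for n unfolding g_def by measurable
    show "(\<lambda>\<omega>. kolmogorov_semigroup (t - \<tau> \<omega>) ?\<phi> (0, L_hit \<omega>) * indicator {\<omega> \<in> space M. hits \<omega> \<and> \<tau> \<omega> \<le> t} \<omega>) \<in> borel_measurable M"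
      by measurable
    show "(\<integral>\<^sup>+\<omega>. ennreal C \<partial>M) < \<infinity>" by (simp add: emeasure_space_1)
    show "AE \<omega> in M. g (Suc n) \<omega> \<le> ennreal C" for n
    proof (rule AE_I2)
      fix \<omega> assume \<omega>: "\<omega> \<in> space M"
      have le: "kolmogorov_semigroup r ?\<phi> z \<le> ennreal C" for r z
        by (intro kolmogorov_semigroup_le ennreal_leI bnd)
      show "g (Suc n) \<omega> \<le> ennreal C"
        unfolding g_def by (subst sum_E[OF \<omega>]) (auto simp: indicator_def le)
    qed
    show "AE \<omega> in M. (\<lambda>n. g (Suc n) \<omega>) \<longlonglongrightarrow> kolmogorov_semigroup (t - \<tau> \<omega>) ?\<phi> (0, L_hit \<omega>) * indicator {\<omega> \<in> space M. hits \<omega> \<and> \<tau> \<omega> \<le> t} \<omega>"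
    proof (rule AE_I2)
      fix \<omega> assume \<omega>: "\<omega> \<in> space M"
      let ?u = "\<lambda>n. t * real (K (Suc n) \<omega>) / real (Suc n)"
      have g_eq: "g (Suc n) \<omega> = kolmogorov_semigroup (t - ?u n) ?\<phi> (phase x (?u n) \<omega>) * indicator {\<omega> \<in> space M. hits \<omega> \<and> \<tau> \<omega> \<le> t} \<omega>" for n
        unfolding g_def by (subst sum_E[OF \<omega>]) auto
      show "(\<lambda>n. g (Suc n) \<omega>) \<longlonglongrightarrow> kolmogorov_semigroup (t - \<tau> \<omega>) ?\<phi> (0, L_hit \<omega>) * indicator {\<omega> \<in> space M. hits \<omega> \<and> \<tau> \<omega> \<le> t} \<omega>"
      proof (cases "hits \<omega> \<and> \<tau> \<omega> \<le> t")
        case True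
        \<comment> \<open>Rounding up overshoots \<tau> by at most one cell of length t / (n +
          1).\<close>
        have u: "?u \<longlonglongrightarrow> \<tau> \<omega>"
        proof (rule tendsto_sandwich)
          have "\<tau> \<omega> \<le> ?u n" "?u n \<le> \<tau> \<omega> + t / real (Suc n)" for n
          proof -
            have "0 \<le> \<tau> \<omega> * real (Suc n) / t" using t \<tau>_nonneg[of \<omega>] by simp
            then have "\<tau> \<omega> * real (Suc n) / t \<le> real (K (Suc n) \<omega>)" "real (K (Suc n) \<omega>) \<le> \<tau> \<omega> * real (Suc n) / t + 1"
              unfolding K_def by linarith+
            moreover define N where "N = real (Suc n)"
            moreover have N: "0 < N" by (simp add: N_def)
            moreover have "0 \<le> t / N" using t N by simp
            ultimately have "t / N * (\<tau> \<omega> * N / t) \<le> t / N * real (K (Suc n) \<omega>)" "t / N * real (K (Suc n) \<omega>) \<le> t / N * (\<tau> \<omega> * N / t + 1)"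
              by (simp_all only: mult_left_mono)
            then show "\<tau> \<omega> \<le> ?u n" "?u n \<le> \<tau> \<omega> + t / real (Suc n)"
              using t N unfolding N_def[symmetric] by (simp_all add: distrib_left)
          qed
          then show "\<forall>\<^sub>F n in sequentially. \<tau> \<omega> \<le> ?u n" "\<forall>\<^sub>F n in sequentially. ?u n \<le> \<tau> \<omega> + t / real (Suc n)" by auto
          have "(\<lambda>n. \<tau> \<omega> + t * (1 / real (Suc n))) \<longlonglongrightarrow> \<tau> \<omega> + t * 0"
            by (intro tendsto_intros LIMSEQ_Suc[OF lim_1_over_n])
          then show "(\<lambda>n. \<tau> \<omega> + t / real (Suc n)) \<longlonglongrightarrow> \<tau> \<omega>" by simp
        qed simp
        have u0: "0 \<le> ?u n" for n using t by simp
        have "(\<lambda>n. X (?u n) \<omega>) \<longlonglongrightarrow> X (\<tau> \<omega>) \<omega>"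
          using u0 by (intro continuous_on_tendsto_compose[OF X_continuous[OF \<omega>] u]) (auto simp: \<tau>_nonneg)
        moreover have "(\<lambda>n. B (?u n) \<omega>) \<longlonglongrightarrow> B (\<tau> \<omega>) \<omega>"
          using u0 by (intro continuous_on_tendsto_compose[OF B_continuous[OF \<omega>] u]) (auto simp: \<tau>_nonneg)
        ultimately have "(\<lambda>n. phase x (?u n) \<omega>) \<longlonglongrightarrow> phase x (\<tau> \<omega>) \<omega>"
          unfolding phase_def L_proc_def by (intro tendsto_intros)
        then have z: "(\<lambda>n. phase x (?u n) \<omega>) \<longlonglongrightarrow> (0, L_hit \<omega>)" using phase_\<tau>[OF \<omega>] True by simp
        have "(\<lambda>n. kolmogorov_semigroup (t - ?u n) ?\<phi> (phase x (?u n) \<omega>)) \<longlonglongrightarrow> kolmogorov_semigroup (t - \<tau> \<omega>) ?\<phi> (0, L_hit \<omega>)"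
          by (intro kolmogorov_semigroup_tendsto[OF f bnd] z tendsto_intros u)
        then show ?thesis unfolding g_eq using True \<omega> by simp
      qed (simp add: g_eq)
    qed
  qed measurable
  then show ?thesis unfolding int_g by (simp add: LIMSEQ_const_iff)
qed

text \<open>Integrating the strong Markov identity over t and shifting time by \<tau> under the
  expectation removes \<tau>: what remains depends on the path only through the hitting event and
  the velocity at the hit.\<close>

lemma potential_decomposition:
  fixes f :: "real \<times> real \<Rightarrow> real"
  assumes f: "continuous_on UNIV f" and bnd: "\<And>z. f z \<le> C"
    and supp: "\<And>z. fst z \<le> 0 \<Longrightarrow> f z = 0"
  shows "(\<integral>\<^sup>+t\<in>{0<..}. kolmogorov_semigroup t (\<lambda>z. ennreal (f z)) (x, 0) \<partial>lborel) =
    (\<integral>\<^sup>+\<omega>. (\<integral>\<^sup>+r\<in>{0<..}. kolmogorov_semigroup r (\<lambda>z. ennreal (f z)) (0, L_hit \<omega>) \<partial>lborel) * indicator {\<omega> \<in> space M. hits \<omega>} \<omega> \<partial>M)"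
proof -
  let ?\<phi> = "\<lambda>z. ennreal (f z)"
  have [measurable]: "f \<in> borel_measurable (borel \<Otimes>\<^sub>M borel)"
    using f by (simp add: borel_prod borel_measurable_continuous_onI)
  interpret P: pair_sigma_finite lborel M by unfold_locales
  let ?h = "\<lambda>t \<omega>. kolmogorov_semigroup (t - \<tau> \<omega>) ?\<phi> (0, L_hit \<omega>) * indicator {\<omega> \<in> space M. hits \<omega>} \<omega> * indicator {0..} (t - \<tau> \<omega>)"
  have "(\<integral>\<^sup>+t\<in>{0<..}. kolmogorov_semigroup t ?\<phi> (x, 0) \<partial>lborel) = (\<integral>\<^sup>+t. \<integral>\<^sup>+\<omega>. ?h t \<omega> \<partial>M \<partial>lborel)"
  proof (rule nn_integral_cong)
    fix t :: real
    show "kolmogorov_semigroup t ?\<phi> (x, 0) * indicator {0<..} t = (\<integral>\<^sup>+\<omega>. ?h t \<omega> \<partial>M)"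
    proof (cases "0 < t")
      case True
      have "(\<integral>\<^sup>+\<omega>. kolmogorov_semigroup (t - \<tau> \<omega>) ?\<phi> (0, L_hit \<omega>) * indicator {\<omega> \<in> space M. hits \<omega> \<and> \<tau> \<omega> \<le> t} \<omega> \<partial>M) = (\<integral>\<^sup>+\<omega>. ?h t \<omega> \<partial>M)"
        by (intro nn_integral_cong) (auto simp: indicator_def)
      then show ?thesis using strong_Markov_at_hitting[OF True f bnd supp] True by simp
    next
      case False
      have "?h t \<omega> = 0" if "\<omega> \<in> space M" for \<omega>
        using \<tau>_pos[OF that] False by (cases "hits \<omega>") (auto simp: indicator_def)
      then have "(\<integral>\<^sup>+\<omega>. ?h t \<omega> \<partial>M) = (\<integral>\<^sup>+\<omega>. 0 \<partial>M)" by (intro nn_integral_cong) auto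
      then show ?thesis using False by simp
    qed
  qed
  also have "\<dots> = (\<integral>\<^sup>+\<omega>. \<integral>\<^sup>+t. ?h t \<omega> \<partial>lborel \<partial>M)"
    by (rule P.Fubini'[symmetric]) measurable
  also have "\<dots> = (\<integral>\<^sup>+\<omega>. (\<integral>\<^sup>+r\<in>{0<..}. kolmogorov_semigroup r ?\<phi> (0, L_hit \<omega>) \<partial>lborel) * indicator {\<omega> \<in> space M. hits \<omega>} \<omega> \<partial>M)"
  proof (rule nn_integral_cong)
    fix \<omega>
    have "(\<integral>\<^sup>+t. ?h t \<omega> \<partial>lborel) = (\<integral>\<^sup>+r. kolmogorov_semigroup r ?\<phi> (0, L_hit \<omega>) * indicator {\<omega> \<in> space M. hits \<omega>} \<omega> * indicator {0..} r \<partial>lborel)"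
      by (subst nn_integral_real_affine[where c = 1 and t = "\<tau> \<omega>"]) auto
    also have "\<dots> = (\<integral>\<^sup>+r. (kolmogorov_semigroup r ?\<phi> (0, L_hit \<omega>) * indicator {0<..} r) * indicator {\<omega> \<in> space M. hits \<omega>} \<omega> \<partial>lborel)"
      using AE_lborel_singleton[of "0::real"]
      by (intro nn_integral_cong_AE) (auto simp: indicator_def elim!: eventually_mono)
    also have "\<dots> = (\<integral>\<^sup>+r\<in>{0<..}. kolmogorov_semigroup r ?\<phi> (0, L_hit \<omega>) \<partial>lborel) * indicator {\<omega> \<in> space M. hits \<omega>} \<omega>"
      by (rule nn_integral_multc) measurable
    finally show "(\<integral>\<^sup>+t. ?h t \<omega> \<partial>lborel) = (\<integral>\<^sup>+r\<in>{0<..}. kolmogorov_semigroup r ?\<phi> (0, L_hit \<omega>) \<partial>lborel) * indicator {\<omega> \<in> space M. hits \<omega>} \<omega>" .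
  qed
  finally show ?thesis .
qed

end

section \<open>Return densities\<close>

lemma nn_integral_std_normal_affine:
  fixes g :: "real \<Rightarrow> ennreal"
  assumes [measurable]: "g \<in> borel_measurable borel" and \<sigma>: "0 < \<sigma>"
  shows "(\<integral>\<^sup>+\<xi>. g (m + \<sigma> * \<xi>) \<partial>\<gamma>) = (\<integral>\<^sup>+x. g x * ennreal (normal_density m \<sigma> x) \<partial>lborel)"
proof -
  have "(\<integral>\<^sup>+x. g x * ennreal (normal_density m \<sigma> x) \<partial>lborel)
    = ennreal \<bar>\<sigma>\<bar> * (\<integral>\<^sup>+\<xi>. g (m + \<sigma> * \<xi>) * ennreal (normal_density m \<sigma> (m + \<sigma> * \<xi>)) \<partial>lborel)"
    using \<sigma> by (intro nn_integral_real_affine) auto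
  also have "\<dots> = (\<integral>\<^sup>+\<xi>. ennreal \<sigma> * (g (m + \<sigma> * \<xi>) * ennreal (normal_density m \<sigma> (m + \<sigma> * \<xi>))) \<partial>lborel)"
    using \<sigma> by (subst nn_integral_cmult) auto
  also have "\<dots> = (\<integral>\<^sup>+\<xi>. ennreal (std_normal_density \<xi>) * g (m + \<sigma> * \<xi>) \<partial>lborel)"
  proof (rule nn_integral_cong)
    fix \<xi>
    have "\<sigma> * normal_density m \<sigma> (m + \<sigma> * \<xi>) = std_normal_density \<xi>"
      using \<sigma> by (simp add: normal_density_def real_sqrt_mult power_mult_distrib)
    then have "ennreal \<sigma> * ennreal (normal_density m \<sigma> (m + \<sigma> * \<xi>)) = ennreal (std_normal_density \<xi>)"
      using \<sigma> by (simp add: ennreal_mult'[symmetric])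
    then show "ennreal \<sigma> * (g (m + \<sigma> * \<xi>) * ennreal (normal_density m \<sigma> (m + \<sigma> * \<xi>))) = ennreal (std_normal_density \<xi>) * g (m + \<sigma> * \<xi>)"
      by (metis mult.assoc mult.commute)
  qed
  also have "\<dots> = (\<integral>\<^sup>+\<xi>. g (m + \<sigma> * \<xi>) \<partial>\<gamma>)"
    by (rule nn_integral_density[symmetric]) auto
  finally show ?thesis ..
qed

text \<open>The velocity is integrated outermost: with y' = y + sqrt (2 r) \<eta> the mean position
  x + r y + (r/2) sqrt (2 r) \<eta> becomes x + r (y + y') / 2, the mean in the conditional factor
  of the density.\<close>

lemma kolmogorov_semigroup_density:
  fixes \<phi> :: "real \<times> real \<Rightarrow> ennreal"
  assumes [measurable]: "\<phi> \<in> borel_measurable (borel \<Otimes>\<^sub>M borel)" and r: "0 < r"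
  shows "kolmogorov_semigroup r \<phi> (x, y) =
    (\<integral>\<^sup>+y'. \<integral>\<^sup>+x'. \<phi> (x', y') * ennreal (kolmogorov_density r x y x' y') \<partial>lborel \<partial>lborel)"
proof -
  interpret N: real_distribution \<gamma> by (rule real_dist_normal_dist)
  interpret P: pair_sigma_finite \<gamma> \<gamma> by unfold_locales
  let ?n = "\<lambda>y' x'. ennreal (normal_density (x + r * (y + y') / 2) (sqrt (r ^ 3 / 6)) x')"
  have "kolmogorov_semigroup r \<phi> (x, y) =
    (\<integral>\<^sup>+\<eta>. \<integral>\<^sup>+\<xi>. \<phi> (kolmogorov_step r (x, y) \<xi> \<eta>) \<partial>\<gamma> \<partial>\<gamma>)"
    unfolding kolmogorov_semigroup_def by (rule P.Fubini'[symmetric]) (simp add: kolmogorov_step_def)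
  also have "\<dots> = (\<integral>\<^sup>+\<eta>. (\<lambda>y'. \<integral>\<^sup>+x'. \<phi> (x', y') * ?n y' x' \<partial>lborel) (y + sqrt (2 * r) * \<eta>) \<partial>\<gamma>)"
  proof (rule nn_integral_cong)
    fix \<eta>
    have "kolmogorov_step r (x, y) \<xi> \<eta> = (x + r * (y + (y + sqrt (2 * r) * \<eta>)) / 2 + sqrt (r ^ 3 / 6) * \<xi>, y + sqrt (2 * r) * \<eta>)" for \<xi>
      by (simp add: kolmogorov_step_def algebra_simps add_divide_distrib)
    then have "(\<integral>\<^sup>+\<xi>. \<phi> (kolmogorov_step r (x, y) \<xi> \<eta>) \<partial>\<gamma>) =
      (\<integral>\<^sup>+\<xi>. \<phi> (x + r * (y + (y + sqrt (2 * r) * \<eta>)) / 2 + sqrt (r ^ 3 / 6) * \<xi>, y + sqrt (2 * r) * \<eta>) \<partial>\<gamma>)"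
      by (simp only:)
    also have "\<dots> = (\<integral>\<^sup>+x'. \<phi> (x', y + sqrt (2 * r) * \<eta>) * ?n (y + sqrt (2 * r) * \<eta>) x' \<partial>lborel)"
      using r by (intro nn_integral_std_normal_affine[where g = "\<lambda>x'. \<phi> (x', y + sqrt (2 * r) * \<eta>)"]) auto
    finally show "(\<integral>\<^sup>+\<xi>. \<phi> (kolmogorov_step r (x, y) \<xi> \<eta>) \<partial>\<gamma>) = (\<lambda>y'. \<integral>\<^sup>+x'. \<phi> (x', y') * ?n y' x' \<partial>lborel) (y + sqrt (2 * r) * \<eta>)" .
  qed
  also have "\<dots> = (\<integral>\<^sup>+y'. (\<integral>\<^sup>+x'. \<phi> (x', y') * ?n y' x' \<partial>lborel) * ennreal (normal_density y (sqrt (2 * r)) y') \<partial>lborel)"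
  proof (rule nn_integral_std_normal_affine)
    have [measurable]: "(\<lambda>p. ?n (fst p) (snd p)) \<in> borel_measurable (borel \<Otimes>\<^sub>M borel)"
      unfolding normal_density_def by measurable
    show "(\<lambda>y'. \<integral>\<^sup>+x'. \<phi> (x', y') * ?n y' x' \<partial>lborel) \<in> borel_measurable borel"
      unfolding normal_density_def by measurable
  qed (use r in simp)
  also have "\<dots> = (\<integral>\<^sup>+y'. \<integral>\<^sup>+x'. \<phi> (x', y') * ennreal (kolmogorov_density r x y x' y') \<partial>lborel \<partial>lborel)"
    by (subst nn_integral_multc[symmetric])
       (auto intro!: nn_integral_cong simp: kolmogorov_density_def ennreal_mult' mult_ac)
  finally show ?thesis .
qed

text \<open>A continuous profile carried by [0, 1] and vanishing at both ends. Its mass is left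
  unnormalised, since it appears on both sides of the identity and cancels.\<close>

definition bump :: "real \<Rightarrow> real" where "bump u = max 0 (u * (1 - u))"

lemma bump_continuous: "continuous_on A bump" unfolding bump_def by (intro continuous_intros)
lemma bump_measurable [measurable]: "bump \<in> borel_measurable borel" unfolding bump_def by measurable
lemma bump_nonneg: "0 \<le> bump u" by (simp add: bump_def)
lemma bump_eq_0: "u \<le> 0 \<Longrightarrow> bump u = 0" by (simp add: bump_def mult_nonpos_nonneg)
lemma bump_eq_0': "1 \<le> u \<Longrightarrow> bump u = 0" by (simp add: bump_def mult_nonneg_nonpos)
lemma bump_le_1: "bump u \<le> 1"
proof (cases "0 < u \<and> u < 1")
  case True
  then have "u * (1 - u) \<le> 1 * 1" by (intro mult_mono) auto
  then show ?thesis by (simp add: bump_def)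
qed (auto simp: not_less bump_eq_0 bump_eq_0')

lemma nn_integral_bump: "0 < (\<integral>\<^sup>+u. ennreal (bump u) \<partial>lborel)" "(\<integral>\<^sup>+u. ennreal (bump u) \<partial>lborel) < \<infinity>"
proof -
  have "(\<integral>\<^sup>+u. ennreal (bump u) \<partial>lborel) \<le> (\<integral>\<^sup>+u. indicator {0..1::real} u \<partial>lborel)"
  proof (rule nn_integral_mono)
    fix u :: real
    show "ennreal (bump u) \<le> indicator {0..1} u"
      using bump_eq_0[of u] bump_eq_0'[of u] bump_le_1[of u] by (auto simp: indicator_def not_le)
  qed
  then show "(\<integral>\<^sup>+u. ennreal (bump u) \<partial>lborel) < \<infinity>" by (simp add: le_less_trans)
  have "(\<integral>\<^sup>+u. ennreal (3 / 16) * indicator {1/4..3/4::real} u \<partial>lborel) \<le> (\<integral>\<^sup>+u. ennreal (bump u) \<partial>lborel)"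
  proof (intro nn_integral_mono)
    fix u :: real
    \<comment> \<open>3/16 is the value of u (1 - u) at the end points 1/4 and 3/4.\<close>
    have "3 / 16 \<le> u * (1 - u)" if "1 / 4 \<le> u" "u \<le> 3 / 4"
    proof -
      have "0 \<le> (u - 1 / 4) * (3 / 4 - u)" using that by (intro mult_nonneg_nonneg) auto
      moreover have "(u - 1 / 4) * (3 / 4 - u) = u * (1 - u) - 3 / 16" by (simp add: field_simps)
      ultimately show ?thesis by linarith
    qed
    then show "ennreal (3 / 16) * indicator {1/4..3/4} u \<le> ennreal (bump u)"
      by (auto simp: indicator_def bump_def intro!: ennreal_leI)
  qed
  moreover have "(\<integral>\<^sup>+u. ennreal (3 / 16) * indicator {1/4..3/4::real} u \<partial>lborel) = ennreal (3 / 16) * emeasure lborel {1/4..3/4::real}"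
    by (rule nn_integral_cmult_indicator) simp
  moreover have "emeasure lborel {1/4..3/4::real} = ennreal (3/4 - 1/4)" by (rule emeasure_lborel_Icc) simp
  moreover have "0 < ennreal (3 / 16) * ennreal (3/4 - 1/4)"
    unfolding ennreal_zero_less_mult_iff by (simp only: ennreal_less_zero_iff) simp
  ultimately show "0 < (\<integral>\<^sup>+u. ennreal (bump u) \<partial>lborel)"
    by (simp only: less_le_trans)
qed

text \<open>The mollifier sits at negative velocity: from \<open>(0, u)\<close> with \<open>u \<ge> 0\<close> the velocity \<open>-w\<close> is not reached
  instantaneously, so the return densities are dominated uniformly in \<open>u\<close>.\<close>

definition mollifier :: "real \<Rightarrow> real \<Rightarrow> real \<times> real \<Rightarrow> real" where
  "mollifier \<epsilon> w z = bump (fst z / \<epsilon>) * bump ((- w - snd z) / \<epsilon>) / \<epsilon>\<^sup>2"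

text \<open>In the coordinates x' = \<epsilon> \<xi> and y' = -w - \<epsilon> \<eta> the two
  Jacobians cancel the factor 1 / \<epsilon>^2, so \<epsilon> remains only in the arguments of the
  density and can be sent to 0.\<close>

lemma kolmogorov_semigroup_mollifier:
  assumes r: "0 < r" and \<epsilon>: "0 < \<epsilon>"
  shows "kolmogorov_semigroup r (\<lambda>z. ennreal (mollifier \<epsilon> w z)) (x, y) =
    (\<integral>\<^sup>+\<eta>. \<integral>\<^sup>+\<xi>. ennreal (bump \<xi> * bump \<eta> * kolmogorov_density r x y (\<epsilon> * \<xi>) (- w - \<epsilon> * \<eta>)) \<partial>lborel \<partial>lborel)"
proof -
  have [measurable]: "mollifier \<epsilon> w \<in> borel_measurable (borel \<Otimes>\<^sub>M borel)" unfolding mollifier_def by measurable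
  let ?G = "\<lambda>y'. \<integral>\<^sup>+x'. ennreal (mollifier \<epsilon> w (x', y')) * ennreal (kolmogorov_density r x y x' y') \<partial>lborel"
  have "kolmogorov_semigroup r (\<lambda>z. ennreal (mollifier \<epsilon> w z)) (x, y) = (\<integral>\<^sup>+y'. ?G y' \<partial>lborel)"
    by (rule kolmogorov_semigroup_density[OF _ r]) measurable
  also have "\<dots> = ennreal \<bar>- \<epsilon>\<bar> * (\<integral>\<^sup>+\<eta>. ?G (- w + - \<epsilon> * \<eta>) \<partial>lborel)"
    by (rule nn_integral_real_affine) (use \<epsilon> in auto)
  also have "\<dots> = (\<integral>\<^sup>+\<eta>. ennreal \<epsilon> * ?G (- w - \<epsilon> * \<eta>) \<partial>lborel)"
    using \<epsilon> by (subst nn_integral_cmult) auto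
  also have "\<dots> = (\<integral>\<^sup>+\<eta>. \<integral>\<^sup>+\<xi>. ennreal (bump \<xi> * bump \<eta> * kolmogorov_density r x y (\<epsilon> * \<xi>) (- w - \<epsilon> * \<eta>)) \<partial>lborel \<partial>lborel)"
  proof (rule nn_integral_cong)
    fix \<eta>
    let ?h = "\<lambda>x'. ennreal (mollifier \<epsilon> w (x', - w - \<epsilon> * \<eta>)) * ennreal (kolmogorov_density r x y x' (- w - \<epsilon> * \<eta>))"
    have "?G (- w - \<epsilon> * \<eta>) = ennreal \<bar>\<epsilon>\<bar> * (\<integral>\<^sup>+\<xi>. ?h (0 + \<epsilon> * \<xi>) \<partial>lborel)"
      by (rule nn_integral_real_affine) (use \<epsilon> in auto)
    also have "\<dots> = (\<integral>\<^sup>+\<xi>. ennreal \<epsilon> * ?h (\<epsilon> * \<xi>) \<partial>lborel)"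
      using \<epsilon> by (subst nn_integral_cmult) auto
    finally have "ennreal \<epsilon> * ?G (- w - \<epsilon> * \<eta>) = ennreal \<epsilon> * (\<integral>\<^sup>+\<xi>. ennreal \<epsilon> * ?h (\<epsilon> * \<xi>) \<partial>lborel)" by simp
    also have "\<dots> = (\<integral>\<^sup>+\<xi>. ennreal \<epsilon> * (ennreal \<epsilon> * ?h (\<epsilon> * \<xi>)) \<partial>lborel)"
      by (rule nn_integral_cmult[symmetric]) auto
    also have "\<dots> = (\<integral>\<^sup>+\<xi>. ennreal (bump \<xi> * bump \<eta> * kolmogorov_density r x y (\<epsilon> * \<xi>) (- w - \<epsilon> * \<eta>)) \<partial>lborel)"
    proof (rule nn_integral_cong)
      fix \<xi>
      have "\<epsilon> * (\<epsilon> * (mollifier \<epsilon> w (\<epsilon> * \<xi>, - w - \<epsilon> * \<eta>) * kolmogorov_density r x y (\<epsilon> * \<xi>) (- w - \<epsilon> * \<eta>)))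
        = bump \<xi> * bump \<eta> * kolmogorov_density r x y (\<epsilon> * \<xi>) (- w - \<epsilon> * \<eta>)"
        using \<epsilon> by (simp add: mollifier_def power2_eq_square)
      moreover have "0 \<le> mollifier \<epsilon> w (\<epsilon> * \<xi>, - w - \<epsilon> * \<eta>)" by (simp add: mollifier_def bump_nonneg)
      ultimately show "ennreal \<epsilon> * (ennreal \<epsilon> * ?h (\<epsilon> * \<xi>)) = ennreal (bump \<xi> * bump \<eta> * kolmogorov_density r x y (\<epsilon> * \<xi>) (- w - \<epsilon> * \<eta>))"
        using \<epsilon> by (metis ennreal_mult' kolmogorov_density_nonneg less_imp_le mult_nonneg_nonneg)
    qed
    finally show "ennreal \<epsilon> * ?G (- w - \<epsilon> * \<eta>) = (\<integral>\<^sup>+\<xi>. ennreal (bump \<xi> * bump \<eta> * kolmogorov_density r x y (\<epsilon> * \<xi>) (- w - \<epsilon> * \<eta>)) \<partial>lborel)" .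
  qed
  finally show ?thesis .
qed

text \<open>The position term is dropped, and the velocity has to travel at least w because y \<ge>
  0. The factor exp (-w^2 / (4 r)) tames r^(-2) at time 0, and the bound involves neither end point
  beyond w.\<close>

lemma kolmogorov_density_le:
  assumes "0 < r" "0 \<le> y" "0 \<le> w" "0 \<le> h"
  shows "kolmogorov_density r x y x' (- w - h) \<le> sqrt 3 / (2 * pi) * (1 / r\<^sup>2 * exp (- (w\<^sup>2 / 4) / r))"
proof -
  have "w\<^sup>2 \<le> (w + h + y)\<^sup>2" using assms by (intro power_mono) auto
  also have "(w + h + y)\<^sup>2 = (- w - h - y)\<^sup>2" by (simp add: power2_eq_square algebra_simps)
  finally have "w\<^sup>2 / (4 * r) \<le> (- w - h - y)\<^sup>2 / (4 * r)" using assms by (intro divide_right_mono) auto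
  moreover have "0 \<le> 3 * (x' - x - r * (y + (- w - h)) / 2)\<^sup>2 / r ^ 3" using assms by simp
  ultimately have "- ((- w - h - y)\<^sup>2 / (4 * r) + 3 * (x' - x - r * (y + (- w - h)) / 2)\<^sup>2 / r ^ 3) \<le> - (w\<^sup>2 / 4) / r"
    by (simp add: field_simps)
  then have "sqrt 3 / (2 * pi) / r\<^sup>2 * exp (- ((- w - h - y)\<^sup>2 / (4 * r) + 3 * (x' - x - r * (y + (- w - h)) / 2)\<^sup>2 / r ^ 3)) \<le> sqrt 3 / (2 * pi) / r\<^sup>2 * exp (- (w\<^sup>2 / 4) / r)"
    by (intro mult_left_mono) auto
  then show ?thesis unfolding kolmogorov_density_eq[OF assms(1)] by simp
qed

text \<open>Dominated convergence over time and both rescaled coordinates at once. The second claim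
  is the integral of the majorant; being free of y and \<epsilon>, it later dominates under the
  expectation.\<close>

lemma mollified_potential:
  fixes w x y :: real
  assumes w: "0 < w" and y: "0 \<le> y"
  defines "J \<equiv> \<lambda>\<epsilon>. \<integral>\<^sup>+r\<in>{0<..}. kolmogorov_semigroup r (\<lambda>z. ennreal (mollifier \<epsilon> w z)) (x, y) \<partial>lborel"
    and "\<kappa> \<equiv> \<integral>\<^sup>+u. ennreal (bump u) \<partial>lborel"
  shows "(\<lambda>n. J (1 / real (Suc n))) \<longlonglongrightarrow> \<kappa> * \<kappa> * (\<integral>\<^sup>+r\<in>{0<..}. ennreal (kolmogorov_density r x y 0 (- w)) \<partial>lborel)"
    and "0 < \<epsilon> \<Longrightarrow> J \<epsilon> \<le> \<kappa> * \<kappa> * ennreal (sqrt 3 / (2 * pi) * (4 / w\<^sup>2))"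
proof -
  define F where "F \<epsilon> p = ennreal (bump (snd (snd p)) * bump (fst (snd p)) * kolmogorov_density (fst p) x y (\<epsilon> * snd (snd p)) (- w - \<epsilon> * fst (snd p))) * indicator {0<..} (fst p)"
    for \<epsilon> :: real and p :: "real \<times> (real \<times> real)"
  define W where "W p = ennreal (bump (snd (snd p)) * bump (fst (snd p)) * (sqrt 3 / (2 * pi) * (1 / (fst p)\<^sup>2 * exp (- (w\<^sup>2 / 4) / fst p)))) * indicator {0<..} (fst p)"
    for p :: "real \<times> (real \<times> real)"
  let ?L = "lborel \<Otimes>\<^sub>M (lborel \<Otimes>\<^sub>M lborel) :: (real \<times> real \<times> real) measure"
  have L2: "sigma_finite_measure (lborel \<Otimes>\<^sub>M lborel :: (real \<times> real) measure)"
    unfolding lborel_prod by unfold_locales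
  have [measurable]: "F \<epsilon> \<in> borel_measurable ?L" for \<epsilon> unfolding F_def by measurable
  have [measurable]: "W \<in> borel_measurable ?L" unfolding W_def by measurable
  have split: "(\<integral>\<^sup>+p. H p \<partial>?L) = (\<integral>\<^sup>+r. \<integral>\<^sup>+\<eta>. \<integral>\<^sup>+\<xi>. H (r, \<eta>, \<xi>) \<partial>lborel \<partial>lborel \<partial>lborel)"
    if [measurable]: "H \<in> borel_measurable ?L" for H
    by (subst sigma_finite_measure.nn_integral_fst[OF L2, symmetric], measurable, subst lborel.nn_integral_fst[symmetric]) auto
  have J_eq: "J \<epsilon> = (\<integral>\<^sup>+p. F \<epsilon> p \<partial>?L)" if "0 < \<epsilon>" for \<epsilon>
    unfolding J_def
  proof (subst split, measurable, rule nn_integral_cong)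
    fix r :: real
    show "kolmogorov_semigroup r (\<lambda>z. ennreal (mollifier \<epsilon> w z)) (x, y) * indicator {0<..} r = (\<integral>\<^sup>+\<eta>. \<integral>\<^sup>+\<xi>. F \<epsilon> (r, \<eta>, \<xi>) \<partial>lborel \<partial>lborel)"
      using that by (cases "0 < r") (simp_all add: kolmogorov_semigroup_mollifier F_def)
  qed
  have prod: "(\<integral>\<^sup>+r. \<integral>\<^sup>+\<eta>. \<integral>\<^sup>+\<xi>. ennreal (bump \<xi> * bump \<eta> * h r) * indicator {0<..} r \<partial>lborel \<partial>lborel \<partial>lborel) = \<kappa> * \<kappa> * (\<integral>\<^sup>+r\<in>{0<..}. ennreal (h r) \<partial>lborel)"
    if [measurable]: "h \<in> borel_measurable borel" and h: "\<And>r. 0 < r \<Longrightarrow> 0 \<le> h r" for h :: "real \<Rightarrow> real"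
  proof -
    have "(\<integral>\<^sup>+\<eta>. \<integral>\<^sup>+\<xi>. ennreal (bump \<xi> * bump \<eta> * h r) * indicator {0<..} r \<partial>lborel \<partial>lborel) = \<kappa> * \<kappa> * (ennreal (h r) * indicator {0<..} r)" for r
    proof (cases "0 < r")
      case True
      have "(\<integral>\<^sup>+\<eta>. \<integral>\<^sup>+\<xi>. ennreal (bump \<xi> * bump \<eta> * h r) * indicator {0<..} r \<partial>lborel \<partial>lborel)
         = (\<integral>\<^sup>+\<eta>. \<integral>\<^sup>+\<xi>. ennreal (bump \<xi>) * (ennreal (bump \<eta>) * ennreal (h r)) \<partial>lborel \<partial>lborel)"
        using True h by (simp add: ennreal_mult bump_nonneg mult.assoc)
      also have "\<dots> = (\<integral>\<^sup>+\<eta>. ennreal (bump \<eta>) * (\<kappa> * ennreal (h r)) \<partial>lborel)"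
        unfolding \<kappa>_def by (subst nn_integral_multc) (auto simp: mult_ac)
      also have "\<dots> = \<kappa> * (\<kappa> * ennreal (h r))"
        by (subst nn_integral_multc) (auto simp: \<kappa>_def)
      finally show ?thesis using True by (simp add: mult.assoc)
    qed simp
    then show ?thesis by (simp add: nn_integral_cmult)
  qed
  have W_int: "(\<integral>\<^sup>+p. W p \<partial>?L) = \<kappa> * \<kappa> * ennreal (sqrt 3 / (2 * pi) * (4 / w\<^sup>2))"
  proof -
    have "(\<integral>\<^sup>+p. W p \<partial>?L) = \<kappa> * \<kappa> * (\<integral>\<^sup>+r\<in>{0<..}. ennreal (sqrt 3 / (2 * pi) * (1 / r\<^sup>2 * exp (- (w\<^sup>2 / 4) / r))) \<partial>lborel)"
      by (subst split, measurable) (simp only: W_def fst_conv snd_conv, rule prod, auto)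
    also have "(\<integral>\<^sup>+r\<in>{0<..}. ennreal (sqrt 3 / (2 * pi) * (1 / r\<^sup>2 * exp (- (w\<^sup>2 / 4) / r))) \<partial>lborel)
       = (\<integral>\<^sup>+r. ennreal (sqrt 3 / (2 * pi)) * (ennreal (1 / r\<^sup>2 * exp (- (w\<^sup>2 / 4) / r)) * indicator {0<..} r) \<partial>lborel)"
      by (intro nn_integral_cong) (auto simp: indicator_def ennreal_mult'[symmetric])
    also have "\<dots> = ennreal (sqrt 3 / (2 * pi)) * (\<integral>\<^sup>+r\<in>{0<..}. ennreal (1 / r\<^sup>2 * exp (- (w\<^sup>2 / 4) / r)) \<partial>lborel)"
      by (rule nn_integral_cmult) auto
    also have "\<dots> = ennreal (sqrt 3 / (2 * pi) * (4 / w\<^sup>2))"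
      using w by (subst nn_integral_inverse_square_exp) (auto simp: ennreal_mult'[symmetric])
    finally show ?thesis .
  qed
  have F_le: "F \<epsilon> p \<le> W p" if "0 < \<epsilon>" for \<epsilon> p
  proof (cases "0 < fst p \<and> 0 < fst (snd p)")
    case True
    have "bump (snd (snd p)) * bump (fst (snd p)) * kolmogorov_density (fst p) x y (\<epsilon> * snd (snd p)) (- w - \<epsilon> * fst (snd p))
      \<le> bump (snd (snd p)) * bump (fst (snd p)) * (sqrt 3 / (2 * pi) * (1 / (fst p)\<^sup>2 * exp (- (w\<^sup>2 / 4) / fst p)))"
      using True that y w by (intro mult_left_mono kolmogorov_density_le mult_nonneg_nonneg bump_nonneg) auto
    then show ?thesis unfolding F_def W_def by (intro mult_right_mono ennreal_leI) auto
  next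
    case False
    then have "F \<epsilon> p = 0" by (auto simp: F_def bump_eq_0 not_less)
    then show ?thesis by simp
  qed
  show "0 < \<epsilon> \<Longrightarrow> J \<epsilon> \<le> \<kappa> * \<kappa> * ennreal (sqrt 3 / (2 * pi) * (4 / w\<^sup>2))"
    unfolding W_int[symmetric] by (simp add: J_eq F_le nn_integral_mono)
  have "(\<lambda>n. \<integral>\<^sup>+p. F (1 / real (Suc n)) p \<partial>?L) \<longlonglongrightarrow> (\<integral>\<^sup>+p. F 0 p \<partial>?L)"
  proof (rule nn_integral_dominated_convergence[where w = W])
    have "\<kappa> < \<infinity>" unfolding \<kappa>_def by (rule nn_integral_bump)
    then show "(\<integral>\<^sup>+p. W p \<partial>?L) < \<infinity>" unfolding W_int by (simp add: ennreal_mult_less_top)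
    show "AE p in ?L. (\<lambda>n. F (1 / real (Suc n)) p) \<longlonglongrightarrow> F 0 p"
    proof (rule AE_I2)
      fix p :: "real \<times> real \<times> real"
      show "(\<lambda>n. F (1 / real (Suc n)) p) \<longlonglongrightarrow> F 0 p"
      proof (cases "0 < fst p")
        case True
        have e: "(\<lambda>n. 1 / real (Suc n)) \<longlonglongrightarrow> 0" by (rule LIMSEQ_Suc[OF lim_1_over_n])
        have "(\<lambda>n. ennreal (bump (snd (snd p)) * bump (fst (snd p)) * kolmogorov_density (fst p) x y (1 / real (Suc n) * snd (snd p)) (- w - 1 / real (Suc n) * fst (snd p))))
           \<longlonglongrightarrow> ennreal (bump (snd (snd p)) * bump (fst (snd p)) * kolmogorov_density (fst p) x y (0 * snd (snd p)) (- w - 0 * fst (snd p)))"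
          unfolding kolmogorov_density_eq[OF True] using True by (intro tendsto_intros e) auto
        then show ?thesis using True by (simp add: F_def)
      qed (simp add: F_def)
    qed
  qed (auto intro!: AE_I2 F_le)
  moreover have "(\<integral>\<^sup>+p. F 0 p \<partial>?L) = \<kappa> * \<kappa> * (\<integral>\<^sup>+r\<in>{0<..}. ennreal (kolmogorov_density r x y 0 (- w)) \<partial>lborel)"
    by (subst split, measurable) (simp only: F_def fst_conv snd_conv mult_zero_left diff_zero, rule prod, auto)
  ultimately show "(\<lambda>n. J (1 / real (Suc n))) \<longlonglongrightarrow> \<kappa> * \<kappa> * (\<integral>\<^sup>+r\<in>{0<..}. ennreal (kolmogorov_density r x y 0 (- w)) \<partial>lborel)"
    by (simp add: J_eq)
qed

context started_below
begin

text \<open>The decomposition for mollifiers passes to the limit on both sides; on the hitting event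
  the velocity is nonnegative, so the uniform bound applies under the expectation. The common factor
  \<kappa>^2 is positive and finite and cancels.\<close>

lemma return_identity:
  assumes w: "0 < w"
  shows "(\<integral>\<^sup>+r\<in>{0<..}. ennreal (kolmogorov_density r x 0 0 (- w)) \<partial>lborel) =
    (\<integral>\<^sup>+\<omega>. (\<integral>\<^sup>+r\<in>{0<..}. ennreal (kolmogorov_density r 0 (L_hit \<omega>) 0 (- w)) \<partial>lborel) * indicator {\<omega> \<in> space M. hits \<omega>} \<omega> \<partial>M)"
proof -
  define \<kappa> where "\<kappa> = (\<integral>\<^sup>+u. ennreal (bump u) \<partial>lborel)"
  define J where "J n z = (\<integral>\<^sup>+r\<in>{0<..}. kolmogorov_semigroup r (\<lambda>z. ennreal (mollifier (1 / real (Suc n)) w z)) z \<partial>lborel)" for n z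
  define R where "R z = (\<integral>\<^sup>+r\<in>{0<..}. ennreal (kolmogorov_density r (fst z) (snd z) 0 (- w)) \<partial>lborel)" for z :: "real \<times> real"
  have [measurable]: "mollifier \<epsilon> w \<in> borel_measurable (borel \<Otimes>\<^sub>M borel)" for \<epsilon> unfolding mollifier_def by measurable
  have Jlim: "(\<lambda>n. J n (a, b)) \<longlonglongrightarrow> \<kappa> * \<kappa> * R (a, b)" if "0 \<le> b" for a b
    using mollified_potential(1)[OF w that, of a] by (simp add: J_def R_def \<kappa>_def)
  have Jle: "J n (a, b) \<le> \<kappa> * \<kappa> * ennreal (sqrt 3 / (2 * pi) * (4 / w\<^sup>2))" if "0 \<le> b" for n a b
    using mollified_potential(2)[OF w that, of "1 / real (Suc n)" a] by (simp add: J_def \<kappa>_def)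
  have dec: "J n (x, 0) = (\<integral>\<^sup>+\<omega>. J n (0, L_hit \<omega>) * indicator {\<omega> \<in> space M. hits \<omega>} \<omega> \<partial>M)" for n
    unfolding J_def
  proof (rule potential_decomposition)
    show "continuous_on UNIV (mollifier (1 / real (Suc n)) w)"
      unfolding mollifier_def by (intro continuous_intros continuous_on_compose2[OF bump_continuous]) auto
    show "mollifier (1 / real (Suc n)) w z \<le> (real (Suc n))\<^sup>2" for z
    proof -
      have "bump (fst z / (1 / real (Suc n))) * bump ((- w - snd z) / (1 / real (Suc n))) \<le> 1 * 1"
        by (intro mult_mono bump_le_1 bump_nonneg) auto
      then have "(bump (fst z / (1 / real (Suc n))) * bump ((- w - snd z) / (1 / real (Suc n)))) * (real (Suc n))\<^sup>2 \<le> (1 * 1) * (real (Suc n))\<^sup>2"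
        by (rule mult_right_mono) simp
      then show ?thesis by (simp add: mollifier_def power_divide)
    qed
    show "fst z \<le> 0 \<Longrightarrow> mollifier (1 / real (Suc n)) w z = 0" for z
      by (simp add: mollifier_def bump_eq_0 mult_nonpos_nonneg)
  qed
  have \<kappa>: "\<kappa> \<noteq> 0" "\<kappa> \<noteq> \<top>" using nn_integral_bump by (auto simp: \<kappa>_def)
  have [measurable]: "(\<lambda>\<omega>. J n (0, L_hit \<omega>)) \<in> borel_measurable M" for n
    unfolding J_def by measurable
  have [measurable]: "R \<in> borel_measurable (borel \<Otimes>\<^sub>M borel)"
    unfolding R_def by measurable
  have "(\<lambda>n. \<integral>\<^sup>+\<omega>. J n (0, L_hit \<omega>) * indicator {\<omega> \<in> space M. hits \<omega>} \<omega> \<partial>M) \<longlonglongrightarrow> (\<integral>\<^sup>+\<omega>. \<kappa> * \<kappa> * R (0, L_hit \<omega>) * indicator {\<omega> \<in> space M. hits \<omega>} \<omega> \<partial>M)"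
  proof (rule nn_integral_dominated_convergence[where w = "\<lambda>_. \<kappa> * \<kappa> * ennreal (sqrt 3 / (2 * pi) * (4 / w\<^sup>2))"])
    show "(\<integral>\<^sup>+\<omega>. \<kappa> * \<kappa> * ennreal (sqrt 3 / (2 * pi) * (4 / w\<^sup>2)) \<partial>M) < \<infinity>"
      using \<kappa> by (simp add: emeasure_space_1 ennreal_mult_less_top less_top)
    show "AE \<omega> in M. J n (0, L_hit \<omega>) * indicator {\<omega> \<in> space M. hits \<omega>} \<omega> \<le> \<kappa> * \<kappa> * ennreal (sqrt 3 / (2 * pi) * (4 / w\<^sup>2))" for n
    proof (rule AE_I2)
      fix \<omega> assume \<omega>: "\<omega> \<in> space M"
      show "J n (0, L_hit \<omega>) * indicator {\<omega> \<in> space M. hits \<omega>} \<omega> \<le> \<kappa> * \<kappa> * ennreal (sqrt 3 / (2 * pi) * (4 / w\<^sup>2))"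
      proof (cases "hits \<omega>")
        case True
        have "J n (0, L_hit \<omega>) \<le> \<kappa> * \<kappa> * ennreal (sqrt 3 / (2 * pi) * (4 / w\<^sup>2))"
          by (rule Jle[OF L_hit_nonneg[OF \<omega> True]])
        then show ?thesis using True \<omega> by (simp only: indicator_simps mem_Collect_eq mult_1_right simp_thms)
      qed simp
    qed
    show "AE \<omega> in M. (\<lambda>n. J n (0, L_hit \<omega>) * indicator {\<omega> \<in> space M. hits \<omega>} \<omega>) \<longlonglongrightarrow> \<kappa> * \<kappa> * R (0, L_hit \<omega>) * indicator {\<omega> \<in> space M. hits \<omega>} \<omega>"
      by (rule AE_I2) (auto simp: indicator_def intro!: Jlim L_hit_nonneg)
  qed measurable
  moreover have "(\<lambda>n. \<integral>\<^sup>+\<omega>. J n (0, L_hit \<omega>) * indicator {\<omega> \<in> space M. hits \<omega>} \<omega> \<partial>M) \<longlonglongrightarrow> \<kappa> * \<kappa> * R (x, 0)"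
    using Jlim[of 0 x] by (simp add: dec)
  ultimately have "\<kappa> * \<kappa> * R (x, 0) = (\<integral>\<^sup>+\<omega>. \<kappa> * \<kappa> * R (0, L_hit \<omega>) * indicator {\<omega> \<in> space M. hits \<omega>} \<omega> \<partial>M)"
    by (rule LIMSEQ_unique[rotated])
  also have "\<dots> = \<kappa> * \<kappa> * (\<integral>\<^sup>+\<omega>. R (0, L_hit \<omega>) * indicator {\<omega> \<in> space M. hits \<omega>} \<omega> \<partial>M)"
    by (subst nn_integral_cmult[symmetric]) (auto simp: mult.assoc)
  finally have "R (x, 0) = (\<integral>\<^sup>+\<omega>. R (0, L_hit \<omega>) * indicator {\<omega> \<in> space M. hits \<omega>} \<omega> \<partial>M)"
    using \<kappa> by (simp add: ennreal_mult_cancel_left ennreal_mult_eq_top_iff)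
  then show ?thesis by (simp add: R_def)
qed

end

section \<open>Gamma and Beta moments\<close>

lemma Gamma_reflection_real:
  fixes a :: real
  shows "Gamma a * Gamma (1 - a) = pi / sin (pi * a)"
proof -
  have "complex_of_real (Gamma a * Gamma (1 - a)) = Gamma (complex_of_real a) * Gamma (1 - complex_of_real a)"
    using Gamma_complex_of_real[of a] Gamma_complex_of_real[of "1 - a"] by simp
  also have "\<dots> = of_real pi / sin (of_real pi * of_real a)" by (rule Gamma_reflection_complex)
  also have "\<dots> = complex_of_real (pi / sin (pi * a))" by (simp add: sin_of_real[symmetric])
  finally have "complex_of_real (Gamma a * Gamma (1 - a)) = complex_of_real (pi / sin (pi * a))" .
  then show ?thesis by (simp only: of_real_eq_iff)
qed

text \<open>With a = s/3 the Gamma functions combine in pairs by reflection until only three sines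
  and \<open>Gamma (1 - a)\<close> depend on a. What is left is a sum-to-product formula, and its
  midpoint a + 1/6 is the source of the parameters 5/6 and 1/6.\<close>

lemma Mellin_transforms_agree:
  fixes a :: real
  assumes a: "0 < a" "a < 2 / 3"
  shows "Gamma (a + 1 / 3) * (Gamma a * Gamma (2 / 3 - a) / Gamma (2 / 3)) =
    (Gamma a * Gamma (1 - a) + Gamma (a + 1 / 3) * Gamma (2 / 3 - a)) *
    (Gamma (a + 1 / 6) / Gamma (5 / 6) * (Gamma (1 / 3) / (Gamma (1 / 6) * Gamma (1 / 6)) * (Gamma (5 / 6 - a) * Gamma (1 / 6) / Gamma (1 - a))))"
proof -
  define S0 S1 S2 where "S0 = sin (pi * a)" and "S1 = sin (pi * (a + 1 / 3))" and "S2 = sin (pi * (a + 1 / 6))"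
  have S: "0 < S0" "0 < S1" "0 < S2"
  proof -
    have "0 < sin (pi * b)" if "0 < b" "b < 1" for b using that by (intro sin_gt_zero) auto
    then show "0 < S0" "0 < S1" "0 < S2" unfolding S0_def S1_def S2_def using a by auto
  qed
  have r0: "Gamma a * Gamma (1 - a) = pi / S0" unfolding S0_def by (rule Gamma_reflection_real)
  have r1: "Gamma (a + 1 / 3) * Gamma (2 / 3 - a) = pi / S1"
    unfolding S1_def using Gamma_reflection_real[of "a + 1 / 3"] by simp
  have r2: "Gamma (a + 1 / 6) * Gamma (5 / 6 - a) = pi / S2"
    unfolding S2_def using Gamma_reflection_real[of "a + 1 / 6"] by simp
  have r3: "Gamma (1 / 3) * Gamma (2 / 3) = 2 * pi / sqrt 3"
    using Gamma_reflection_real[of "1 / 3"] by (simp add: sin_60)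
  have r4: "Gamma (1 / 6) * Gamma (5 / 6) = 2 * pi"
    using Gamma_reflection_real[of "1 / 6"] by (simp add: sin_30)
  \<comment> \<open>S0 and S1 are sines of the angle of S2 shifted by -pi/6 and pi/6, so the sum is
    2 cos (pi/6) S2.\<close>
  have sum: "S0 + S1 = sqrt 3 * S2"
  proof -
    have "S0 = sin (pi * (a + 1 / 6) - pi / 6)" "S1 = sin (pi * (a + 1 / 6) + pi / 6)"
      by (simp_all add: S0_def S1_def algebra_simps)
    then show ?thesis by (simp add: sin_add sin_diff cos_30 S2_def)
  qed
  have G: "0 < Gamma a" "0 < Gamma (1 - a)" "0 < Gamma (1 / 3 :: real)" "0 < Gamma (2 / 3 :: real)" "0 < Gamma (1 / 6 :: real)" "0 < Gamma (5 / 6 :: real)"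
    using a by (auto intro!: Gamma_real_pos)
  have "Gamma (a + 1 / 3) * (Gamma a * Gamma (2 / 3 - a) / Gamma (2 / 3)) = (Gamma (a + 1 / 3) * Gamma (2 / 3 - a)) * Gamma a / Gamma (2 / 3)"
    by simp
  also have "\<dots> = pi / S1 * Gamma a / Gamma (2 / 3)" unfolding r1 ..
  also have "\<dots> = (pi / S0 + pi / S1) * ((pi / S2) * Gamma (1 / 3) / (2 * pi * Gamma (1 - a)))"
  proof -
    have A: "Gamma a = pi / (S0 * Gamma (1 - a))" using r0 G S by (simp add: nonzero_eq_divide_eq mult_ac)
    have T: "Gamma (2 / 3) = 2 * pi / (sqrt 3 * Gamma (1 / 3))"
    proof -
      have "Gamma (2 / 3) = Gamma (1 / 3) * Gamma (2 / 3) / Gamma (1 / 3 :: real)" using less_imp_neq[OF G(3)] by simp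
      then show ?thesis unfolding r3 by simp
    qed
    have "pi / S0 + pi / S1 = pi * (S0 + S1) / (S0 * S1)" using S by (simp add: add_divide_eq_iff divide_add_eq_iff algebra_simps)
    then have "(pi / S0 + pi / S1) * ((pi / S2) * Gamma (1 / 3) / (2 * pi * Gamma (1 - a))) = pi * sqrt 3 * Gamma (1 / 3) / (2 * S0 * S1 * Gamma (1 - a))"
      using S by (simp add: sum)
    also have "\<dots> = pi / S1 * Gamma a / Gamma (2 / 3)"
      unfolding A T by (simp add: mult_ac)
    finally show ?thesis ..
  qed
  also have "\<dots> = (Gamma a * Gamma (1 - a) + Gamma (a + 1 / 3) * Gamma (2 / 3 - a)) *
    ((Gamma (a + 1 / 6) * Gamma (5 / 6 - a)) * Gamma (1 / 3) / ((Gamma (1 / 6) * Gamma (5 / 6)) * Gamma (1 - a)))"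
    unfolding r0 r1 r2 r4 ..
  also have "\<dots> = (Gamma a * Gamma (1 - a) + Gamma (a + 1 / 3) * Gamma (2 / 3 - a)) *
    (Gamma (a + 1 / 6) / Gamma (5 / 6) * (Gamma (1 / 3) / (Gamma (1 / 6) * Gamma (1 / 6)) * (Gamma (5 / 6 - a) * Gamma (1 / 6) / Gamma (1 - a))))"
    using less_imp_neq[OF G(5)] by (simp add: mult_ac)
  finally show ?thesis .
qed

section \<open>Fractional moments of the Gamma and Beta variables and of their quotient\<close>

lemma nn_integral_gamma_powr:
  assumes G: "distributed N lborel G (\<lambda>u. ennreal (gamma_density c u))" and c: "0 < c" "0 < c + e"
  shows "(\<integral>\<^sup>+\<omega>. ennreal (G \<omega> powr e) \<partial>N) = ennreal (Gamma (c + e) / Gamma c)"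
proof -
  have "(\<integral>\<^sup>+\<omega>. ennreal (G \<omega> powr e) \<partial>N) = (\<integral>\<^sup>+u. ennreal (gamma_density c u) * ennreal (u powr e) \<partial>lborel)"
    by (rule distributed_nn_integral[OF G, symmetric]) auto
  also have "\<dots> = (\<integral>\<^sup>+u. ennreal (1 / Gamma c) * (ennreal (u powr (c + e - 1) * exp (- 1 * u)) * indicator {0<..} u) \<partial>lborel)"
  proof (rule nn_integral_cong)
    fix u :: real
    have "u powr (c - 1) * u powr e = u powr (c + e - 1)" by (simp add: powr_add[symmetric] algebra_simps)
    moreover have "0 < Gamma c" by (rule Gamma_real_pos[OF c(1)])
    ultimately show "ennreal (gamma_density c u) * ennreal (u powr e) = ennreal (1 / Gamma c) * (ennreal (u powr (c + e - 1) * exp (- 1 * u)) * indicator {0<..} u)"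
      by (auto simp: gamma_density_def indicator_def ennreal_mult'[symmetric] mult_ac)
  qed
  also have "\<dots> = ennreal (1 / Gamma c) * (\<integral>\<^sup>+u\<in>{0<..}. ennreal (u powr (c + e - 1) * exp (- 1 * u)) \<partial>lborel)"
    by (rule nn_integral_cmult) auto
  also have "\<dots> = ennreal (Gamma (c + e) / Gamma c)"
    using c Gamma_real_pos[of c] by (subst nn_integral_Gamma_scaled) (auto simp: ennreal_mult'[symmetric])
  finally show ?thesis .
qed

text \<open>The density lives on the open interval, the Beta integral on the closed one; the
  integrands agree even at the end points because \<open>powr\<close> with base 0 is 0.\<close>

lemma nn_integral_beta_powr:
  assumes Z: "distributed N lborel Z (\<lambda>u. ennreal (beta_density a b u))" and ab: "0 < a" "0 < b" "0 < a + e"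
  shows "(\<integral>\<^sup>+\<omega>. ennreal (Z \<omega> powr e) \<partial>N) = ennreal (Gamma (a + b) / (Gamma a * Gamma b) * (Gamma (a + e) * Gamma b / Gamma (a + e + b)))"
proof -
  have "(\<integral>\<^sup>+\<omega>. ennreal (Z \<omega> powr e) \<partial>N) = (\<integral>\<^sup>+u. ennreal (beta_density a b u) * ennreal (u powr e) \<partial>lborel)"
    by (rule distributed_nn_integral[OF Z, symmetric]) auto
  also have "\<dots> = (\<integral>\<^sup>+u. ennreal (Gamma (a + b) / (Gamma a * Gamma b)) * (ennreal (u powr (a + e - 1) * (1 - u) powr (b - 1)) * indicator {0..1} u) \<partial>lborel)"
  proof (rule nn_integral_cong)
    fix u :: real
    define R where "R = Gamma (a + b) / (Gamma a * Gamma b)"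
    have R: "0 < R" unfolding R_def using ab by (auto intro!: Gamma_real_pos divide_pos_pos mult_pos_pos)
    have "u powr (a + e - 1) = u powr (a - 1) * u powr e" by (simp add: powr_add[symmetric] algebra_simps)
    then have "beta_density a b u * u powr e = R * (u powr (a + e - 1) * (1 - u) powr (b - 1))" if "0 < u" "u < 1"
      using that by (simp add: beta_density_def R_def[symmetric] mult_ac)
    then have "ennreal (beta_density a b u) * ennreal (u powr e) = ennreal R * ennreal (u powr (a + e - 1) * (1 - u) powr (b - 1))" if "0 < u" "u < 1"
      using that R by (simp only: ennreal_mult''[symmetric] powr_ge_zero mult_nonneg_nonneg)
    then show "ennreal (beta_density a b u) * ennreal (u powr e) = ennreal (Gamma (a + b) / (Gamma a * Gamma b)) * (ennreal (u powr (a + e - 1) * (1 - u) powr (b - 1)) * indicator {0..1} u)"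
      unfolding R_def[symmetric]
      by (cases "0 < u \<and> u < 1"; cases "u = 0 \<or> u = 1") (auto simp: beta_density_def indicator_def)
  qed
  also have "\<dots> = ennreal (Gamma (a + b) / (Gamma a * Gamma b)) * (\<integral>\<^sup>+u\<in>{0..1}. ennreal (u powr (a + e - 1) * (1 - u) powr (b - 1)) \<partial>lborel)"
    by (rule nn_integral_cmult) auto
  also have "(\<integral>\<^sup>+u\<in>{0..1}. ennreal (u powr (a + e - 1) * (1 - u) powr (b - 1)) \<partial>lborel) = ennreal (Beta (a + e) b)"
    using ab by (intro nn_integral_has_integral_lebesgue' has_integral_Beta_real) auto
  finally show ?thesis
    using ab by (simp add: Beta_def ennreal_mult'[symmetric] Gamma_real_pos less_imp_le)
qed

lemma (in prob_space) nn_integral_indep_mult: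
  fixes f g :: "real \<Rightarrow> ennreal"
  assumes ind: "indep_var borel G borel Z" and [measurable]: "f \<in> borel_measurable borel" "g \<in> borel_measurable borel"
  shows "(\<integral>\<^sup>+\<omega>. f (G \<omega>) * g (Z \<omega>) \<partial>M) = (\<integral>\<^sup>+\<omega>. f (G \<omega>) \<partial>M) * (\<integral>\<^sup>+\<omega>. g (Z \<omega>) \<partial>M)"
proof -
  have [measurable]: "G \<in> borel_measurable M" "Z \<in> borel_measurable M"
    using indep_var_rv1[OF ind] indep_var_rv2[OF ind] by auto
  interpret Z: prob_space "distr M borel Z" by (rule prob_space_distr) measurable
  have "(\<integral>\<^sup>+\<omega>. f (G \<omega>) * g (Z \<omega>) \<partial>M) = (\<integral>\<^sup>+p. f (fst p) * g (snd p) \<partial>distr M (borel \<Otimes>\<^sub>M borel) (\<lambda>\<omega>. (G \<omega>, Z \<omega>)))"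
    by (subst nn_integral_distr) auto
  also have "\<dots> = (\<integral>\<^sup>+p. f (fst p) * g (snd p) \<partial>(distr M borel G \<Otimes>\<^sub>M distr M borel Z))"
    using ind unfolding indep_var_distribution_eq by simp
  also have "\<dots> = (\<integral>\<^sup>+a. \<integral>\<^sup>+b. f a * g b \<partial>distr M borel Z \<partial>distr M borel G)"
    by (subst Z.nn_integral_fst[symmetric]) auto
  also have "\<dots> = (\<integral>\<^sup>+a. f a \<partial>distr M borel G) * (\<integral>\<^sup>+b. g b \<partial>distr M borel Z)"
    by (simp add: nn_integral_cmult nn_integral_multc)
  also have "\<dots> = (\<integral>\<^sup>+\<omega>. f (G \<omega>) \<partial>M) * (\<integral>\<^sup>+\<omega>. g (Z \<omega>) \<partial>M)"
    by (simp add: nn_integral_distr)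
  finally show ?thesis .
qed

text \<open>By independence the moment of order t splits into a Gamma moment of order t/3 and a Beta
  moment of order -t/3. On the given range 5/6 + t/3 and 1/6 - t/3 are positive, so both are
  finite.\<close>

lemma Mellin_gamma_beta_quotient:
  fixes G Z :: "'b \<Rightarrow> real" and c t :: real
  assumes prob: "prob_space N"
    and G: "distributed N lborel G (\<lambda>u. ennreal (gamma_density (5/6) u))"
    and Z: "distributed N lborel Z (\<lambda>u. ennreal (beta_density (1/6) (1/6) u))"
    and ind: "prob_space.indep_var N borel G borel Z"
    and c: "0 < c" and t: "- 2 < t" "t < 0"
  shows "AE \<omega> in N. 0 < c powr (1/3) * (G \<omega> / Z \<omega>) powr (1/3)"
    and "(\<integral>\<^sup>+\<omega>. ennreal ((c powr (1/3) * (G \<omega> / Z \<omega>) powr (1/3)) powr t) \<partial>N) =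
    ennreal (c powr (t / 3) * (Gamma (5/6 + t / 3) / Gamma (5/6) * (Gamma (1 / 3) / (Gamma (1 / 6) * Gamma (1 / 6)) * (Gamma (1/6 - t / 3) * Gamma (1 / 6) / Gamma (1/3 - t / 3)))))"
proof -
  interpret prob_space N by fact
  have G_pos: "AE \<omega> in N. 0 < G \<omega>"
    by (subst distributed_AE2[OF G]) (auto simp: gamma_density_def)
  have Z_pos: "AE \<omega> in N. 0 < Z \<omega>"
    by (subst distributed_AE2[OF Z]) (auto simp: beta_density_def)
  show "AE \<omega> in N. 0 < c powr (1/3) * (G \<omega> / Z \<omega>) powr (1/3)"
    using G_pos Z_pos by eventually_elim (use c in auto)
  have [measurable]: "G \<in> borel_measurable N" "Z \<in> borel_measurable N"
    using distributed_measurable[OF G] distributed_measurable[OF Z] by auto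
  have "(\<integral>\<^sup>+\<omega>. ennreal ((c powr (1/3) * (G \<omega> / Z \<omega>) powr (1/3)) powr t) \<partial>N) = (\<integral>\<^sup>+\<omega>. ennreal (c powr (t / 3)) * (ennreal (G \<omega> powr (t / 3)) * ennreal (Z \<omega> powr (- t / 3))) \<partial>N)"
  proof (rule nn_integral_cong_AE)
    show "AE \<omega> in N. ennreal ((c powr (1/3) * (G \<omega> / Z \<omega>) powr (1/3)) powr t) = ennreal (c powr (t / 3)) * (ennreal (G \<omega> powr (t / 3)) * ennreal (Z \<omega> powr (- t / 3)))"
      using G_pos Z_pos
    proof eventually_elim
      fix \<omega> assume "0 < G \<omega>" "0 < Z \<omega>"
      then have "(c powr (1/3) * (G \<omega> / Z \<omega>) powr (1/3)) powr t = c powr (t / 3) * (G \<omega> powr (t / 3) * Z \<omega> powr (- t / 3))"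
        using c by (subst ln_inj_iff[symmetric]) (simp_all add: ln_mult ln_div ln_powr, simp_all add: field_simps)
      then show "ennreal ((c powr (1/3) * (G \<omega> / Z \<omega>) powr (1/3)) powr t) = ennreal (c powr (t / 3)) * (ennreal (G \<omega> powr (t / 3)) * ennreal (Z \<omega> powr (- t / 3)))"
        by (simp add: ennreal_mult)
    qed
  qed
  also have "\<dots> = ennreal (c powr (t / 3)) * (\<integral>\<^sup>+\<omega>. ennreal (G \<omega> powr (t / 3)) * ennreal (Z \<omega> powr (- t / 3)) \<partial>N)"
    by (rule nn_integral_cmult) measurable
  also have "(\<integral>\<^sup>+\<omega>. ennreal (G \<omega> powr (t / 3)) * ennreal (Z \<omega> powr (- t / 3)) \<partial>N) = (\<integral>\<^sup>+\<omega>. ennreal (G \<omega> powr (t / 3)) \<partial>N) * (\<integral>\<^sup>+\<omega>. ennreal (Z \<omega> powr (- t / 3)) \<partial>N)"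
    by (rule nn_integral_indep_mult[OF ind]) auto
  also have "(\<integral>\<^sup>+\<omega>. ennreal (G \<omega> powr (t / 3)) \<partial>N) = ennreal (Gamma (5/6 + t / 3) / Gamma (5/6))"
    using t by (intro nn_integral_gamma_powr[OF G]) auto
  also have "(\<integral>\<^sup>+\<omega>. ennreal (Z \<omega> powr (- t / 3)) \<partial>N) = ennreal (Gamma (1/6 + 1/6) / (Gamma (1/6) * Gamma (1/6)) * (Gamma (1/6 + - t / 3) * Gamma (1/6) / Gamma (1/6 + - t / 3 + 1/6)))"
    using t by (intro nn_integral_beta_powr[OF Z]) auto
  also have "1 / 6 + - t / 3 + 1 / 6 = 1 / 3 - t / 3" by simp
  also have "1 / 6 + - t / 3 = 1 / 6 - t / 3" by simp
  also have "(1 / 6 + 1 / 6 :: real) = 1 / 3" by simp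
  also have "ennreal (c powr (t / 3)) * (ennreal (Gamma (5/6 + t / 3) / Gamma (5/6)) * ennreal (Gamma (1 / 3) / (Gamma (1 / 6) * Gamma (1 / 6)) * (Gamma (1/6 - t / 3) * Gamma (1 / 6) / Gamma (1/3 - t / 3))))
    = ennreal (c powr (t / 3) * (Gamma (5/6 + t / 3) / Gamma (5/6) * (Gamma (1 / 3) / (Gamma (1 / 6) * Gamma (1 / 6)) * (Gamma (1/6 - t / 3) * Gamma (1 / 6) / Gamma (1/3 - t / 3)))))"
  proof -
    have "0 < Gamma (5/6 + t / 3) / Gamma (5/6)" using t by (intro divide_pos_pos Gamma_real_pos) auto
    then show ?thesis by (simp only: ennreal_mult' powr_ge_zero less_imp_le)
  qed
  finally show "(\<integral>\<^sup>+\<omega>. ennreal ((c powr (1/3) * (G \<omega> / Z \<omega>) powr (1/3)) powr t) \<partial>N) =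
    ennreal (c powr (t / 3) * (Gamma (5/6 + t / 3) / Gamma (5/6) * (Gamma (1 / 3) / (Gamma (1 / 6) * Gamma (1 / 6)) * (Gamma (1/6 - t / 3) * Gamma (1 / 6) / Gamma (1/3 - t / 3)))))" .
qed

section \<open>The law at the hitting time\<close>

context started_below
begin

text \<open>Both sides of the return identity carry the factor sqrt 3 / (2 pi), which is cancelled
  after integration against w^(s-1). The kernel is not yet evaluated, because that requires a
  strictly positive velocity.\<close>

lemma Mellin_hitting:
  assumes s: "0 < s" "s < 2"
  shows "(\<integral>\<^sup>+\<omega>. (\<integral>\<^sup>+w\<in>{0<..}. ennreal (w powr (s - 1) / ((L_hit \<omega>)\<^sup>2 - L_hit \<omega> * w + w\<^sup>2)) \<partial>lborel) * indicator {\<omega> \<in> space M. hits \<omega>} \<omega> \<partial>M)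
    = ennreal (Gamma ((s + 1) / 3) / 3 * (9 * \<bar>x\<bar>) powr ((s - 2) / 3) * (Gamma (s / 3) * Gamma ((2 - s) / 3) / Gamma (2 / 3)))"
    (is "?lhs = ennreal ?A")
proof -
  define c where "c = sqrt 3 / (2 * pi)"
  have c: "0 < c" by (simp add: c_def)
  interpret P: pair_sigma_finite lborel M by unfold_locales
  let ?k = "\<lambda>w \<omega>. ennreal (w powr (s - 1) / ((L_hit \<omega>)\<^sup>2 - L_hit \<omega> * w + w\<^sup>2))"
  let ?I = "indicator {\<omega> \<in> space M. hits \<omega>} :: 'a \<Rightarrow> ennreal"
  have "ennreal (c * ?A) = (\<integral>\<^sup>+w\<in>{0<..}. ennreal (w powr (s - 1)) * (\<integral>\<^sup>+r\<in>{0<..}. ennreal (kolmogorov_density r x 0 0 (- w)) \<partial>lborel) \<partial>lborel)"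
    unfolding c_def by (rule Mellin_kolmogorov_start[OF s start_neg, symmetric])
  also have "\<dots> = (\<integral>\<^sup>+w. \<integral>\<^sup>+\<omega>. ennreal c * (?k w \<omega> * indicator {0<..} w * ?I \<omega>) \<partial>M \<partial>lborel)"
  proof (rule nn_integral_cong)
    fix w :: real
    show "ennreal (w powr (s - 1)) * (\<integral>\<^sup>+r\<in>{0<..}. ennreal (kolmogorov_density r x 0 0 (- w)) \<partial>lborel) * indicator {0<..} w = (\<integral>\<^sup>+\<omega>. ennreal c * (?k w \<omega> * indicator {0<..} w * ?I \<omega>) \<partial>M)"
    proof (cases "0 < w")
      case w: True
      have "ennreal (w powr (s - 1)) * (\<integral>\<^sup>+r\<in>{0<..}. ennreal (kolmogorov_density r x 0 0 (- w)) \<partial>lborel)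
         = ennreal (w powr (s - 1)) * (\<integral>\<^sup>+\<omega>. ennreal (c * (1 / ((L_hit \<omega>)\<^sup>2 - L_hit \<omega> * w + w\<^sup>2))) * ?I \<omega> \<partial>M)"
        unfolding return_identity[OF w] c_def
      proof (rule arg_cong2[where f = "(*)", OF refl], rule nn_integral_cong)
        fix \<omega>
        show "(\<integral>\<^sup>+r\<in>{0<..}. ennreal (kolmogorov_density r 0 (L_hit \<omega>) 0 (- w)) \<partial>lborel) * ?I \<omega>
          = ennreal (sqrt 3 / (2 * pi) * (1 / ((L_hit \<omega>)\<^sup>2 - L_hit \<omega> * w + w\<^sup>2))) * ?I \<omega>"
        proof (cases "\<omega> \<in> space M \<and> hits \<omega>")
          case True
          then show ?thesis by (simp only: nn_integral_kolmogorov_return[OF L_hit_nonneg w])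
        qed auto
      qed
      also have "\<dots> = (\<integral>\<^sup>+\<omega>. ennreal (w powr (s - 1)) * (ennreal (c * (1 / ((L_hit \<omega>)\<^sup>2 - L_hit \<omega> * w + w\<^sup>2))) * ?I \<omega>) \<partial>M)"
        by (rule nn_integral_cmult[symmetric]) measurable
      also have "\<dots> = (\<integral>\<^sup>+\<omega>. ennreal c * (?k w \<omega> * indicator {0<..} w * ?I \<omega>) \<partial>M)"
      proof (rule nn_integral_cong)
        fix \<omega>
        have "ennreal (w powr (s - 1)) * ennreal (c * (1 / ((L_hit \<omega>)\<^sup>2 - L_hit \<omega> * w + w\<^sup>2))) = ennreal (w powr (s - 1) * (c * (1 / ((L_hit \<omega>)\<^sup>2 - L_hit \<omega> * w + w\<^sup>2))))"
          by (rule ennreal_mult'[symmetric]) simp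
        also have "\<dots> = ennreal (c * (w powr (s - 1) / ((L_hit \<omega>)\<^sup>2 - L_hit \<omega> * w + w\<^sup>2)))"
          by (simp add: mult_ac)
        also have "\<dots> = ennreal c * ?k w \<omega>" using c by (intro ennreal_mult') simp
        finally show "ennreal (w powr (s - 1)) * (ennreal (c * (1 / ((L_hit \<omega>)\<^sup>2 - L_hit \<omega> * w + w\<^sup>2))) * ?I \<omega>) = ennreal c * (?k w \<omega> * indicator {0<..} w * ?I \<omega>)"
          using w by (simp only: mult.assoc[symmetric] indicator_simps greaterThan_iff mult_1_right)
      qed
      finally show ?thesis using w by simp
    qed simp
  qed
  also have "\<dots> = (\<integral>\<^sup>+\<omega>. \<integral>\<^sup>+w. ennreal c * (?k w \<omega> * indicator {0<..} w * ?I \<omega>) \<partial>lborel \<partial>M)"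
    by (rule P.Fubini'[symmetric]) measurable
  also have "\<dots> = (\<integral>\<^sup>+\<omega>. ennreal c * ((\<integral>\<^sup>+w\<in>{0<..}. ?k w \<omega> \<partial>lborel) * ?I \<omega>) \<partial>M)"
    by (intro nn_integral_cong) (subst nn_integral_cmult, measurable, subst nn_integral_multc, auto)
  also have "\<dots> = ennreal c * ?lhs"
    by (rule nn_integral_cmult) measurable
  finally have *: "ennreal (c * ?A) = ennreal c * ?lhs" .
  have "ennreal c * ennreal ?A = ennreal c * ?lhs"
    unfolding *[symmetric] using c by (intro ennreal_mult'[symmetric]) simp
  then show ?thesis using c by (auto simp: ennreal_mult_cancel_left)
qed

text \<open>Scaling by 2 multiplies the integral by 2^(p+1) < 1, so a finite value would have to be
  0, although the integrand is positive on the half line.\<close>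

lemma nn_integral_powr_halfline_infinite:
  fixes p :: real
  assumes "p < - 1"
  shows "(\<integral>\<^sup>+w\<in>{0<..}. ennreal (w powr p) \<partial>lborel) = \<infinity>"
proof (rule ccontr)
  let ?I = "\<integral>\<^sup>+w\<in>{0<..}. ennreal (w powr p) \<partial>lborel"
  assume "?I \<noteq> \<infinity>"
  then obtain v where v: "?I = ennreal v" "0 \<le> v" by (cases ?I) auto
  have "?I = (\<integral>\<^sup>+w\<in>{0<..}. ennreal ((2 * w) powr p * 2) \<partial>lborel)"
    by (rule nn_integral_halfline_scale) auto
  also have "\<dots> = (\<integral>\<^sup>+w. ennreal (2 powr (p + 1)) * (ennreal (w powr p) * indicator {0<..} w) \<partial>lborel)"
    by (intro nn_integral_cong) (auto simp: indicator_def ennreal_mult'[symmetric] powr_mult powr_add)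
  also have "\<dots> = ennreal (2 powr (p + 1)) * ?I" by (rule nn_integral_cmult) auto
  finally have "ennreal v = ennreal (2 powr (p + 1) * v)" using v by (simp add: ennreal_mult')
  then have "v = 2 powr (p + 1) * v" using v by (subst (asm) ennreal_inj) auto
  moreover have "2 powr (p + 1) < (1 :: real)" using assms by (simp add: powr_less_one)
  ultimately have "v = 0" using assms by simp
  then have "?I = 0" using v by simp
  then have "AE w in lborel. ennreal (w powr p) * indicator {0<..} w = 0" by (subst (asm) nn_integral_0_iff_AE) auto
  then have "AE w in lborel. w \<notin> {1..2::real}"
    by eventually_elim (auto simp: indicator_def split: if_splits)
  then have "emeasure lborel {1..2::real} = 0" by (subst (asm) AE_iff_measurable[where N = "{1..2}"]) auto
  then show False by simp
qed

text \<open>For s = 1 and velocity 0 the kernel is w^(-2), whose integral diverges; the finite total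
  leaves room for this only on a null set.\<close>

lemma L_hit_pos: "AE \<omega> in M. hits \<omega> \<longrightarrow> 0 < L_hit \<omega>"
proof -
  let ?h = "\<lambda>\<omega>. (\<integral>\<^sup>+w\<in>{0<..}. ennreal (w powr (1 - 1) / ((L_hit \<omega>)\<^sup>2 - L_hit \<omega> * w + w\<^sup>2)) \<partial>lborel) * indicator {\<omega> \<in> space M. hits \<omega>} \<omega>"
  have "(\<integral>\<^sup>+\<omega>. ?h \<omega> \<partial>M) \<noteq> \<infinity>" by (subst Mellin_hitting) auto
  then have "AE \<omega> in M. ?h \<omega> \<noteq> \<infinity>" by (intro nn_integral_noteq_infinite) measurable
  moreover have "AE \<omega> in M. \<omega> \<in> space M" by (rule AE_space)
  ultimately show ?thesis
  proof eventually_elim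
    fix \<omega> assume fin: "?h \<omega> \<noteq> \<infinity>" and \<omega>: "\<omega> \<in> space M"
    have "L_hit \<omega> \<noteq> 0" if "hits \<omega>"
    proof
      assume 0: "L_hit \<omega> = 0"
      have "(\<integral>\<^sup>+w\<in>{0<..}. ennreal (w powr (1 - 1) / ((L_hit \<omega>)\<^sup>2 - L_hit \<omega> * w + w\<^sup>2)) \<partial>lborel) = (\<integral>\<^sup>+w\<in>{0<..}. ennreal (w powr (- 2)) \<partial>lborel)"
        by (intro set_nn_integral_cong refl) (auto simp: 0 powr_minus_divide)
      also have "\<dots> = \<infinity>" by (rule nn_integral_powr_halfline_infinite) simp
      finally show False using fin that \<omega> by simp
    qed
    then show "hits \<omega> \<longrightarrow> 0 < L_hit \<omega>" using L_hit_nonneg[OF \<omega>] by force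
  qed
qed

text \<open>For positive velocity the kernel integral is homogeneous of degree s - 2 = t, so the
  expectation computed above is the moment of order t times D / 3. Dividing by this positive
  constant gives the claim through the Gamma function identity at a = s/3.\<close>

lemma Mellin_L_hit:
  assumes t: "- 2 < t" "t < 0"
  shows "(\<integral>\<^sup>+\<omega>. ennreal (L_hit \<omega> powr t) * indicator {\<omega> \<in> space M. hits \<omega>} \<omega> \<partial>M) =
    ennreal ((9 * \<bar>x\<bar>) powr (t / 3) * (Gamma (5/6 + t / 3) / Gamma (5/6) * (Gamma (1 / 3) / (Gamma (1 / 6) * Gamma (1 / 6)) * (Gamma (1/6 - t / 3) * Gamma (1 / 6) / Gamma (1/3 - t / 3)))))"
proof -
  define a where "a = (t + 2) / 3"
  define s where "s = t + 2"
  have s: "0 < s" "s < 2" and a: "0 < a" "a < 2 / 3" using t by (auto simp: s_def a_def)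
  define D where "D = Gamma a * Gamma (1 - a) + Gamma (a + 1 / 3) * Gamma (2 / 3 - a)"
  define C where "C = Gamma (5/6 + t / 3) / Gamma (5/6) * (Gamma (1 / 3) / (Gamma (1 / 6) * Gamma (1 / 6)) * (Gamma (1/6 - t / 3) * Gamma (1 / 6) / Gamma (1/3 - t / 3)))"
  let ?E = "\<integral>\<^sup>+\<omega>. ennreal (L_hit \<omega> powr t) * indicator {\<omega> \<in> space M. hits \<omega>} \<omega> \<partial>M"
  have D: "0 < D" unfolding D_def using a by (intro add_pos_pos mult_pos_pos Gamma_real_pos) auto
  have C: "0 \<le> C" unfolding C_def using t by (intro mult_nonneg_nonneg divide_nonneg_nonneg less_imp_le[OF Gamma_real_pos]) auto
  have e: "s / 3 = a" "(s + 1) / 3 = a + 1 / 3" "(2 - s) / 3 = 2 / 3 - a" "(s - 2) / 3 = t / 3" "s - 2 = t" "1 - (a + 1 / 3) = 2 / 3 - a"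
    by (simp_all add: s_def a_def field_simps)
  have e2: "5 / 6 + t / 3 = a + 1 / 6" "1 / 6 - t / 3 = 5 / 6 - a" "1 / 3 - t / 3 = 1 - a"
    by (simp_all add: a_def field_simps)
  have "ennreal (Gamma (a + 1 / 3) / 3 * (9 * \<bar>x\<bar>) powr (t / 3) * (Gamma a * Gamma (2 / 3 - a) / Gamma (2 / 3)))
    = (\<integral>\<^sup>+\<omega>. (\<integral>\<^sup>+w\<in>{0<..}. ennreal (w powr (s - 1) / ((L_hit \<omega>)\<^sup>2 - L_hit \<omega> * w + w\<^sup>2)) \<partial>lborel) * indicator {\<omega> \<in> space M. hits \<omega>} \<omega> \<partial>M)"
    using Mellin_hitting[OF s] unfolding e by simp
  also have "\<dots> = (\<integral>\<^sup>+\<omega>. ennreal (D / 3) * (ennreal (L_hit \<omega> powr t) * indicator {\<omega> \<in> space M. hits \<omega>} \<omega>) \<partial>M)"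
  proof (rule nn_integral_cong_AE)
    show "AE \<omega> in M. (\<integral>\<^sup>+w\<in>{0<..}. ennreal (w powr (s - 1) / ((L_hit \<omega>)\<^sup>2 - L_hit \<omega> * w + w\<^sup>2)) \<partial>lborel) * indicator {\<omega> \<in> space M. hits \<omega>} \<omega>
      = ennreal (D / 3) * (ennreal (L_hit \<omega> powr t) * indicator {\<omega> \<in> space M. hits \<omega>} \<omega>)"
      using L_hit_pos
    proof eventually_elim
      fix \<omega> assume pos: "hits \<omega> \<longrightarrow> 0 < L_hit \<omega>"
      show "(\<integral>\<^sup>+w\<in>{0<..}. ennreal (w powr (s - 1) / ((L_hit \<omega>)\<^sup>2 - L_hit \<omega> * w + w\<^sup>2)) \<partial>lborel) * indicator {\<omega> \<in> space M. hits \<omega>} \<omega>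
        = ennreal (D / 3) * (ennreal (L_hit \<omega> powr t) * indicator {\<omega> \<in> space M. hits \<omega>} \<omega>)"
      proof (cases "hits \<omega>")
        case True
        with pos have "0 < L_hit \<omega>" by simp
        have "(\<integral>\<^sup>+w\<in>{0<..}. ennreal (w powr (s - 1) / ((L_hit \<omega>)\<^sup>2 - L_hit \<omega> * w + w\<^sup>2)) \<partial>lborel) = ennreal (L_hit \<omega> powr t / 3 * D)"
          using nn_integral_rational_kernel[OF s \<open>0 < L_hit \<omega>\<close>] unfolding e D_def .
        also have "L_hit \<omega> powr t / 3 * D = D / 3 * L_hit \<omega> powr t" by simp
        also have "ennreal \<dots> = ennreal (D / 3) * ennreal (L_hit \<omega> powr t)" using D by (intro ennreal_mult') simp
        finally show ?thesis by (simp only: mult.assoc)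
      qed simp
    qed
  qed
  also have "\<dots> = ennreal (D / 3) * ?E" by (rule nn_integral_cmult) measurable
  also have "Gamma (a + 1 / 3) / 3 * (9 * \<bar>x\<bar>) powr (t / 3) * (Gamma a * Gamma (2 / 3 - a) / Gamma (2 / 3)) = D / 3 * ((9 * \<bar>x\<bar>) powr (t / 3) * C)"
  proof -
    have "Gamma (a + 1 / 3) * (Gamma a * Gamma (2 / 3 - a) / Gamma (2 / 3)) = D * C"
      unfolding D_def C_def e2 by (rule Mellin_transforms_agree[OF a])
    then have "Gamma (a + 1 / 3) * (Gamma a * Gamma (2 / 3 - a) / Gamma (2 / 3)) * ((9 * \<bar>x\<bar>) powr (t / 3) / 3) = D * C * ((9 * \<bar>x\<bar>) powr (t / 3) / 3)"
      by (simp only:)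
    then show ?thesis by (simp add: mult_ac)
  qed
  also have "ennreal (D / 3 * ((9 * \<bar>x\<bar>) powr (t / 3) * C)) = ennreal (D / 3) * ennreal ((9 * \<bar>x\<bar>) powr (t / 3) * C)"
    using D by (intro ennreal_mult') simp
  finally have "ennreal (D / 3) * ennreal ((9 * \<bar>x\<bar>) powr (t / 3) * C) = ennreal (D / 3) * ?E" .
  then have "ennreal ((9 * \<bar>x\<bar>) powr (t / 3) * C) = ?E"
    using D by (auto simp: ennreal_mult_cancel_left)
  then show ?thesis by (simp add: C_def)
qed

lemma distr_L_hit:
  assumes N: "prob_space N"
    and G: "distributed N lborel G (\<lambda>u. ennreal (gamma_density (5/6) u))"
    and Z: "distributed N lborel Z (\<lambda>u. ennreal (beta_density (1/6) (1/6) u))"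
    and ind: "prob_space.indep_var N borel G borel Z"
  shows "distr M borel L_hit = distr N borel (\<lambda>\<omega>. \<bar>9 * x\<bar> powr (1/3) * (G \<omega> / Z \<omega>) powr (1/3))"
proof -
  interpret N: prob_space N by fact
  define Y where "Y \<omega> = \<bar>9 * x\<bar> powr (1/3) * (G \<omega> / Z \<omega>) powr (1/3)" for \<omega>
  have [measurable]: "G \<in> borel_measurable N" "Z \<in> borel_measurable N"
    using distributed_measurable[OF G] distributed_measurable[OF Z] by auto
  have [measurable]: "Y \<in> borel_measurable N" unfolding Y_def by measurable
  have c: "0 < \<bar>9 * x\<bar>" using start_neg by simp
  \<comment> \<open>A priori only a sub-probability; its mass is recovered from the Mellin transform near \<open>0\<close>.\<close>
  define K where "K = density M (indicator {\<omega> \<in> space M. hits \<omega>} :: 'a \<Rightarrow> ennreal)"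
  have sK [simp, measurable_cong]: "sets K = sets M" "space K = space M" by (simp_all add: K_def)
  have K_int: "(\<integral>\<^sup>+x. f x \<partial>distr K borel L_hit) = (\<integral>\<^sup>+\<omega>. f (L_hit \<omega>) * indicator {\<omega> \<in> space M. hits \<omega>} \<omega> \<partial>M)"
    if [measurable]: "f \<in> borel_measurable borel" for f :: "real \<Rightarrow> ennreal"
    by (subst nn_integral_distr) (auto simp: K_def nn_integral_density mult.commute intro!: nn_integral_cong)
  have Y_Mellin: "(\<integral>\<^sup>+y. ennreal (y powr t) \<partial>distr N borel Y) =
      ennreal (\<bar>9 * x\<bar> powr (t / 3) * (Gamma (5/6 + t / 3) / Gamma (5/6) * (Gamma (1 / 3) / (Gamma (1 / 6) * Gamma (1 / 6)) * (Gamma (1/6 - t / 3) * Gamma (1 / 6) / Gamma (1/3 - t / 3)))))"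
    if "- 2 < t" "t < 0" for t
    using Mellin_gamma_beta_quotient(2)[OF N G Z ind c that]
    by (subst nn_integral_distr) (simp_all add: Y_def)
  have eq: "distr K borel L_hit = distr N borel Y"
  proof (rule Mellin_uniqueness[where a = "- 2"])
    have "emeasure K (space K) = emeasure M {\<omega> \<in> space M. hits \<omega>}"
      by (simp add: K_def emeasure_density cong: nn_integral_cong)
    then show "finite_measure (distr K borel L_hit)"
      by (intro finite_measure.finite_measure_distr finite_measureI) auto
    show "prob_space (distr N borel Y)" by (rule N.prob_space_distr) measurable
    show "AE y in distr K borel L_hit. 0 < y"
    proof -
      have "AE \<omega> in K. 0 < L_hit \<omega>"
        unfolding K_def using L_hit_pos by (subst AE_density) (auto simp: indicator_def elim!: eventually_mono)
      then show ?thesis by (subst AE_distr_iff) auto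
    qed
    show "AE y in distr N borel Y. 0 < y"
      using Mellin_gamma_beta_quotient(1)[OF N G Z ind c, of "- 1"] by (subst AE_distr_iff) (auto simp: Y_def)
    fix t :: real assume t: "- 2 < t" "t < 0"
    show "(\<integral>\<^sup>+y. ennreal (y powr t) \<partial>distr N borel Y) < \<infinity>" unfolding Y_Mellin[OF t] by simp
    have "(\<integral>\<^sup>+y. ennreal (y powr t) \<partial>distr K borel L_hit) = (\<integral>\<^sup>+\<omega>. ennreal (L_hit \<omega> powr t) * indicator {\<omega> \<in> space M. hits \<omega>} \<omega> \<partial>M)"
      by (rule K_int) measurable
    then show "(\<integral>\<^sup>+y. ennreal (y powr t) \<partial>distr K borel L_hit) = (\<integral>\<^sup>+y. ennreal (y powr t) \<partial>distr N borel Y)"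
      unfolding Y_Mellin[OF t] Mellin_L_hit[OF t] by (simp add: abs_mult)
  qed auto
  \<comment> \<open>The law on hitting paths has just been identified with a probability measure;
    full mass means that almost every path hits, so the restriction to hitting paths can be
    removed.\<close>
  have "emeasure (distr K borel L_hit) UNIV = 1"
    unfolding eq using N.emeasure_space_1 by (simp add: emeasure_distr)
  then have "emeasure M {\<omega> \<in> space M. hits \<omega>} = 1"
    by (simp add: emeasure_distr K_def emeasure_density cong: nn_integral_cong)
  then have "AE \<omega> in M. hits \<omega>"
    by (intro AE_I_eq_1) auto
  then have "AE \<omega> in M. indicator {\<omega> \<in> space M. hits \<omega>} \<omega> = (1 :: ennreal)"
    using AE_space[of M] by eventually_elim simp
  then have "K = M"
    unfolding K_def by (subst density_cong[where f' = "\<lambda>_. 1"]) (auto simp: density_1)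
  with eq show ?thesis unfolding Y_def[abs_def] by simp
qed

end

text \<open>Subtracting B 0 leaves all increments unchanged and makes the start exactly 0 at every
  sample point, which generating the path from grid increments requires.\<close>

lemma standard_brownian_motionD:
  assumes "standard_brownian_motion M B"
  shows "brownian M (\<lambda>t \<omega>. B t \<omega> - B 0 \<omega>)" "AE \<omega> in M. B 0 \<omega> = 0" "continuous_process M B"
proof -
  note * = assms[unfolded standard_brownian_motion_def]
  interpret prob_space M using * by blast
  have meas: "B t \<in> borel_measurable M" if "0 \<le> t" for t using * that by blast
  have cont: "continuous_on {0..} (\<lambda>t. B t \<omega>)" if "\<omega> \<in> space M" for \<omega> using * that by blast
  show "AE \<omega> in M. B 0 \<omega> = 0" using * by blast
  show "continuous_process M B" by unfold_locales (auto intro: meas cont)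
  show "brownian M (\<lambda>t \<omega>. B t \<omega> - B 0 \<omega>)"
  proof unfold_locales
    fix \<tau> :: "nat \<Rightarrow> real" and n :: nat assume "0 \<le> \<tau> 0" "\<And>i. i < n \<Longrightarrow> \<tau> i < \<tau> (Suc i)"
    then have "indep_vars (\<lambda>_. borel) (\<lambda>i \<omega>. B (\<tau> (Suc i)) \<omega> - B (\<tau> i) \<omega>) {..<n}" using * by blast
    then show "indep_vars (\<lambda>_. borel) (\<lambda>i \<omega>. B (\<tau> (Suc i)) \<omega> - B 0 \<omega> - (B (\<tau> i) \<omega> - B 0 \<omega>)) {..<n}" by simp
  next
    fix s t :: real assume "0 \<le> s" "s < t"
    then have "distributed M lborel (\<lambda>\<omega>. B t \<omega> - B s \<omega>) (normal_density 0 (sqrt (t - s)))" using * by blast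
    then show "distributed M lborel (\<lambda>\<omega>. B t \<omega> - B 0 \<omega> - (B s \<omega> - B 0 \<omega>)) (normal_density 0 (sqrt (t - s)))" by simp
  qed (auto intro!: borel_measurable_diff meas continuous_intros cont)
qed

theorem mainTheorem5:
  fixes M :: "'a measure" and B :: "real \<Rightarrow> 'a \<Rightarrow> real"
    and N :: "'b measure" and G Z :: "'b \<Rightarrow> real" and x :: real
  assumes "standard_brownian_motion M B"
    and "x < 0"
    and "prob_space N"
    and "distributed N lborel G (gamma_density (5/6))"
    and "distributed N lborel Z (beta_density (1/6) (1/6))"
    and "prob_space.indep_var N borel G borel Z"
  shows "distr M borel (L_at_T_zero B x 0) =
         distr N borel (\<lambda>\<omega>. \<bar>9 * x\<bar> powr (1/3) * (G \<omega> / Z \<omega>) powr (1/3))"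
proof -
  note bm = standard_brownian_motionD[OF assms(1)]
  let ?B = "\<lambda>t \<omega>. B t \<omega> - B 0 \<omega>"
  interpret B0: brownian M ?B by (rule bm)
  interpret S: started_below M ?B x by unfold_locales fact
  interpret B1: continuous_process M B by (rule bm)
  \<comment> \<open>Comparing image measures of almost surely equal functions requires measurability
    of both. For the original B this comes from the purely pathwise locale, which makes no
    assumption on B 0.\<close>
  interpret P: started_process M B x by unfold_locales fact
  have "distr M borel (L_at_T_zero B x 0) = distr M borel (L_at_T_zero ?B x 0)"
  proof (rule distr_cong_AE)
    show "AE \<omega> in M. L_at_T_zero B x 0 \<omega> = L_at_T_zero ?B x 0 \<omega>"
      using bm(2) by eventually_elim (simp add: L_at_T_zero_def T_zero_def X_proc_def L_proc_def)
    show "L_at_T_zero B x 0 \<in> borel_measurable M"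
      using P.L_hit_measurable by (simp add: P.L_hit_def[abs_def])
    show "L_at_T_zero ?B x 0 \<in> borel_measurable M"
      using S.L_hit_measurable by (simp add: S.L_hit_def[abs_def])
  qed auto
  also have "\<dots> = distr N borel (\<lambda>\<omega>. \<bar>9 * x\<bar> powr (1/3) * (G \<omega> / Z \<omega>) powr (1/3))"
    using S.distr_L_hit[OF assms(3-6)] by (simp add: S.L_hit_def[abs_def])
  finally show ?thesis .
qed

end
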